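(* Let $n\ge1$ and $\beta>0$. For every Lipschitz function $f$ on $\mathbb R^n$ satisfying $\int_{\mathbb R^n}e^{\beta f}dx=1$, \[ \operatorname{Ent}(e^{\beta f}):=\int_{\mathbb R^n}e^{\beta f}\log e^{\beta f}\,dx\le n\log\Big(\frac{\beta k_n}{e}\,\mathcal E_\infty(f)\Big),\qquad k_n=\Big(\frac{1}{n!\,\omega_n}\Big)^{\frac1n}. \] Moreover, equality holds for every function of the form $f(x)=c-b|Ax-a|$ with $a\in\mathbb R^n$, $b>0$, $c\in\mathbb R$, $A\in SL_n$, normalized so that $\int e^{\beta f}dx=1$.
   Context: $\omega_n=\pi^{n/2}/\Gamma(\frac n2+1)$. For $\xi\in\mathbb S^{n-1}$, $\nabla_\xi f=\nabla f\cdot\xi$ and $\|\nabla_\xi f\|_\infty$ is its $L^\infty(\mathbb R^n)$ norm. \[ \mathcal E_\infty(f)=(n\omega_n)^{\frac1n}\Big(\int_{\mathbb S^{n-1}}\|\nabla_\xi f\|_\infty^{-n}\,d\xi\Big)^{-\frac1n}, \] with $d\xi$ the surface measure on $\mathbb S^{n-1}$. $SL_n$ denotes real $n\times n$ matrices with determinant $1$. *)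

theory Defs
  imports "HOL-Analysis.Analysis" "HOL-Probability.Essential_Supremum"
begin

text \<open>Volume of the unit ball: omega_n = pi^(n/2) / Gamma(n/2 + 1).\<close>
definition omega :: "nat \<Rightarrow> real" where
  "omega n = pi powr (real n / 2) / Gamma (real n / 2 + 1)"

definition kconst :: "nat \<Rightarrow> real" where
  "kconst n = (1 / (fact n * omega n)) powr (1 / real n)"

text \<open>L-infinity norm (essential supremum w.r.t. Lebesgue measure) of the directional
  derivative grad f . xi; the gradient is taken where f is differentiable
  (almost everywhere for Lipschitz f), the value elsewhere is irrelevant.\<close>
definition dir_grad_sup :: "(real^'n \<Rightarrow> real) \<Rightarrow> real^'n \<Rightarrow> ereal" where
  "dir_grad_sup f \<xi> = esssup lborel
     (\<lambda>x. ereal \<bar>if f differentiable (at x) then frechet_derivative f (at x) \<xi> else 0\<bar>)"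

text \<open>Integral over the unit sphere S^(n-1) with respect to surface measure, for a
  nonnegative (extended) integrand, expressed through polar coordinates:
  integral over S of g = n * integral over the unit ball of g(x/|x|).\<close>
definition sphere_nn_integral :: "(real^'n \<Rightarrow> ennreal) \<Rightarrow> ennreal" where
  "sphere_nn_integral g =
     of_nat CARD('n) * (\<integral>\<^sup>+ x \<in> ball 0 1. g (x /\<^sub>R norm x) \<partial>lborel)"

definition E_inf :: "(real^'n \<Rightarrow> real) \<Rightarrow> real" where
  "E_inf f = (real CARD('n) * omega CARD('n)) powr (1 / real CARD('n)) *
     (enn2real (sphere_nn_integral (\<lambda>\<xi>. inverse (e2ennreal (dir_grad_sup f \<xi>)) ^ CARD('n))))
       powr (- 1 / real CARD('n))"

definition Ent :: "real \<Rightarrow> (real^'n \<Rightarrow> real) \<Rightarrow> ereal" where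
  "Ent \<beta> f =
     enn2ereal (\<integral>\<^sup>+ x. ennreal (max 0 (exp (\<beta> * f x) * ln (exp (\<beta> * f x)))) \<partial>lborel)
   - enn2ereal (\<integral>\<^sup>+ x. ennreal (max 0 (- (exp (\<beta> * f x) * ln (exp (\<beta> * f x))))) \<partial>lborel)"

end

theory Submission
  imports Defs "HOL-Probability.Distributions"
begin

text \<open>Let \<open>N \<xi>\<close> be the essential supremum of \<open>\<bar>\<nabla>f \<cdot> \<xi>\<bar>\<close>. By Rademacher's theorem \<open>f x - f (x + \<xi>) \<le> N \<xi>\<close>, so the
  Prekopa-Leindler inequality applies to the functions \<open>e\<^bsup>(1+1/k) \<beta> f\<^esup>\<close>, \<open>e\<^bsup>-(k+1) \<beta> N\<^esup>\<close> and \<open>e\<^bsup>\<beta> f\<^esup>\<close>; letting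
  \<open>k\<close> tend to infinity gives \<open>Ent (e\<^bsup>\<beta> f\<^esup>) \<le> n ln \<beta> - n - ln \<integral> e\<^bsup>-N\<^esup>\<close>. Polar coordinates turn \<open>\<integral> e\<^bsup>-N\<^esup>\<close> into
  \<open>(n - 1)!\<close> times the spherical integral of \<open>N\<^bsup>-n\<^esup>\<close>. For the cones \<open>c - b \<bar>A x - a\<bar>\<close> one has
  \<open>N \<xi> = b \<bar>A \<xi>\<bar>\<close>, and both sides are computed explicitly.\<close>

section \<open>The Prekopa-Leindler inequality\<close>

text \<open>The exponents are chosen for the limit. For F = e^((1+1/k) beta f) the power F^k is
  e^((k+1) beta f), so the hypothesis F(x)^k G(y) <= h(x+y)^(k+1) is the increment bound f(x) -
  f(x+y) <= N(y), multiplied by (k+1) beta and exponentiated. Natural exponents and sums x+y in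
  place of convex combinations keep real powers out of the extended reals; the price is the factor
  \<open>pl_const k\<close> = (1+1/k)^k (k+1) in each dimension. Dilating e^(-(k+1) beta N) absorbs
  (k+1)^n, and what remains tends to e^n, the origin of the e in the bound. Since exp s >= 1 + s,
  the integral of F is at least 1 + Ent/k, whose k-th power tends to e^Ent; this replaces
  differentiation under the integral. The obstacle is that N is an essential supremum: the bound on
  the derivative in one direction holds only off a null set, and a given segment may lie inside that
  set. Hence the increment bound is first proved for averages over translates of the
  segment.\<close>

lemma ennreal_add_le_of_less:
  fixes x y z :: ennreal
  assumes "0 < x" "0 < y" and le: "\<And>a b. a < x \<Longrightarrow> b < y \<Longrightarrow> a + b \<le> z"
  shows "x + y \<le> z"
proof -
  have 1: "x + b \<le> z" if "b < y" for b
  proof -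
    have "x + b = (SUP a\<in>{..<x}. a) + b"
      using Sup_lessThan[of x] by (simp add: Sup_lessThan)
    \<comment> \<open>Positivity makes \<open>{..<x}\<close> nonempty; over an empty index set the
      supremum would lose the summand \<open>b\<close>.\<close>
    also have "\<dots> = (SUP a\<in>{..<x}. a + b)"
      using assms by (intro ennreal_SUP_add_left[symmetric]) auto
    also have "\<dots> \<le> z"
      using le that by (intro SUP_least) auto
    finally show ?thesis .
  qed
  have "x + y = (SUP a\<in>{..<y}. a) + x"
    by (simp add: Sup_lessThan add.commute)
  also have "\<dots> = (SUP a\<in>{..<y}. a + x)"
    using assms by (intro ennreal_SUP_add_left[symmetric]) auto
  also have "\<dots> \<le> z"
    using 1 by (intro SUP_least) (auto simp: add.commute)
  finally show ?thesis .
qed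

text \<open>Inner regularity is applied to a finite measure: Lebesgue measure cut off by a ball so
  large that more than \<open>a\<close> of the mass of \<open>A\<close> remains.\<close>

lemma compact_approx_lborel:
  fixes A :: "'a::euclidean_space set"
  assumes A[measurable]: "A \<in> sets borel" and a: "a < emeasure lborel A"
  obtains K where "compact K" "K \<subseteq> A" "a < emeasure lborel K"
proof -
  have "emeasure lborel A = emeasure lborel (\<Union>n. A \<inter> cball 0 (real n))"
    by (rule arg_cong[of _ _ "emeasure lborel"]) (auto intro: real_arch_simple)
  also have "\<dots> = (SUP n. emeasure lborel (A \<inter> cball 0 (real n)))"
    by (intro SUP_emeasure_incseq[symmetric]) (auto simp: incseq_def)
  finally obtain n where n: "a < emeasure lborel (A \<inter> cball 0 (real n))"
    using a by (auto simp: less_SUP_iff)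
  let ?M = "density lborel (indicator (cball (0::'a) (real n)))"
  have M: "emeasure ?M B = emeasure lborel (B \<inter> cball 0 (real n))" if "B \<in> sets borel" for B
    using that by (subst emeasure_density) (auto simp: Int_commute borel_measurable_indicator simp flip: nn_integral_indicator indicator_inter_arith)
  have "emeasure ?M A = (SUP K\<in>{K. K \<subseteq> A \<and> compact K}. emeasure ?M K)"
    by (intro inner_regular) (auto simp: M less_imp_neq[OF emeasure_lborel_cball_finite[unfolded infinity_ennreal_def]])
  with n obtain K where K: "K \<subseteq> A" "compact K" "a < emeasure ?M K"
    by (auto simp: M less_SUP_iff)
  moreover have "emeasure ?M K \<le> emeasure lborel K"
    using K by (subst M) (auto intro!: emeasure_mono borel_compact)
  ultimately show ?thesis
    using that by (meson order_less_le_trans)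
qed

section \<open>The Brunn-Minkowski inequality on the line\<close>

lemma emeasure_lborel_translate:
  fixes A :: "'a::euclidean_space set"
  assumes [measurable]: "A \<in> sets borel"
  shows "emeasure lborel ((+) c ` A) = emeasure lborel A"
proof -
  have "emeasure lborel A = emeasure (distr lborel borel (\<lambda>x. - c + x)) A"
    by (simp only: lborel_distr_plus)
  also have "\<dots> = emeasure lborel ((\<lambda>x. - c + x) -` A)"
    by (subst emeasure_distr) auto
  also have "(\<lambda>x. - c + x) -` A = (+) c ` A"
    by (force simp: image_iff)
  finally show ?thesis by simp
qed

text \<open>For compact \<open>K\<close> and \<open>L\<close>, the translates of \<open>K\<close> by
  the least point of \<open>L\<close> and of \<open>L\<close> by the greatest point of
  \<open>K\<close> both lie in the sum set and meet in one point only, so their measures add up.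
  Inner approximation by compact sets gives the general case; if one set is null, a translate of the
  other suffices.\<close>

lemma brunn_minkowski_real:
  fixes A B C :: "real set"
  assumes [measurable]: "A \<in> sets borel" "B \<in> sets borel" "C \<in> sets borel"
    and ne: "A \<noteq> {}" "B \<noteq> {}" and sum: "\<And>x y. x \<in> A \<Longrightarrow> y \<in> B \<Longrightarrow> x + y \<in> C"
  shows "emeasure lborel A + emeasure lborel B \<le> emeasure lborel C"
proof -
  obtain a0 b0 where a0: "a0 \<in> A" "b0 \<in> B" using ne by auto
  have 1: "emeasure lborel B \<le> emeasure lborel C"
    using sum a0 by (subst emeasure_lborel_translate[of B a0, symmetric]) (auto intro!: emeasure_mono)
  have 2: "emeasure lborel A \<le> emeasure lborel C"
    using sum a0 by (subst emeasure_lborel_translate[of A b0, symmetric])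
      (auto intro!: emeasure_mono simp: add.commute)
  show ?thesis
  proof (cases "emeasure lborel A = 0 \<or> emeasure lborel B = 0")
    case True
    with 1 2 show ?thesis by auto
  next
    case False
    show ?thesis
    proof (rule ennreal_add_le_of_less)
      fix a b assume "a < emeasure lborel A" "b < emeasure lborel B"
      then obtain K L where K: "compact K" "K \<subseteq> A" "a < emeasure lborel K"
        and L: "compact L" "L \<subseteq> B" "b < emeasure lborel L"
        by (meson compact_approx_lborel assms(1,2))
      then have "K \<noteq> {}" "L \<noteq> {}" by auto
      then obtain k l where k: "k \<in> K" "\<And>x. x \<in> K \<Longrightarrow> x \<le> k" and l: "l \<in> L" "\<And>x. x \<in> L \<Longrightarrow> l \<le> x"
        using compact_attains_sup[of K] compact_attains_inf[of L] K L by metis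
      have [measurable]: "K \<in> sets borel" "L \<in> sets borel"
        using K L by (auto intro: borel_compact)
      have [measurable]: "(+) l ` K \<in> sets borel" "(+) k ` L \<in> sets borel"
        using K L by (auto intro!: borel_compact compact_translation)
      have "(+) l ` K \<inter> (+) k ` L \<subseteq> {k + l}"
        using k l by force
      then have "emeasure lborel ((+) l ` K \<inter> (+) k ` L) \<le> emeasure lborel {k + l}"
        by (intro emeasure_mono) auto
      then have 0: "emeasure lborel ((+) l ` K \<inter> (+) k ` L) = 0" by simp
      have "a + b \<le> emeasure lborel ((+) l ` K) + emeasure lborel ((+) k ` L)"
        using K L by (intro add_mono) (auto simp: emeasure_lborel_translate)
      also have "\<dots> = emeasure lborel ((+) l ` K \<union> (+) k ` L)"
        using emeasure_Un_Int[of "(+) l ` K" lborel "(+) k ` L"] 0 by simp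
      also have "\<dots> \<le> emeasure lborel C"
        using K L k l sum by (intro emeasure_mono) (auto, metis add.commute subsetD, metis subsetD)
      finally show "a + b \<le> emeasure lborel C" .
    qed (use False in \<open>auto simp: zero_less_iff_neq_zero\<close>)
  qed
qed

section \<open>Weighted AM-GM and the Prekopa-Leindler inequality on the line\<close>

lemma weighted_am_gm_power:
  fixes u v :: real
  assumes "0 \<le> u" "0 \<le> v" "0 < k"
  shows "real (k+1) ^ (k+1) * (u ^ k * v) \<le> real k ^ k * (u + v) ^ (k+1)"
proof (cases "u = 0")
  case True
  then show ?thesis using assms by (auto simp: power_0_left)
next
  case False
  \<comment> \<open>This ratio equals 1 exactly for \<open>u = k * v\<close>, the equality case of
    the claim, and Bernoulli's inequality is sharp at 1.\<close>
  define w where "w = real k * (u + v) / (real (k+1) * u)"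
  have u: "u > 0" using False assms by simp
  have w: "real (k+1) * u * w = real k * (u + v)"
    unfolding w_def using u by simp
  have "1 + real (k+1) * (w - 1) \<le> w ^ (k+1)"
    using Bernoulli_inequality[of "w - 1" "k+1"] u assms by (simp add: w_def)
  moreover have "u * (1 + real (k+1) * (w - 1)) = real k * v"
    using w by (simp add: algebra_simps)
  ultimately have "real k * v \<le> u * w ^ (k+1)"
    using u by (metis mult_left_mono less_imp_le)
  then have "(real (k+1) ^ (k+1) * u ^ k) * (real k * v) \<le> (real (k+1) ^ (k+1) * u ^ k) * (u * w ^ (k+1))"
    using u by (intro mult_left_mono) auto
  also have "\<dots> = (real (k+1) * u * w) ^ (k+1)"
    by (simp add: power_mult_distrib)
  also have "\<dots> = real k * (real k ^ k * (u + v) ^ (k+1))"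
    unfolding w by (simp add: power_mult_distrib)
  finally have "real k * (real (k+1) ^ (k+1) * (u ^ k * v)) \<le> real k * (real k ^ k * (u + v) ^ (k+1))"
    by (simp add: algebra_simps)
  then show ?thesis
    using assms by simp
qed

text \<open>The reciprocal of the maximum of \<open>u\<^sup>k v\<close> subject to \<open>u + v = 1\<close>.\<close>
definition pl_const :: "nat \<Rightarrow> real" where
  "pl_const k = real (k+1) ^ (k+1) / real k ^ k"

lemma pl_const_pos: "0 < k \<Longrightarrow> 0 < pl_const k"
  by (simp add: pl_const_def)

lemma weighted_am_gm_ennreal:
  fixes u v :: ennreal
  assumes k: "0 < k"
  shows "ennreal (pl_const k) * (u ^ k * v) \<le> (u + v) ^ (k+1)"
proof (cases "u = top \<or> v = top")
  case True
  then have "(u + v) ^ (k+1) = top" by (auto simp: power_eq_top_ennreal)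
  then show ?thesis by (simp only: top_greatest)
next
  case False
  then obtain a b where [simp]: "u = ennreal a" "v = ennreal b" "0 \<le> a" "0 \<le> b"
    by (metis ennreal_cases)
  have "pl_const k * (a ^ k * b) \<le> (a + b) ^ (k+1)"
    using weighted_am_gm_power[of a b k] k by (simp add: pl_const_def divide_simps mult_ac)
  then show ?thesis
    using pl_const_pos[OF k]
    by (simp add: ennreal_leI ennreal_power del: power_Suc flip: ennreal_plus ennreal_mult'')
qed

text \<open>Tonelli for the region below the graph, cut off at height 1. Once the suprema are
  normalized to 1, these are the heights at which superlevel sets are nonempty, as Brunn-Minkowski
  demands.\<close>

lemma nn_integral_layer_cake_unit:
  fixes f :: "real \<Rightarrow> ennreal"
  assumes [measurable]: "f \<in> borel_measurable borel"
  shows "(\<integral>\<^sup>+t\<in>{0..<1}. emeasure lborel {x. ennreal t < f x} \<partial>lborel) = (\<integral>\<^sup>+x. min (f x) 1 \<partial>lborel)"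
proof -
  have "(\<integral>\<^sup>+t\<in>{0..<1}. emeasure lborel {x. ennreal t < f x} \<partial>lborel) =
      (\<integral>\<^sup>+t. (\<integral>\<^sup>+x. indicator {t. 0 \<le> t \<and> t < 1 \<and> ennreal t < f x} t \<partial>lborel) \<partial>lborel)"
  proof (intro nn_integral_cong)
    fix t :: real
    have "emeasure lborel {x. ennreal t < f x} = (\<integral>\<^sup>+x. indicator {x. ennreal t < f x} x \<partial>lborel)"
      by (subst nn_integral_indicator) auto
    then show "emeasure lborel {x. ennreal t < f x} * indicator {0..<1} t =
       (\<integral>\<^sup>+x. indicator {t. 0 \<le> t \<and> t < 1 \<and> ennreal t < f x} t \<partial>lborel)"
      by (auto simp: indicator_def intro!: nn_integral_cong)
  qed
  also have "\<dots> = (\<integral>\<^sup>+x. (\<integral>\<^sup>+t. indicator {t. 0 \<le> t \<and> t < 1 \<and> ennreal t < f x} t \<partial>lborel) \<partial>lborel)"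
    by (rule lborel_pair.Fubini') measurable
  also have "\<dots> = (\<integral>\<^sup>+x. min (f x) 1 \<partial>lborel)"
  proof (intro nn_integral_cong)
    fix x
    have "(\<integral>\<^sup>+t. indicator {t. 0 \<le> t \<and> t < 1 \<and> ennreal t < f x} t \<partial>lborel) =
      emeasure lborel {t. 0 \<le> t \<and> t < 1 \<and> ennreal t < f x}"
      by (subst nn_integral_indicator) auto
    also have "\<dots> = min (f x) 1"
    proof (cases "f x")
      case (real r)
      then have "{t. 0 \<le> t \<and> t < 1 \<and> ennreal t < f x} = {0..<min r 1}"
        by (auto simp: ennreal_less_iff)
      with real show ?thesis
        by (simp add: min_def flip: ennreal_1)
    next
      case top
      then have "{t. 0 \<le> t \<and> t < 1 \<and> ennreal t < f x} = {0..<1}"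
        by auto
      with top show ?thesis by simp
    qed
    finally show "(\<integral>\<^sup>+t. indicator {t. 0 \<le> t \<and> t < 1 \<and> ennreal t < f x} t \<partial>lborel) = min (f x) 1" .
  qed
  finally show ?thesis .
qed

text \<open>If \<open>F x\<close> and \<open>G y\<close> both exceed \<open>t\<close>, then
  \<open>h (x + y) ^ (k+1)\<close> exceeds \<open>t ^ (k+1)\<close>; so each superlevel set of
  \<open>h\<close> contains the sum of those of \<open>F\<close> and \<open>G\<close>.
  Brunn-Minkowski at every height and integration over the heights give the additive form of the
  inequality.\<close>

lemma prekopa_leindler_real_normalized:
  fixes F G h :: "real \<Rightarrow> ennreal"
  assumes [measurable]: "F \<in> borel_measurable borel" "G \<in> borel_measurable borel" "h \<in> borel_measurable borel"
    and le: "\<And>x. F x \<le> 1" "\<And>x. G x \<le> 1"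
    and sup: "\<And>t. t < 1 \<Longrightarrow> \<exists>x. t < F x" "\<And>t. t < 1 \<Longrightarrow> \<exists>x. t < G x"
    and h: "\<And>x y. F x ^ k * G y \<le> h (x + y) ^ (k+1)"
  shows "(\<integral>\<^sup>+x. F x \<partial>lborel) + (\<integral>\<^sup>+x. G x \<partial>lborel) \<le> (\<integral>\<^sup>+x. h x \<partial>lborel)"
proof -
  have bm: "emeasure lborel {x. ennreal t < F x} + emeasure lborel {x. ennreal t < G x}
      \<le> emeasure lborel {x. ennreal t < h x}" if t: "0 \<le> t" "t < 1" for t
  proof (rule brunn_minkowski_real)
    have t1: "ennreal t < 1" using t by (simp add: ennreal_less_iff flip: ennreal_1)
    show "{x. ennreal t < F x} \<noteq> {}" "{x. ennreal t < G x} \<noteq> {}"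
      using sup[OF t1] by auto
    fix x y assume "x \<in> {x. ennreal t < F x}" "y \<in> {x. ennreal t < G x}"
    then have xy: "ennreal t < F x" "ennreal t < G y" by auto
    show "x + y \<in> {x. ennreal t < h x}"
    proof (rule ccontr)
      assume "x + y \<notin> {x. ennreal t < h x}"
      then have "h (x + y) ^ (k+1) \<le> ennreal t ^ (k+1)"
        by (intro power_mono_ennreal) auto
      with h[of x y] have *: "F x ^ k * G y \<le> ennreal t ^ k * ennreal t"
        by (simp add: mult.commute)
      obtain a b where ab: "F x = ennreal a" "G y = ennreal b" "0 \<le> a" "0 \<le> b"
        using le[of x] le(2)[of y] by (metis ennreal_cases neq_top_trans ennreal_one_neq_top)
      then have tab: "t < a" "t < b" using xy t by (auto simp: ennreal_less_iff)
      \<comment> \<open>Strictness is left to the last factor, where \<open>a > t \<ge> 0\<close>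
        guarantees \<open>a ^ k > 0\<close>.\<close>
      have "t ^ k * t \<le> a ^ k * t"
        using tab t by (intro mult_right_mono power_mono) auto
      also have "\<dots> < a ^ k * b"
        using tab t by (intro mult_strict_left_mono zero_less_power) auto
      finally have "t ^ k * t < a ^ k * b" .
      with * show False
        using ab t by (simp add: ennreal_power not_le flip: ennreal_mult'')
    qed
  qed auto
  have "(\<integral>\<^sup>+x. F x \<partial>lborel) + (\<integral>\<^sup>+x. G x \<partial>lborel) =
     (\<integral>\<^sup>+x. min (F x) 1 \<partial>lborel) + (\<integral>\<^sup>+x. min (G x) 1 \<partial>lborel)"
    using le by (simp add: min_absorb1)
  also have "\<dots> = (\<integral>\<^sup>+t. emeasure lborel {x. ennreal t < F x} * indicator {0..<1} t
       + emeasure lborel {x. ennreal t < G x} * indicator {0..<1} t \<partial>lborel)"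
    unfolding nn_integral_layer_cake_unit[OF assms(1), symmetric] nn_integral_layer_cake_unit[OF assms(2), symmetric]
    by (rule nn_integral_add[symmetric]) measurable
  also have "\<dots> \<le> (\<integral>\<^sup>+t. emeasure lborel {x. ennreal t < h x} * indicator {0..<1} t \<partial>lborel)"
    using bm by (intro nn_integral_mono) (auto simp: indicator_def)
  also have "\<dots> = (\<integral>\<^sup>+x. min (h x) 1 \<partial>lborel)"
    by (rule nn_integral_layer_cake_unit) measurable
  also have "\<dots> \<le> (\<integral>\<^sup>+x. h x \<partial>lborel)"
    by (intro nn_integral_mono) simp
  finally show ?thesis .
qed

text \<open>The additive form presupposes suprema equal to 1. Dividing \<open>F\<close> and
  \<open>G\<close> by their suprema \<open>a\<close> and \<open>b\<close>, and \<open>h\<close> by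
  the \<open>c\<close> with \<open>c ^ (k+1) = a ^ k * b\<close>, preserves the hypothesis; AM-GM
  then turns the sum of integrals into a product, from which the scaling factors cancel.\<close>

lemma prekopa_leindler_real_bounded:
  fixes F G h :: "real \<Rightarrow> ennreal"
  assumes k: "0 < k"
    and [measurable]: "F \<in> borel_measurable borel" "G \<in> borel_measurable borel" "h \<in> borel_measurable borel"
    and bdd: "(SUP x. F x) < top" "(SUP x. G x) < top"
    and h: "\<And>x y. F x ^ k * G y \<le> h (x + y) ^ (k+1)"
  shows "ennreal (pl_const k) * ((\<integral>\<^sup>+x. F x \<partial>lborel) ^ k * (\<integral>\<^sup>+x. G x \<partial>lborel)) \<le> (\<integral>\<^sup>+x. h x \<partial>lborel) ^ (k+1)"
proof (cases "(SUP x. F x) = 0 \<or> (SUP x. G x) = 0")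
  case True
  then have "(\<forall>x. F x = 0) \<or> (\<forall>x. G x = 0)" by (simp add: SUP_eq_iff bot_ennreal flip: bot_ennreal)
  then show ?thesis using k by (auto simp: power_0_left)
next
  case False
  obtain a where a: "(SUP x. F x) = ennreal a" "a > 0"
    using bdd False by (cases "SUP x. F x") (auto simp: less_le)
  obtain b where b: "(SUP x. G x) = ennreal b" "b > 0"
    using bdd False by (cases "SUP x. G x") (auto simp: less_le)
  define c where "c = root (k+1) (a ^ k * b)"
  have c: "c > 0" "c ^ (k+1) = a ^ k * b"
    using a b unfolding c_def by (simp_all del: power_Suc)
  have cc: "(1/c) ^ (k+1) = (1/a) ^ k * (1/b)"
    unfolding power_one_over c by (simp add: power_one_over)
  have "ennreal (1/a) ^ k * ennreal (1/b) = ennreal ((1/a) ^ k * (1/b))"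
    using a b by (simp only: ennreal_power ennreal_mult'' less_imp_le divide_nonneg_nonneg zero_le_one zero_le_power)
  then have eq: "ennreal (1/a) ^ k * ennreal (1/b) = ennreal ((1/c) ^ (k+1))"
      "ennreal (1/c) ^ (k+1) = ennreal ((1/c) ^ (k+1))"
    using c(1) by (simp_all only: cc ennreal_power less_imp_le divide_nonneg_nonneg zero_le_one)
  let ?F = "\<lambda>x. ennreal (1/a) * F x" and ?G = "\<lambda>x. ennreal (1/b) * G x" and ?h = "\<lambda>x. ennreal (1/c) * h x"
  have sup: "\<exists>x. t < ennreal (1/s) * f x" if t: "t < 1" and s: "(SUP x. f x) = ennreal s" "s > 0"
    for t s and f :: "real \<Rightarrow> ennreal"
  proof -
    have "1 = ennreal (1/s) * (SUP x. f x)"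
      using s by (simp flip: ennreal_mult'')
    also have "\<dots> = (SUP x. ennreal (1/s) * f x)"
      by (rule SUP_mult_left_ennreal)
    finally have "t < (SUP x. ennreal (1/s) * f x)"
      using t by simp
    then show ?thesis
      by (auto simp: less_SUP_iff)
  qed
  have le: "ennreal (1/s) * f x \<le> 1" if s: "(SUP x. f x) = ennreal s" "s > 0"
    for s x and f :: "real \<Rightarrow> ennreal"
  proof -
    have "ennreal (1/s) * f x \<le> ennreal (1/s) * ennreal s"
      unfolding s(1)[symmetric] by (intro mult_left_mono SUP_upper) auto
    then show ?thesis using s by (simp flip: ennreal_mult'')
  qed
  have "(\<integral>\<^sup>+x. ?F x \<partial>lborel) + (\<integral>\<^sup>+x. ?G x \<partial>lborel) \<le> (\<integral>\<^sup>+x. ?h x \<partial>lborel)"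
  proof (rule prekopa_leindler_real_normalized)
    show "?F x ^ k * ?G y \<le> ?h (x + y) ^ (k + 1)" for x y
    proof -
      have "?F x ^ k * ?G y = (ennreal (1/a) ^ k * ennreal (1/b)) * (F x ^ k * G y)"
        by (simp add: power_mult_distrib mult_ac)
      also have "ennreal (1/a) ^ k * ennreal (1/b) = ennreal (1/c) ^ (k+1)"
        by (simp only: eq)
      also have "ennreal (1/c) ^ (k+1) * (F x ^ k * G y) \<le> ennreal (1/c) ^ (k+1) * h (x + y) ^ (k + 1)"
        by (intro mult_left_mono h) auto
      finally show ?thesis by (simp add: power_mult_distrib mult_ac)
    qed
  qed (use sup le a b in auto)
  then have "(\<integral>\<^sup>+x. ?F x \<partial>lborel) + (\<integral>\<^sup>+x. ?G x \<partial>lborel) \<le> ennreal (1/c) * (\<integral>\<^sup>+x. h x \<partial>lborel)"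
    by (subst (asm) (3) nn_integral_cmult) auto
  then have "((\<integral>\<^sup>+x. ?F x \<partial>lborel) + (\<integral>\<^sup>+x. ?G x \<partial>lborel)) ^ (k+1) \<le> (ennreal (1/c) * (\<integral>\<^sup>+x. h x \<partial>lborel)) ^ (k+1)"
    by (intro power_mono_ennreal)
  then have "ennreal (pl_const k) * ((\<integral>\<^sup>+x. ?F x \<partial>lborel) ^ k * (\<integral>\<^sup>+x. ?G x \<partial>lborel)) \<le> (ennreal (1/c) * (\<integral>\<^sup>+x. h x \<partial>lborel)) ^ (k+1)"
    by (rule order_trans[OF weighted_am_gm_ennreal[OF k]])
  also have "(\<integral>\<^sup>+x. ?F x \<partial>lborel) = ennreal (1/a) * (\<integral>\<^sup>+x. F x \<partial>lborel)"
    by (rule nn_integral_cmult) auto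
  also have "(\<integral>\<^sup>+x. ?G x \<partial>lborel) = ennreal (1/b) * (\<integral>\<^sup>+x. G x \<partial>lborel)"
    by (rule nn_integral_cmult) auto
  finally have *: "(ennreal (1/a) ^ k * ennreal (1/b)) * (ennreal (pl_const k) * ((\<integral>\<^sup>+x. F x \<partial>lborel) ^ k * (\<integral>\<^sup>+x. G x \<partial>lborel)))
     \<le> ennreal (1/c) ^ (k+1) * (\<integral>\<^sup>+x. h x \<partial>lborel) ^ (k+1)"
    by (simp add: power_mult_distrib mult_ac)
  have "ennreal (c ^ (k+1)) * (ennreal ((1/c) ^ (k+1)) * X) = X" for X
  proof -
    have "ennreal (c ^ (k+1)) * ennreal ((1/c) ^ (k+1)) = 1"
      using c(1) by (simp add: power_one_over flip: ennreal_mult'' del: power_Suc)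
    then show ?thesis by (simp add: mult.assoc[symmetric])
  qed
  then show ?thesis
    using mult_left_mono[OF *[unfolded eq], of "ennreal (c ^ (k+1))"] by simp
qed

lemma SUP_mult_SUP_le_ennreal:
  fixes f g :: "nat \<Rightarrow> ennreal"
  assumes "incseq f" "incseq g"
  shows "(SUP i. f i) * (SUP i. g i) \<le> (SUP i. f i * g i)"
proof -
  have "(SUP i. f i) * (SUP j. g j) = (SUP i. SUP j. f i * g j)"
    unfolding SUP_mult_right_ennreal[of f UNIV "SUP j. g j"] by (simp only: SUP_mult_left_ennreal)
  also have "\<dots> \<le> (SUP i. f i * g i)"
  proof (intro SUP_least)
    fix i j
    have "f i * g j \<le> f (max i j) * g (max i j)"
      using assms by (intro mult_mono) (auto simp: incseq_def)
    also have "\<dots> \<le> (SUP i. f i * g i)" by (intro SUP_upper) auto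
    finally show "f i * g j \<le> (SUP i. f i * g i)" .
  qed
  finally show ?thesis .
qed

lemma SUP_power_le_ennreal:
  fixes f :: "nat \<Rightarrow> ennreal"
  assumes "incseq f"
  shows "(SUP i. f i) ^ n \<le> (SUP i. f i ^ n)"
proof (induction n)
  case (Suc n)
  have "(SUP i. f i) ^ Suc n \<le> (SUP i. f i) * (SUP i. f i ^ n)"
    using Suc by (auto intro: mult_left_mono)
  also have "\<dots> \<le> (SUP i. f i * f i ^ n)"
    using assms by (intro SUP_mult_SUP_le_ennreal) (auto simp: incseq_def intro: power_mono_ennreal)
  finally show ?case by simp
qed simp

lemma nn_integral_SUP_truncate:
  fixes f :: "real \<Rightarrow> ennreal"
  assumes [measurable]: "f \<in> borel_measurable borel"
  shows "(\<integral>\<^sup>+x. f x \<partial>lborel) = (SUP j. \<integral>\<^sup>+x. min (f x) (of_nat j) \<partial>lborel)"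
proof -
  have *: "f x = (SUP j. min (f x) (of_nat j))" for x
    using inf_SUP[of "f x" "of_nat :: nat \<Rightarrow> ennreal" UNIV] ennreal_SUP_of_nat_eq_top
    by (simp add: inf_min)
  have "(\<integral>\<^sup>+x. f x \<partial>lborel) = (\<integral>\<^sup>+x. (SUP j. min (f x) (of_nat j)) \<partial>lborel)"
    using * by simp
  also have "\<dots> = (SUP j. \<integral>\<^sup>+x. min (f x) (of_nat j) \<partial>lborel)"
    by (intro nn_integral_monotone_convergence_SUP) (auto simp: incseq_def le_fun_def intro: min.mono order_trans[OF min.cobounded2])
  finally show ?thesis .
qed

text \<open>Truncating \<open>F\<close> and \<open>G\<close> at height \<open>j\<close> only weakens
  the left side of the hypothesis, so \<open>h\<close> may stay the same; monotone convergence
  removes the truncation.\<close>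

theorem prekopa_leindler_real:
  fixes F G h :: "real \<Rightarrow> ennreal"
  assumes k: "0 < k"
    and [measurable]: "F \<in> borel_measurable borel" "G \<in> borel_measurable borel" "h \<in> borel_measurable borel"
    and h: "\<And>x y. F x ^ k * G y \<le> h (x + y) ^ (k+1)"
  shows "ennreal (pl_const k) * ((\<integral>\<^sup>+x. F x \<partial>lborel) ^ k * (\<integral>\<^sup>+x. G x \<partial>lborel)) \<le> (\<integral>\<^sup>+x. h x \<partial>lborel) ^ (k+1)"
proof -
  let ?F = "\<lambda>j. \<integral>\<^sup>+x. min (F x) (of_nat j) \<partial>lborel" and ?G = "\<lambda>j. \<integral>\<^sup>+x. min (G x) (of_nat j) \<partial>lborel"
  have inc: "incseq ?F" "incseq ?G"
    by (auto simp: incseq_def intro!: nn_integral_mono min.mono)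
  have "(\<integral>\<^sup>+x. F x \<partial>lborel) ^ k * (\<integral>\<^sup>+x. G x \<partial>lborel) \<le> (SUP j. ?F j ^ k) * (SUP j. ?G j)"
    unfolding nn_integral_SUP_truncate[OF assms(2)] nn_integral_SUP_truncate[OF assms(3)]
    by (intro mult_right_mono SUP_power_le_ennreal inc) auto
  also have "\<dots> \<le> (SUP j. ?F j ^ k * ?G j)"
    using inc by (intro SUP_mult_SUP_le_ennreal) (auto simp: incseq_def intro: power_mono_ennreal)
  finally have "ennreal (pl_const k) * ((\<integral>\<^sup>+x. F x \<partial>lborel) ^ k * (\<integral>\<^sup>+x. G x \<partial>lborel)) \<le>
     (SUP j. ennreal (pl_const k) * (?F j ^ k * ?G j))"
    by (simp add: mult_left_mono flip: SUP_mult_left_ennreal)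
  also have "\<dots> \<le> (\<integral>\<^sup>+x. h x \<partial>lborel) ^ (k+1)"
  proof (intro SUP_least prekopa_leindler_real_bounded k)
    fix j :: nat
    have "(SUP x. min (f x) (of_nat j)) < top" for f :: "real \<Rightarrow> ennreal"
      by (rule le_less_trans[of _ "of_nat j"]) (auto intro!: SUP_least simp: of_nat_less_top)
    then show "(SUP x. min (F x) (of_nat j)) < top" "(SUP x. min (G x) (of_nat j)) < top"
      by auto
    fix x y
    have "min (F x) (of_nat j) ^ k * min (G y) (of_nat j) \<le> F x ^ k * G y"
      by (intro mult_mono power_mono_ennreal) auto
    also note h
    finally show "min (F x) (of_nat j) ^ k * min (G y) (of_nat j) \<le> h (x + y) ^ (k + 1)" .
  qed auto
  finally show ?thesis .
qed

section \<open>The Prekopa-Leindler inequality in several variables, by induction on the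
  dimension\<close>

lemma prekopa_leindler_PiM:
  fixes F G h :: "('i \<Rightarrow> real) \<Rightarrow> ennreal"
  assumes k: "0 < k" and "finite I"
    and "F \<in> borel_measurable (\<Pi>\<^sub>M i\<in>I. lborel)" "G \<in> borel_measurable (\<Pi>\<^sub>M i\<in>I. lborel)"
      "h \<in> borel_measurable (\<Pi>\<^sub>M i\<in>I. lborel)"
    and "\<And>x y. x \<in> extensional I \<Longrightarrow> y \<in> extensional I \<Longrightarrow>
      F x ^ k * G y \<le> h (\<lambda>i\<in>I. x i + y i) ^ (k+1)"
  shows "ennreal (pl_const k) ^ card I * ((\<integral>\<^sup>+x. F x \<partial>(\<Pi>\<^sub>M i\<in>I. lborel)) ^ k * (\<integral>\<^sup>+x. G x \<partial>(\<Pi>\<^sub>M i\<in>I. lborel)))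
    \<le> (\<integral>\<^sup>+x. h x \<partial>(\<Pi>\<^sub>M i\<in>I. lborel)) ^ (k+1)"
proof -
  interpret lborel_prod: product_sigma_finite "\<lambda>_. lborel :: real measure" ..
  show ?thesis
    using assms(2-)
  proof (induction I arbitrary: F G h rule: finite_induct)
    case empty
    have [simp]: "(\<lambda>x. undefined) \<in> extensional {}" by (simp add: extensional_def)
    from empty(4)[of "\<lambda>_. undefined" "\<lambda>_. undefined"] show ?case
      by (simp add: lborel_prod.nn_integral_empty restrict_def)
  next
    case (insert i I)
    note [measurable] = insert.prems(1-3)
    let ?P = "\<Pi>\<^sub>M i\<in>I. (lborel :: real measure)"
    let ?c = "ennreal (pl_const k) ^ card I"
    let ?S = "\<lambda>f s. \<integral>\<^sup>+x. f (x(i := s)) \<partial>?P"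
    have rev: "(\<integral>\<^sup>+x. f x \<partial>(\<Pi>\<^sub>M i\<in>insert i I. lborel)) = (\<integral>\<^sup>+s. ?S f s \<partial>lborel)"
      if "f \<in> borel_measurable (\<Pi>\<^sub>M i\<in>insert i I. lborel)" for f :: "('i \<Rightarrow> real) \<Rightarrow> ennreal"
      using that insert.hyps by (intro lborel_prod.product_nn_integral_insert_rev) auto
    have sec: "?S f \<in> borel_measurable borel"
      if [measurable]: "f \<in> borel_measurable (\<Pi>\<^sub>M i\<in>insert i I. lborel)" for f :: "('i \<Rightarrow> real) \<Rightarrow> ennreal"
    proof -
      interpret I: finite_product_sigma_finite "\<lambda>_. lborel :: real measure" I
        by standard (use insert.hyps in auto)
      have "?S f \<in> borel_measurable lborel"
        by (rule I.borel_measurable_nn_integral) measurable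
      then show ?thesis by simp
    qed
    \<comment> \<open>By the induction hypothesis the slice integrals satisfy the one-dimensional
      hypothesis up to the constant \<open>?c\<close>. It is attached to \<open>G\<close>, which
      enters to the first power only.\<close>
    have 1: "ennreal (pl_const k) * ((\<integral>\<^sup>+s. ?S F s \<partial>lborel) ^ k * (\<integral>\<^sup>+s. ?c * ?S G s \<partial>lborel)) \<le>
      (\<integral>\<^sup>+s. ?S h s \<partial>lborel) ^ (k+1)"
    proof (rule prekopa_leindler_real[OF k])
      fix s t :: real
      have "?c * (?S F s ^ k * ?S G t) \<le> ?S h (s + t) ^ (k+1)"
      proof (rule insert.IH)
        fix x y :: "'i \<Rightarrow> real" assume xy: "x \<in> extensional I" "y \<in> extensional I"
        have ext: "x(i := s) \<in> extensional (insert i I)" "y(i := t) \<in> extensional (insert i I)"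
          using xy by (auto simp: extensional_def)
        have eq: "(\<lambda>j\<in>insert i I. (x(i := s)) j + (y(i := t)) j) = (\<lambda>j\<in>I. x j + y j)(i := s + t)"
          using insert.hyps by (auto simp: fun_eq_iff)
        then show "F (x(i := s)) ^ k * G (y(i := t)) \<le> h ((\<lambda>j\<in>I. x j + y j)(i := s + t)) ^ (k+1)"
          using insert.prems(4)[OF ext] by (simp only: eq)
      qed measurable
      then show "?S F s ^ k * (?c * ?S G t) \<le> ?S h (s + t) ^ (k+1)"
        by (simp add: mult_ac)
      show "?S F \<in> borel_measurable borel" "?S h \<in> borel_measurable borel"
        by (rule sec, fact)+
      show "(\<lambda>s. ?c * ?S G s) \<in> borel_measurable borel"
        using sec[OF insert.prems(2)] by (rule borel_measurable_times_ennreal[OF borel_measurable_const])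
    qed
    have "(\<integral>\<^sup>+s. ?c * ?S G s \<partial>lborel) = ?c * (\<integral>\<^sup>+s. ?S G s \<partial>lborel)"
      by (intro nn_integral_cmult) (simp add: sec)
    with 1 show ?case
      using insert.hyps by (simp add: rev mult_ac)
  qed
qed

theorem prekopa_leindler:
  fixes F G h :: "'a::euclidean_space \<Rightarrow> ennreal"
  assumes k: "0 < k"
    and [measurable]: "F \<in> borel_measurable borel" "G \<in> borel_measurable borel" "h \<in> borel_measurable borel"
    and h: "\<And>x y. F x ^ k * G y \<le> h (x + y) ^ (k+1)"
  shows "ennreal (pl_const k) ^ DIM('a) * ((\<integral>\<^sup>+x. F x \<partial>lborel) ^ k * (\<integral>\<^sup>+x. G x \<partial>lborel)) \<le> (\<integral>\<^sup>+x. h x \<partial>lborel) ^ (k+1)"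
proof -
  let ?P = "\<Pi>\<^sub>M b\<in>(Basis::'a set). (lborel :: real measure)"
  let ?T = "\<lambda>f. \<Sum>b\<in>(Basis::'a set). f b *\<^sub>R b"
  have eq: "(\<integral>\<^sup>+x. f x \<partial>lborel) = (\<integral>\<^sup>+x. f (?T x) \<partial>?P)" if "f \<in> borel_measurable borel"
    for f :: "'a \<Rightarrow> ennreal"
    using that by (subst lborel_eq) (simp add: nn_integral_distr)
  have T[measurable]: "?T \<in> ?P \<rightarrow>\<^sub>M borel" by measurable
  show ?thesis
    unfolding eq[OF assms(2)] eq[OF assms(3)] eq[OF assms(4)]
  proof (rule prekopa_leindler_PiM[OF k])
    fix x y :: "'a \<Rightarrow> real"
    have "?T x + ?T y = ?T (\<lambda>i\<in>Basis. x i + y i)"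
      by (simp add: sum.distrib scaleR_add_left)
    then show "F (?T x) ^ k * G (?T y) \<le> h (?T (\<lambda>i\<in>Basis. x i + y i)) ^ (k+1)"
      using h[of "?T x" "?T y"] by simp
  qed measurable
qed

section \<open>Polar integration of homogeneous functions\<close>

lemma nn_integral_scaleR_lborel:
  fixes g :: "'a::euclidean_space \<Rightarrow> ennreal"
  assumes [measurable]: "g \<in> borel_measurable borel" and t: "t > 0"
  shows "(\<integral>\<^sup>+x. g x \<partial>lborel) = ennreal (t ^ DIM('a)) * (\<integral>\<^sup>+x. g (t *\<^sub>R x) \<partial>lborel)"
  using t by (subst lborel_affine[of t 0])
    (simp_all add: nn_integral_density nn_integral_distr nn_integral_cmult)

text \<open>Used with \<open>r = norm y\<close>: integrating out the auxiliary radius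
  \<open>t\<close> leaves the reciprocal of the weight \<open>n * norm y ^ n\<close>.\<close>

lemma nn_integral_power_tail:
  fixes r :: real
  assumes "r > 0" "0 < n"
  shows "(\<integral>\<^sup>+t. ennreal (1 / t ^ (n+1)) * (if r < t then 1 else 0) \<partial>lborel) = ennreal (1 / (real n * r ^ n))"
proof -
  have "(\<integral>\<^sup>+t. ennreal (1 / t ^ (n+1)) * (if r < t then 1 else 0) \<partial>lborel) = (\<integral>\<^sup>+t. ennreal (1 / t ^ (n+1)) * indicator {r..} t \<partial>lborel)"
    by (rule nn_integral_cong_AE, rule AE_mp[OF AE_lborel_singleton[of r]]) (simp add: indicator_def)
  also have "\<dots> = ennreal (0 - (- 1 / (real n * r ^ n)))"
  proof (rule nn_integral_FTC_atLeast)
    show "((\<lambda>t. - 1 / (real n * t ^ n)) has_real_derivative 1 / x ^ (n+1)) (at x)" if "r \<le> x" for x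
    proof -
      have x: "x > 0" using that assms by simp
      have "real n * x ^ (n - Suc 0) * (x * x ^ n) = real n * (x ^ n * x ^ n)"
        using assms by (cases n) (auto)
      then show ?thesis using x assms
        by (auto intro!: derivative_eq_intros simp: field_simps power2_eq_square)
    qed
    have "filterlim (\<lambda>t::real. real n * t ^ n) at_top at_top"
      using assms by (intro filterlim_tendsto_pos_mult_at_top[OF tendsto_const] filterlim_pow_at_top filterlim_ident) auto
    then show "((\<lambda>t. - 1 / (real n * t ^ n)) \<longlongrightarrow> 0) at_top"
      by (intro tendsto_divide_0[OF tendsto_const] filterlim_at_top_imp_at_infinity)
  qed (use assms in auto)
  finally show ?thesis by simp
qed

text \<open>Polar integration of a function of a positively homogeneous \<open>q\<close>, without surface measure: by Tonelli and the
  dilation \<open>y = t x\<close>, both sides are iterated integrals of \<open>n \<bar>y\<bar>\<^sup>n t\<^bsup>-n-1\<^esup> \<phi> (q y)\<close>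
  over \<open>\<bar>y\<bar> < t\<close>.\<close>
lemma nn_integral_homogeneous:
  fixes q :: "'a::euclidean_space \<Rightarrow> real" and \<phi> :: "real \<Rightarrow> ennreal"
  assumes [measurable]: "q \<in> borel_measurable borel" "\<phi> \<in> borel_measurable borel"
    and q0: "\<And>x. 0 \<le> q x" and hom: "\<And>t x. t > 0 \<Longrightarrow> q (t *\<^sub>R x) = t * q x"
    and \<phi>: "\<And>x. x \<noteq> 0 \<Longrightarrow> (\<integral>\<^sup>+t\<in>{0<..}. ennreal (t ^ (DIM('a) - 1)) * \<phi> (t * q x) \<partial>lborel)
       = c * inverse (ennreal (q x)) ^ DIM('a)"
  shows "c * (of_nat DIM('a) * (\<integral>\<^sup>+x\<in>ball 0 1. inverse (ennreal (q (x /\<^sub>R norm x))) ^ DIM('a) \<partial>lborel))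
    = (\<integral>\<^sup>+x. \<phi> (q x) \<partial>(lborel :: 'a measure))"
proof -
  let ?n = "DIM('a)"
  have AE0: "AE x in lborel. x \<noteq> (0::'a)"
    by (rule AE_lborel_singleton)
  have [measurable]: "ball (0::'a) 1 \<in> sets borel"
    by simp
  let ?w = "\<lambda>(x::'a). ennreal (norm x ^ ?n) * indicator (ball 0 1) x"
  \<comment> \<open>At \<open>q x = 0\<close> both sides are \<open>top\<close>, which uses
    \<open>x \<noteq> 0\<close>.\<close>
  have inv: "inverse (ennreal (q (x /\<^sub>R norm x))) = ennreal (norm x) * inverse (ennreal (q x))" if "x \<noteq> 0" for x
  proof -
    have "q (x /\<^sub>R norm x) = q x / norm x"
      using that by (subst hom) (auto simp: field_simps)
    moreover have "inverse (ennreal (q x / norm x)) = ennreal (norm x) * inverse (ennreal (q x))"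
      using that q0[of x] by (cases "q x = 0") (auto simp: inverse_ennreal ennreal_mult_top divide_inverse simp flip: ennreal_mult'')
    ultimately show ?thesis by simp
  qed
  have "c * (of_nat ?n * (\<integral>\<^sup>+x\<in>ball 0 1. inverse (ennreal (q (x /\<^sub>R norm x))) ^ ?n \<partial>lborel))
     = of_nat ?n * (\<integral>\<^sup>+x. c * (inverse (ennreal (q (x /\<^sub>R norm x))) ^ ?n * indicator (ball 0 1) x) \<partial>lborel)"
    by (subst nn_integral_cmult) (auto simp: mult.left_commute)
  also have "(\<integral>\<^sup>+x. c * (inverse (ennreal (q (x /\<^sub>R norm x))) ^ ?n * indicator (ball 0 1) x) \<partial>lborel)
     = (\<integral>\<^sup>+x. (\<integral>\<^sup>+t. ?w x * (ennreal (t ^ (?n - 1)) * \<phi> (t * q x) * indicator {0<..} t) \<partial>lborel) \<partial>lborel)"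
  proof (rule nn_integral_cong_AE, rule AE_mp[OF AE0], rule AE_I2, rule impI)
    fix x :: 'a assume x: "x \<noteq> 0"
    have "(\<integral>\<^sup>+t. ?w x * (ennreal (t ^ (?n - 1)) * \<phi> (t * q x) * indicator {0<..} t) \<partial>lborel)
       = ?w x * (c * inverse (ennreal (q x)) ^ ?n)"
      using \<phi>[OF x] by (subst nn_integral_cmult) auto
    also have "\<dots> = c * (inverse (ennreal (q (x /\<^sub>R norm x))) ^ ?n * indicator (ball 0 1) x)"
      unfolding inv[OF x] by (simp add: power_mult_distrib ennreal_power mult_ac)
    finally show "c * (inverse (ennreal (q (x /\<^sub>R norm x))) ^ ?n * indicator (ball 0 1) x) =
      (\<integral>\<^sup>+t. ?w x * (ennreal (t ^ (?n - 1)) * \<phi> (t * q x) * indicator {0<..} t) \<partial>lborel)" by simp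
  qed
  also have "\<dots> = (\<integral>\<^sup>+t. (\<integral>\<^sup>+x. ?w x * (ennreal (t ^ (?n - 1)) * \<phi> (t * q x) * indicator {0<..} t) \<partial>lborel) \<partial>lborel)"
    by (rule lborel_pair.Fubini') measurable
  also have "\<dots> = (\<integral>\<^sup>+t. (\<integral>\<^sup>+y. ennreal (norm y ^ ?n) * \<phi> (q y) * (ennreal (1 / t ^ (?n + 1)) * (if norm y < t then 1 else 0)) \<partial>lborel) \<partial>lborel)"
  proof (rule nn_integral_cong)
    fix t :: real
    show "(\<integral>\<^sup>+x. ?w x * (ennreal (t ^ (?n - 1)) * \<phi> (t * q x) * indicator {0<..} t) \<partial>lborel) =
      (\<integral>\<^sup>+y. ennreal (norm y ^ ?n) * \<phi> (q y) * (ennreal (1 / t ^ (?n + 1)) * (if norm y < t then 1 else 0)) \<partial>lborel)"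
    proof (cases "t > 0")
      case True
      have "(\<integral>\<^sup>+y. ennreal (norm y ^ ?n) * \<phi> (q y) * (ennreal (1 / t ^ (?n + 1)) * (if norm y < t then 1 else 0)) \<partial>lborel)
        = ennreal (t ^ ?n) * (\<integral>\<^sup>+x. ennreal (norm (t *\<^sub>R x) ^ ?n) * \<phi> (q (t *\<^sub>R x)) * (ennreal (1 / t ^ (?n + 1)) * (if norm (t *\<^sub>R x) < t then 1 else 0)) \<partial>lborel)"
        by (rule nn_integral_scaleR_lborel[OF _ True]) measurable
      also have "\<dots> = (\<integral>\<^sup>+x. ennreal (t ^ ?n) * (ennreal (norm (t *\<^sub>R x) ^ ?n) * \<phi> (q (t *\<^sub>R x)) * (ennreal (1 / t ^ (?n + 1)) * (if norm (t *\<^sub>R x) < t then 1 else 0))) \<partial>lborel)"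
        by (rule nn_integral_cmult[symmetric]) measurable
      also have "\<dots> = (\<integral>\<^sup>+x. ?w x * (ennreal (t ^ (?n - 1)) * \<phi> (t * q x) * indicator {0<..} t) \<partial>lborel)"
      proof (rule nn_integral_cong)
        fix x :: 'a
        have ind: "(if norm (t *\<^sub>R x) < t then 1 else 0) = (indicator (ball 0 1) x :: ennreal)"
          using True by (auto simp: indicator_def)
        \<comment> \<open>One factor \<open>t ^ n\<close> is the Jacobian and another comes from the
          norm; divided by \<open>t ^ (n+1)\<close> they leave the radial weight
          \<open>t ^ (n-1)\<close> of polar coordinates.\<close>
        have "t ^ ?n * (norm (t *\<^sub>R x) ^ ?n * (1 / t ^ (?n + 1))) = norm x ^ ?n * t ^ (?n - 1)"
          using True by (cases ?n) (auto simp: power_mult_distrib)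
        then have "ennreal (t ^ ?n) * (ennreal (norm (t *\<^sub>R x) ^ ?n) * ennreal (1 / t ^ (?n + 1))) = ennreal (norm x ^ ?n) * ennreal (t ^ (?n - 1))"
          using True by (simp only: ennreal_mult''[symmetric] zero_le_power norm_ge_zero mult_nonneg_nonneg divide_nonneg_nonneg zero_le_one less_imp_le)
        then have "(ennreal (t ^ ?n) * (ennreal (norm (t *\<^sub>R x) ^ ?n) * ennreal (1 / t ^ (?n + 1)))) * (\<phi> (t * q x) * indicator (ball 0 1) x)
           = (ennreal (norm x ^ ?n) * ennreal (t ^ (?n - 1))) * (\<phi> (t * q x) * indicator (ball 0 1) x)"
          by (simp only:)
        then show "ennreal (t ^ ?n) * (ennreal (norm (t *\<^sub>R x) ^ ?n) * \<phi> (q (t *\<^sub>R x)) * (ennreal (1 / t ^ (?n + 1)) * (if norm (t *\<^sub>R x) < t then 1 else 0))) =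
           ?w x * (ennreal (t ^ (?n - 1)) * \<phi> (t * q x) * indicator {0<..} t)"
          unfolding ind hom[OF True] using True by (simp only: mult_ac indicator_simps greaterThan_iff mult_1_left mult_1_right)
      qed
      finally show ?thesis by simp
    next
      case False
      then have "\<not> norm y < t" for y :: 'a
        using norm_ge_zero[of y] by linarith
      with False show ?thesis by simp
    qed
  qed
  also have "\<dots> = (\<integral>\<^sup>+y. (\<integral>\<^sup>+t. ennreal (norm y ^ ?n) * \<phi> (q y) * (ennreal (1 / t ^ (?n + 1)) * (if norm y < t then 1 else 0)) \<partial>lborel) \<partial>lborel)"
    by (rule lborel_pair.Fubini') measurable
  also have "of_nat ?n * \<dots> = (\<integral>\<^sup>+y. of_nat ?n * (\<integral>\<^sup>+t. ennreal (norm y ^ ?n) * \<phi> (q y) * (ennreal (1 / t ^ (?n + 1)) * (if norm y < t then 1 else 0)) \<partial>lborel) \<partial>lborel)"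
    by (rule nn_integral_cmult[symmetric]) measurable
  also have "\<dots> = (\<integral>\<^sup>+y. \<phi> (q y) \<partial>lborel)"
  proof (rule nn_integral_cong_AE, rule AE_mp[OF AE0], rule AE_I2, rule impI)
    fix y :: 'a assume y: "y \<noteq> 0"
    have "(\<integral>\<^sup>+t. ennreal (norm y ^ ?n) * \<phi> (q y) * (ennreal (1 / t ^ (?n + 1)) * (if norm y < t then 1 else 0)) \<partial>lborel)
       = ennreal (norm y ^ ?n) * \<phi> (q y) * ennreal (1 / (real ?n * norm y ^ ?n))"
      using y nn_integral_power_tail[of "norm y" ?n] by (subst nn_integral_cmult) auto
    moreover have "ennreal (real ?n) * (ennreal (norm y ^ ?n) * ennreal (1 / (real ?n * norm y ^ ?n))) = 1"
      using y by (simp flip: ennreal_mult'')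
    ultimately show "of_nat ?n * (\<integral>\<^sup>+t. ennreal (norm y ^ ?n) * \<phi> (q y) * (ennreal (1 / t ^ (?n + 1)) * (if norm y < t then 1 else 0)) \<partial>lborel) = \<phi> (q y)"
      by (simp add: ennreal_of_nat_eq_real_of_nat mult_ac)
  qed
  finally show ?thesis .
qed

text \<open>The substitution \<open>x = t * q\<close> reduces this to the Gamma integral. At
  \<open>q = 0\<close> the integral diverges, in agreement with \<open>inverse 0 = top\<close>; the
  case is kept because a seminorm may vanish in some directions.\<close>

lemma nn_integral_power_exp_scaled:
  fixes q :: real
  assumes q: "0 \<le> q"
  shows "(\<integral>\<^sup>+t\<in>{0<..}. ennreal (t ^ m * exp (- (t * q))) \<partial>lborel) = ennreal (fact m) * inverse (ennreal q) ^ (m+1)"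
proof (cases "q = 0")
  case True
  have "top = (SUP n. of_nat n :: ennreal)"
    by (simp add: ennreal_SUP_of_nat_eq_top)
  also have "\<dots> \<le> emeasure lborel {1::real..}"
  proof (intro SUP_least)
    fix n :: nat
    have "of_nat n = emeasure lborel {1..1 + real n}"
      by (simp add: ennreal_of_nat_eq_real_of_nat)
    also have "\<dots> \<le> emeasure lborel {1::real..}"
      by (intro emeasure_mono) auto
    finally show "of_nat n \<le> emeasure lborel {1::real..}" .
  qed
  also have "\<dots> = (\<integral>\<^sup>+t. indicator {1::real..} t \<partial>lborel)"
    by simp
  also have "\<dots> \<le> (\<integral>\<^sup>+t\<in>{0<..}. ennreal (t ^ m * exp (- (t * q))) \<partial>lborel)"
  proof (intro nn_integral_mono)
    fix t :: real
    have "(1::ennreal) \<le> ennreal (t ^ m)" if "1 \<le> t"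
      using ennreal_leI[OF one_le_power[OF that, of m]] by simp
    then show "indicator {1::real..} t \<le> ennreal (t ^ m * exp (- (t * q))) * indicator {0<..} t"
      using True by (auto simp: indicator_def)
  qed
  finally have "(\<integral>\<^sup>+t\<in>{0<..}. ennreal (t ^ m * exp (- (t * q))) \<partial>lborel) = top"
    by (simp add: top_unique)
  then show ?thesis using True by (simp add: ennreal_mult_top ennreal_top_mult)
next
  case False
  with q have q: "q > 0" by simp
  have "(\<integral>\<^sup>+t\<in>{0<..}. ennreal (t ^ m * exp (- (t * q))) \<partial>lborel) =
      ennreal \<bar>1/q\<bar> * (\<integral>\<^sup>+x. ennreal ((0 + 1/q * x) ^ m * exp (- ((0 + 1/q * x) * q))) * indicator {0<..} (0 + 1/q * x) \<partial>lborel)"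
    using q by (intro nn_integral_real_affine) auto
  also have "(\<integral>\<^sup>+x. ennreal ((0 + 1/q * x) ^ m * exp (- ((0 + 1/q * x) * q))) * indicator {0<..} (0 + 1/q * x) \<partial>lborel)
     = (\<integral>\<^sup>+x. ennreal ((1/q) ^ m) * (ennreal (x ^ m * exp (- x)) * indicator {0..} x) \<partial>lborel)"
  proof (rule nn_integral_cong_AE, rule AE_mp[OF AE_lborel_singleton[of 0]], rule AE_I2, rule impI)
    fix x :: real assume "x \<noteq> 0"
    then show "ennreal ((0 + 1/q * x) ^ m * exp (- ((0 + 1/q * x) * q))) * indicator {0<..} (0 + 1/q * x)
       = ennreal ((1/q) ^ m) * (ennreal (x ^ m * exp (- x)) * indicator {0..} x)"
      using q by (cases "x > 0")
        (auto simp: indicator_def zero_less_divide_iff power_divide simp flip: ennreal_mult'')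
  qed
  also have "\<dots> = ennreal ((1/q) ^ m) * ennreal (fact m)"
    by (subst nn_integral_cmult) (auto simp: nn_intergal_power_times_exp_Ici)
  also have "ennreal \<bar>1/q\<bar> * (ennreal ((1/q) ^ m) * ennreal (fact m)) = ennreal (fact m) * inverse (ennreal q) ^ (m+1)"
    using q by (simp add: inverse_ennreal ennreal_power power_divide divide_inverse power_inverse mult_ac flip: ennreal_mult'')
  finally show ?thesis .
qed

context
  fixes q :: "'a::euclidean_space \<Rightarrow> real"
  assumes meas[measurable]: "q \<in> borel_measurable borel"
    and q0: "\<And>x. 0 \<le> q x" and hom: "\<And>t x. t > 0 \<Longrightarrow> q (t *\<^sub>R x) = t * q x"
begin

lemma polar_exp_homogeneous:
  "ennreal (fact (DIM('a) - 1)) * (of_nat DIM('a) * (\<integral>\<^sup>+x\<in>ball 0 1. inverse (ennreal (q (x /\<^sub>R norm x))) ^ DIM('a) \<partial>lborel))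
    = (\<integral>\<^sup>+x. ennreal (exp (- q x)) \<partial>(lborel :: 'a measure))"
proof (rule nn_integral_homogeneous[where \<phi> = "\<lambda>t. ennreal (exp (- t))"])
  fix x :: 'a
  have "(\<integral>\<^sup>+t\<in>{0<..}. ennreal (t ^ (DIM('a) - 1)) * ennreal (exp (- (t * q x))) \<partial>lborel)
     = (\<integral>\<^sup>+t\<in>{0<..}. ennreal (t ^ (DIM('a) - 1) * exp (- (t * q x))) \<partial>lborel)"
    by (intro nn_integral_cong) (simp add: ennreal_mult'')
  also have "\<dots> = ennreal (fact (DIM('a) - 1)) * inverse (ennreal (q x)) ^ DIM('a)"
    using nn_integral_power_exp_scaled[OF q0, of "DIM('a) - 1" x] by simp
  finally show "(\<integral>\<^sup>+t\<in>{0<..}. ennreal (t ^ (DIM('a) - 1)) * ennreal (exp (- (t * q x))) \<partial>lborel)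
     = ennreal (fact (DIM('a) - 1)) * inverse (ennreal (q x)) ^ DIM('a)" .
qed (use q0 hom in auto)

text \<open>The profiles \<open>exp (- t)\<close> and \<open>t * exp (- t)\<close> produce the same
  spherical integral with the factors (n-1)! and n!, whose ratio is n. For cones this is the source
  of the term n in the entropy.\<close>

lemma polar_mean_homogeneous:
  assumes pos: "\<And>x. x \<noteq> 0 \<Longrightarrow> 0 < q x"
  shows "(\<integral>\<^sup>+x. ennreal (q x * exp (- q x)) \<partial>lborel) = ennreal DIM('a) * (\<integral>\<^sup>+x. ennreal (exp (- q x)) \<partial>lborel)"
proof -
  have "ennreal (fact DIM('a)) * (of_nat DIM('a) * (\<integral>\<^sup>+x\<in>ball 0 1. inverse (ennreal (q (x /\<^sub>R norm x))) ^ DIM('a) \<partial>lborel))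
      = (\<integral>\<^sup>+x. ennreal (q x * exp (- q x)) \<partial>lborel)"
  proof (rule nn_integral_homogeneous[where \<phi> = "\<lambda>t. ennreal (t * exp (- t))"])
    fix x :: 'a assume "x \<noteq> 0"
    with pos have x: "q x > 0" by simp
    have "(\<integral>\<^sup>+t\<in>{0<..}. ennreal (t ^ (DIM('a) - 1)) * ennreal (t * q x * exp (- (t * q x))) \<partial>lborel)
       = (\<integral>\<^sup>+t. ennreal (q x) * (ennreal (t ^ DIM('a) * exp (- (t * q x))) * indicator {0<..} t) \<partial>lborel)"
    proof (intro nn_integral_cong)
      fix t :: real
      have "t ^ (DIM('a) - 1) * t = t ^ DIM('a)"
        by (metis DIM_positive power_minus_mult)
      then show "ennreal (t ^ (DIM('a) - 1)) * ennreal (t * q x * exp (- (t * q x))) * indicator {0<..} t =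
         ennreal (q x) * (ennreal (t ^ DIM('a) * exp (- (t * q x))) * indicator {0<..} t)"
        using x by (auto simp: indicator_def mult_ac simp flip: ennreal_mult'')
    qed
    also have "\<dots> = ennreal (q x) * (ennreal (fact DIM('a)) * inverse (ennreal (q x)) ^ (DIM('a) + 1))"
      by (subst nn_integral_cmult) (auto simp: nn_integral_power_exp_scaled[OF q0] simp del: power_Suc)
    also have "\<dots> = ennreal (fact DIM('a)) * inverse (ennreal (q x)) ^ DIM('a) * (ennreal (q x) * inverse (ennreal (q x)))"
      by (simp add: mult_ac)
    also have "ennreal (q x) * inverse (ennreal (q x)) = 1"
      using x by (simp add: inverse_ennreal flip: ennreal_mult'')
    finally show "(\<integral>\<^sup>+t\<in>{0<..}. ennreal (t ^ (DIM('a) - 1)) * ennreal (t * q x * exp (- (t * q x))) \<partial>lborel)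
       = ennreal (fact DIM('a)) * inverse (ennreal (q x)) ^ DIM('a)" by simp
  qed (use q0 hom in auto)
  moreover have "(fact DIM('a) :: real) = real DIM('a) * fact (DIM('a) - 1)"
    by (metis DIM_positive fact_reduce)
  ultimately show ?thesis
    unfolding polar_exp_homogeneous[symmetric] by (simp add: ennreal_mult mult.assoc)
qed

end

section \<open>Rademacher's theorem\<close>

text \<open>By Vitali's theorem, disjoint balls on which \<open>M\<close> is at most
  \<open>N\<close>, inside an open set slightly larger than \<open>E\<close>, cover \<open>E\<close>
  up to a null set. Domination by Lebesgue measure makes both the uncovered rest and the excess of
  the open set harmless. The balls need only contain \<open>x\<close>, since they will be intervals
  having \<open>x\<close> as an endpoint.\<close>

lemma emeasure_le_of_small_cballs:
  fixes E :: "'a::euclidean_space set"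
  assumes M: "sets M = sets borel" "\<And>A. A \<in> sets borel \<Longrightarrow> emeasure M A \<le> ennreal c * emeasure lborel A"
    and N: "sets N = sets borel" "\<And>A. A \<in> sets borel \<Longrightarrow> emeasure N A \<le> ennreal c * emeasure lborel A"
    and E[measurable]: "E \<in> sets borel"
    and small: "\<And>x d. x \<in> E \<Longrightarrow> d > 0 \<Longrightarrow>
      \<exists>a r. 0 < r \<and> r < d \<and> x \<in> cball a r \<and> emeasure M (cball a r) \<le> emeasure N (cball a r)"
  shows "emeasure M E \<le> emeasure N E"
proof -
  have [measurable_cong]: "sets M = sets borel" "sets N = sets borel" by (fact M N)+
  have le: "emeasure M E \<le> emeasure N E + ennreal c * ennreal e" if e: "e > 0" for e :: real
  proof -
    obtain U where U: "open U" "E \<subseteq> U" "emeasure lborel (U - E) \<le> ennreal e"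
      using outer_regular_lborel_le[OF E e] by blast
    have [measurable]: "U \<in> sets borel" using U by simp
    define K where "K = {(a, r). 0 < r \<and> cball a r \<subseteq> U \<and> emeasure M (cball a r) \<le> emeasure N (cball a r)}"
    have pos: "0 < snd i" if "i \<in> K" for i
      using that by (auto simp: K_def)
    have cov: "\<exists>i. i \<in> K \<and> x \<in> cball (fst i) (snd i) \<and> snd i < d" if x: "x \<in> E" "0 < d" for x d
    proof -
      \<comment> \<open>A ball of radius below \<open>s / 2\<close> that contains \<open>x\<close>
        stays inside \<open>ball x s\<close>, whatever its centre.\<close>
      obtain s where s: "s > 0" "ball x s \<subseteq> U"
        using U x by (meson openE subsetD)
      obtain a r where ar: "0 < r" "r < min d (s / 2)" "x \<in> cball a r" "emeasure M (cball a r) \<le> emeasure N (cball a r)"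
        using small[OF x(1), of "min d (s/2)"] x s by auto
      have "cball a r \<subseteq> ball x s"
      proof
        fix y assume y: "y \<in> cball a r"
        have "dist x y \<le> dist x a + dist a y" by (rule dist_triangle)
        also have "\<dots> < s" using y ar by (auto simp: dist_commute)
        finally show "y \<in> ball x s" by simp
      qed
      with s have "(a, r) \<in> K" using ar by (auto simp: K_def)
      with ar show "\<exists>i. i \<in> K \<and> x \<in> cball (fst i) (snd i) \<and> snd i < d"
        by (intro exI[of _ "(a, r)"]) auto
    qed
    obtain C where C: "countable C" "C \<subseteq> K"
      "pairwise (\<lambda>i j. disjnt (cball (fst i) (snd i)) (cball (fst j) (snd j))) C"
      "negligible (E - (\<Union>i\<in>C. cball (fst i) (snd i)))"
      by (rule Vitali_covering_theorem_cballs[of K snd E fst]) (erule pos, erule (1) cov, rule that)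
    let ?I = "\<lambda>i::'a \<times> real. cball (fst i) (snd i)"
    have disj: "disjoint_family_on ?I C"
      using C(3) by (auto simp: disjoint_family_on_def pairwise_def disjnt_def)
    have [measurable]: "(\<Union>i\<in>C. ?I i) \<in> sets borel"
      using C(1) by (intro sets.countable_UN') auto
    have "E - (\<Union>i\<in>C. ?I i) \<in> null_sets lebesgue"
      using C(4) by (simp add: negligible_iff_null_sets)
    then have "emeasure lborel (E - (\<Union>i\<in>C. ?I i)) = 0"
      by (auto simp: null_sets_def emeasure_completion)
    then have "emeasure M (E - (\<Union>i\<in>C. ?I i)) = 0"
      using M(2)[of "E - (\<Union>i\<in>C. ?I i)"] by simp
    then have "emeasure M E \<le> emeasure M ((\<Union>i\<in>C. ?I i) \<union> (E - (\<Union>i\<in>C. ?I i)))"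
      by (intro emeasure_mono) auto
    also have "\<dots> \<le> emeasure M (\<Union>i\<in>C. ?I i) + emeasure M (E - (\<Union>i\<in>C. ?I i))"
      by (intro emeasure_subadditive) auto
    also have "\<dots> = emeasure M (\<Union>i\<in>C. ?I i)"
      using \<open>emeasure M (E - _) = 0\<close> by simp
    also have "\<dots> = (\<integral>\<^sup>+i. emeasure M (?I i) \<partial>count_space C)"
      using C(1) disj M(1) by (intro emeasure_UN_countable) auto
    also have "\<dots> \<le> (\<integral>\<^sup>+i. emeasure N (?I i) \<partial>count_space C)"
      using C(2) by (intro nn_integral_mono) (auto simp: K_def)
    also have "\<dots> = emeasure N (\<Union>i\<in>C. ?I i)"
      using C(1) disj N(1) by (intro emeasure_UN_countable[symmetric]) auto
    also have "\<dots> \<le> emeasure N (E \<union> (U - E))"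
    proof (intro emeasure_mono)
      have "?I i \<subseteq> U" if "i \<in> C" for i
        using subsetD[OF C(2) that] by (auto simp: K_def)
      then show "(\<Union>i\<in>C. ?I i) \<subseteq> E \<union> (U - E)" by blast
    qed measurable
    also have "\<dots> \<le> emeasure N E + emeasure N (U - E)"
      by (intro emeasure_subadditive) auto
    also have "emeasure N (U - E) \<le> ennreal c * ennreal e"
      by (rule order_trans[OF N(2)]) (use U in \<open>auto intro: mult_left_mono\<close>)
    finally show ?thesis by (simp add: add_left_mono)
  qed
  show ?thesis
  proof (rule ennreal_le_epsilon)
    fix e :: real assume "e > 0"
    moreover have "ennreal c * ennreal (e / (\<bar>c\<bar> + 1)) \<le> ennreal e"
    proof -
      have "c * (e / (\<bar>c\<bar> + 1)) \<le> e"
      proof -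
        have "c * e \<le> e * (\<bar>c\<bar> + 1)"
          using \<open>e > 0\<close> by (simp add: mult.commute mult_left_mono)
        then show ?thesis by (simp add: field_simps)
      qed
      then show ?thesis
        using \<open>e > 0\<close> by (simp add: ennreal_leI flip: ennreal_mult'')
    qed
    ultimately show "emeasure M E \<le> emeasure N E + ennreal e"
      using le[of "e / (\<bar>c\<bar> + 1)"] by (meson add_left_mono divide_pos_pos order_trans abs_ge_zero add_nonneg_pos zero_less_one)
  qed
qed

section \<open>Stieltjes measures and Dini derivates\<close>

lemma emeasure_interval_measure_Ioo:
  assumes "a \<le> b" and F: "mono F" "continuous_on UNIV F"
  shows "emeasure (interval_measure F) {a<..<b} = ennreal (F b - F a)"
proof -
  have sing: "emeasure (interval_measure F) {x} = 0" for x
    using emeasure_interval_measure_Icc[of x x F] F by (auto simp: mono_def)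
  have "emeasure (interval_measure F) ({a<..<b} \<union> {a, b}) = emeasure (interval_measure F) {a<..<b}"
    using null_sets.Un[of "{a}" "interval_measure F" "{b}"] sing
    by (intro emeasure_Un_null_set) (auto simp: null_sets_def insert_commute)
  moreover have "{a<..<b} \<union> {a, b} = {a..b}" using assms by auto
  ultimately show ?thesis
    using emeasure_interval_measure_Icc[of a b F] assms by (auto simp: mono_def)
qed

text \<open>The complementary function \<open>L * x - F x\<close> is monotone as well, and the two
  Stieltjes measures add up to \<open>L\<close> times Lebesgue measure, because they do so on open
  intervals.\<close>

lemma interval_measure_le_lborel:
  fixes F :: "real \<Rightarrow> real"
  assumes F: "mono F" and lip: "\<And>x y. x \<le> y \<Longrightarrow> F y - F x \<le> L * (y - x)" and L: "L > 0"
    and cont: "continuous_on UNIV F" and A: "A \<in> sets borel"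
  shows "emeasure (interval_measure F) A \<le> ennreal L * emeasure lborel A"
proof -
  define G where "G = (\<lambda>x. L * x - F x)"
  have G: "mono G" "continuous_on UNIV G"
    using lip cont by (auto simp: G_def mono_def algebra_simps intro!: continuous_intros)
  define s where "s = (\<lambda>A. (emeasure (interval_measure F) A + emeasure (interval_measure G) A) / ennreal L)"
  define M where "M = measure_of UNIV (sets borel) s"
  have sM: "sets M = sets borel"
    unfolding M_def by (subst sets_measure_of) (auto simp: sets.sigma_sets_eq[of borel, simplified])
  have eM: "emeasure M A = s A" if "A \<in> sets borel" for A
    unfolding M_def
  proof (rule emeasure_measure_of_sigma)
    show "sigma_algebra UNIV (sets borel :: real set set)"
      by (metis sets.sigma_algebra_axioms space_borel)
    show "positive (sets borel) s"
      by (auto simp: positive_def s_def)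
    show "countably_additive (sets borel) s"
    proof (rule countably_additiveI)
      fix A :: "nat \<Rightarrow> real set" assume A: "range A \<subseteq> sets borel" "disjoint_family A"
      then show "(\<Sum>i. s (A i)) = s (\<Union> (range A))"
        unfolding s_def
        by (subst suminf_emeasure[symmetric, OF _ A(2)], simp, subst suminf_emeasure[symmetric, OF _ A(2)], simp)
           (simp add: divide_ennreal_def ennreal_suminf_multc suminf_add)
    qed
  qed fact
  have "lborel = M"
  proof (rule lborel_eqI)
    fix l u :: real assume "\<And>b. b \<in> Basis \<Longrightarrow> l \<bullet> b \<le> u \<bullet> b"
    then have lu: "l \<le> u" by simp
    have nn: "0 \<le> F u - F l" "0 \<le> G u - G l" using F G lu by (auto simp: mono_def)
    have "emeasure M (box l u) = ennreal ((F u - F l) + (G u - G l)) / ennreal L"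
      using lu F cont G nn by (subst eM) (auto simp: s_def emeasure_interval_measure_Ioo)
    also have "(F u - F l) + (G u - G l) = L * (u - l)"
      by (simp add: G_def algebra_simps)
    also have "ennreal (L * (u - l)) / ennreal L = ennreal (u - l)"
      using L lu by (simp add: divide_ennreal)
    finally show "emeasure M (box l u) = ennreal (\<Prod>b\<in>Basis. (u - l) \<bullet> b)"
      by simp
  qed (fact sM)
  then have "ennreal L * emeasure lborel A = ennreal L * s A"
    using eM[OF A] by simp
  also have "\<dots> = emeasure (interval_measure F) A + emeasure (interval_measure G) A"
    using L by (simp add: s_def ennreal_times_divide ennreal_mult_divide_eq mult.commute[of "ennreal L"])
  finally show ?thesis by simp
qed

text \<open>For \<open>p < q\<close> no derivative along \<xi> exists at these points: the
  difference quotients fall below \<open>p\<close> and rise above \<open>q\<close> at arbitrarily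
  small steps of either sign. Quantifying over the steps, instead of comparing lower and upper
  limits, leaves conditions that are open in \<open>x\<close> for each fixed step when
  \<open>f\<close> is continuous.\<close>

definition dini_gap :: "('a::real_normed_vector \<Rightarrow> real) \<Rightarrow> 'a \<Rightarrow> real \<Rightarrow> real \<Rightarrow> 'a set" where
  "dini_gap f \<xi> p q = {x. (\<forall>d>0. \<exists>h. 0 < \<bar>h\<bar> \<and> \<bar>h\<bar> < d \<and> (f (x + h *\<^sub>R \<xi>) - f x) / h < p) \<and>
      (\<forall>d>0. \<exists>h. 0 < \<bar>h\<bar> \<and> \<bar>h\<bar> < d \<and> q < (f (x + h *\<^sub>R \<xi>) - f x) / h)}"

text \<open>The uncountable union over \<open>h\<close> is a union of open sets; only the quantifier
  over \<open>d\<close> has to be made countable.\<close>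

lemma borel_frequently_small:
  fixes P :: "real \<Rightarrow> 'a::topological_space \<Rightarrow> bool"
  assumes "\<And>h. open {x. P h x}"
  shows "{x. \<forall>d>0. \<exists>h. 0 < \<bar>h\<bar> \<and> \<bar>h\<bar> < d \<and> P h x} \<in> sets borel"
proof -
  have "{x. \<forall>d>0. \<exists>h. 0 < \<bar>h\<bar> \<and> \<bar>h\<bar> < d \<and> P h x} =
      (\<Inter>n::nat. \<Union>h\<in>{h. 0 < \<bar>h\<bar> \<and> \<bar>h\<bar> < 1 / Suc n}. {x. P h x})" (is "?L = ?R")
  proof
    show "?L \<subseteq> ?R" by (auto simp del: of_nat_Suc)
    show "?R \<subseteq> ?L"
    proof (rule subsetI, rule CollectI, intro allI impI)
      fix x d assume x: "x \<in> ?R" "(0::real) < d"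
      obtain n where n: "1 / Suc n < d"
        using nat_approx_posE[OF x(2)] by blast
      with x(1) obtain h where "0 < \<bar>h\<bar>" "\<bar>h\<bar> < 1 / Suc n" "P h x" by blast
      with n show "\<exists>h. 0 < \<bar>h\<bar> \<and> \<bar>h\<bar> < d \<and> P h x"
        by (meson less_trans)
    qed
  qed
  also have "\<dots> \<in> sets borel"
    using assms by (intro sets.countable_INT'' borel_open open_UN) auto
  finally show ?thesis .
qed

lemma dini_gap_borel:
  fixes f :: "'a::real_normed_vector \<Rightarrow> real"
  assumes f: "continuous_on UNIV f"
  shows "dini_gap f \<xi> p q \<in> sets borel"
proof -
  have cont: "continuous_on UNIV (\<lambda>x. (f (x + h *\<^sub>R \<xi>) - f x) / h)" for h
    unfolding divide_inverse
    by (intro continuous_intros continuous_on_compose2[OF f] f) auto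
  have "{x. \<forall>d>0. \<exists>h. 0 < \<bar>h\<bar> \<and> \<bar>h\<bar> < d \<and> (f (x + h *\<^sub>R \<xi>) - f x) / h < p} \<in> sets borel"
       "{x. \<forall>d>0. \<exists>h. 0 < \<bar>h\<bar> \<and> \<bar>h\<bar> < d \<and> q < (f (x + h *\<^sub>R \<xi>) - f x) / h} \<in> sets borel"
    by (intro borel_frequently_small open_Collect_less cont continuous_on_const)+
  then show ?thesis
    unfolding dini_gap_def Collect_conj_eq by (rule sets.Int)
qed

lemma dini_gap_add_linear:
  fixes f :: "real \<Rightarrow> real"
  assumes "x \<in> dini_gap f 1 p q"
  shows "x \<in> dini_gap (\<lambda>t. f t + L * t) 1 (p + L) (q + L)"
proof -
  have "(f (x + h) + L * (x + h) - (f x + L * x)) / h = (f (x + h) - f x) / h + L" if "0 < \<bar>h\<bar>" for h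
    using that by (simp add: field_simps)
  with assms show ?thesis
    unfolding dini_gap_def by (auto cong: conj_cong)
qed

text \<open>By the Vitali comparison, the Stieltjes measure of \<open>F\<close> is at most \<open>p\<close> times and at least \<open>q\<close> times
  Lebesgue measure on the gap set.\<close>
lemma dini_gap_null_mono:
  fixes F :: "real \<Rightarrow> real"
  assumes F: "mono F" and lip: "\<And>x y. x \<le> y \<Longrightarrow> F y - F x \<le> L * (y - x)" and L: "L > 0"
    and pq: "p < q"
  shows "emeasure lborel (dini_gap F 1 p q) = 0"
proof -
  have cont: "continuous_on UNIV F"
  proof (rule lipschitz_on_continuous_on, rule lipschitz_onI)
    show "dist (F x) (F y) \<le> L * dist x y" for x y
      using lip[of x y] lip[of y x] monoD[OF F, of x y] monoD[OF F, of y x]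
      by (cases "x \<le> y") (auto simp: dist_real_def)
  qed (use L in auto)
  \<comment> \<open>Bounded pieces have finite measure, so that it can be cancelled from the final
    comparison.\<close>
  define E where "E n = dini_gap F 1 p q \<inter> cball 0 (real n)" for n :: nat
  have [measurable]: "E n \<in> sets borel" for n
    unfolding E_def using dini_gap_borel[OF cont] by auto
  let ?\<mu> = "interval_measure F"
  have im: "emeasure ?\<mu> A \<le> ennreal L * emeasure lborel A" if "A \<in> sets borel" for A
    by (rule interval_measure_le_lborel[OF F lip L cont that])
  \<comment> \<open>The interval between \<open>x\<close> and \<open>x + h\<close> is a ball about
    its midpoint, and the slope of \<open>F\<close> over it is the ratio of its Stieltjes measure to
    its length. Bounds on difference quotients thus become comparisons of measures on balls
    containing \<open>x\<close>.\<close>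
  have ball: "\<exists>a r. r = \<bar>h\<bar> / 2 \<and> x \<in> cball a r \<and>
      emeasure ?\<mu> (cball a r) = ennreal (\<bar>h\<bar> * ((F (x + h) - F x) / h)) \<and> emeasure lborel (cball a r) = ennreal \<bar>h\<bar>"
    if h: "h \<noteq> 0" for x h
  proof (rule exI[of _ "x + h / 2"], rule exI[of _ "\<bar>h\<bar> / 2"], intro conjI)
    have cb: "cball (x + h / 2) (\<bar>h\<bar> / 2) = {min x (x + h)..max x (x + h)}"
      by (auto simp: cball_eq_atLeastAtMost min_def max_def abs_if field_simps)
    show "x \<in> cball (x + h / 2) (\<bar>h\<bar> / 2)" by (simp add: dist_real_def)
    show "emeasure lborel (cball (x + h / 2) (\<bar>h\<bar> / 2)) = ennreal \<bar>h\<bar>"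
      unfolding cb by (auto simp: min_def max_def abs_if)
    show "emeasure ?\<mu> (cball (x + h / 2) (\<bar>h\<bar> / 2)) = ennreal (\<bar>h\<bar> * ((F (x + h) - F x) / h))"
      unfolding cb using F cont h
      by (subst emeasure_interval_measure_Icc) (auto simp: mono_def min_def max_def abs_if divide_simps)
  qed auto
  have Q0: "0 \<le> (F (x + h) - F x) / h" for x h
    using monoD[OF F, of x "x + h"] monoD[OF F, of "x + h" x] by (cases "h > 0") (auto simp: zero_le_divide_iff)
  have E0: "emeasure lborel (E n) = 0" for n
  proof (cases "E n = {}")
    case False
    then obtain x0 where "x0 \<in> dini_gap F 1 p q" by (auto simp: E_def)
    \<comment> \<open>Difference quotients of a monotone function are nonnegative and one of them
      lies below \<open>p\<close>; hence neither \<open>ennreal p\<close> nor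
      \<open>ennreal q\<close> is truncated at 0.\<close>
    then have p: "p > 0" unfolding dini_gap_def using Q0
      by simp (meson le_less_trans zero_less_one)
    have 1: "emeasure ?\<mu> (E n) \<le> emeasure (scale_measure (ennreal p) lborel) (E n)"
    proof (rule emeasure_le_of_small_cballs[where c = "L + p"])
      fix x d :: real assume "x \<in> E n" "d > 0"
      then obtain h where h: "0 < \<bar>h\<bar>" "\<bar>h\<bar> < d" "(F (x + h) - F x) / h < p"
        by (auto simp: E_def dini_gap_def)
      moreover obtain a r where ar: "r = \<bar>h\<bar> / 2" "x \<in> cball a r"
        "emeasure ?\<mu> (cball a r) = ennreal (\<bar>h\<bar> * ((F (x + h) - F x) / h))" "emeasure lborel (cball a r) = ennreal \<bar>h\<bar>"
        using ball[of h x] h(1) by auto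
      ultimately have "emeasure ?\<mu> (cball a r) \<le> ennreal (\<bar>h\<bar> * p)"
        unfolding ar(3) by (intro ennreal_leI mult_left_mono) auto
      then have "emeasure ?\<mu> (cball a r) \<le> emeasure (scale_measure (ennreal p) lborel) (cball a r)"
        using p by (simp add: ar(4) ennreal_mult' mult.commute)
      with ar h show "\<exists>a r. 0 < r \<and> r < d \<and> x \<in> cball a r \<and> emeasure ?\<mu> (cball a r) \<le> emeasure (scale_measure (ennreal p) lborel) (cball a r)"
        by (intro exI[of _ a] exI[of _ r]) auto
    qed (use p L im in \<open>auto intro!: order_trans[OF im] mult_right_mono ennreal_leI\<close>)
    have 2: "emeasure (scale_measure (ennreal q) lborel) (E n) \<le> emeasure ?\<mu> (E n)"
    proof (rule emeasure_le_of_small_cballs[where c = "L + q"])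
      fix x d :: real assume "x \<in> E n" "d > 0"
      then obtain h where h: "0 < \<bar>h\<bar>" "\<bar>h\<bar> < d" "q < (F (x + h) - F x) / h"
        by (auto simp: E_def dini_gap_def)
      moreover obtain a r where ar: "r = \<bar>h\<bar> / 2" "x \<in> cball a r"
        "emeasure ?\<mu> (cball a r) = ennreal (\<bar>h\<bar> * ((F (x + h) - F x) / h))" "emeasure lborel (cball a r) = ennreal \<bar>h\<bar>"
        using ball[of h x] h(1) by auto
      ultimately have "ennreal (\<bar>h\<bar> * q) \<le> emeasure ?\<mu> (cball a r)"
        unfolding ar(3) by (intro ennreal_leI mult_left_mono) auto
      then have "emeasure (scale_measure (ennreal q) lborel) (cball a r) \<le> emeasure ?\<mu> (cball a r)"
        using p pq by (simp add: ar(4) ennreal_mult' mult.commute)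
      with ar h show "\<exists>a r. 0 < r \<and> r < d \<and> x \<in> cball a r \<and> emeasure (scale_measure (ennreal q) lborel) (cball a r) \<le> emeasure ?\<mu> (cball a r)"
        by (intro exI[of _ a] exI[of _ r]) auto
    qed (use p pq L im in \<open>auto intro!: order_trans[OF im] mult_right_mono ennreal_leI\<close>)
    have "emeasure lborel (E n) \<le> emeasure lborel (cball 0 (real n) :: real set)"
      by (intro emeasure_mono) (auto simp: E_def)
    also have "\<dots> < \<infinity>" by (rule emeasure_lborel_cball_finite)
    finally obtain m where m: "emeasure lborel (E n) = ennreal m" "0 \<le> m"
      by (cases "emeasure lborel (E n)") auto
    \<comment> \<open>The Stieltjes measure of \<open>E n\<close> lies between these two multiples
      of its finite Lebesgue measure, which \<open>p < q\<close> allows only for measure 0.\<close>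
    have "ennreal q * emeasure lborel (E n) \<le> ennreal p * emeasure lborel (E n)"
      using order_trans[OF 2 1] by simp
    then have "q * m \<le> p * m"
      using m p pq by (simp add: m flip: ennreal_mult)
    then have "m = 0" using pq m
      by (metis mult_le_cancel_right not_less order.order_iff_strict)
    then show ?thesis using m by simp
  qed simp
  have "dini_gap F 1 p q = (\<Union>n. E n)"
    by (auto simp: E_def intro: real_arch_simple)
  also have "emeasure lborel \<dots> = 0"
    using E0 by (intro emeasure_UN_eq_0) auto
  finally show ?thesis .
qed

text \<open>Adding \<open>(L + 1) * t\<close> makes the function monotone with slopes at most
  \<open>2 * L + 1\<close>, and merely shifts both thresholds by \<open>L + 1\<close>.\<close>

lemma dini_gap_null_lipschitz:
  fixes g :: "real \<Rightarrow> real"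
  assumes g: "L-lipschitz_on UNIV g" and pq: "p < q"
  shows "emeasure lborel (dini_gap g 1 p q) = 0"
proof -
  let ?F = "\<lambda>t. g t + (L + 1) * t"
  have L: "L \<ge> 0" using g lipschitz_on_nonneg by blast
  have lip: "\<bar>g y - g x\<bar> \<le> L * (y - x)" if "x \<le> y" for x y
    using lipschitz_onD[OF g, of x y] that by (simp add: dist_real_def abs_minus_commute)
  have 0: "emeasure lborel (dini_gap ?F 1 (p + (L + 1)) (q + (L + 1))) = 0"
  proof (rule dini_gap_null_mono[where L = "2 * L + 1"])
    have "g x + (L + 1) * x \<le> g y + (L + 1) * y" if "x \<le> y" for x y
      using lip[OF that] that by (simp add: algebra_simps abs_le_iff)
    then show "mono ?F" by (simp add: mono_def)
    show "g y + (L + 1) * y - (g x + (L + 1) * x) \<le> (2 * L + 1) * (y - x)" if "x \<le> y" for x y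
      using lip[OF that] that by (simp add: algebra_simps abs_le_iff)
  qed (use L pq in auto)
  have "continuous_on UNIV ?F"
    by (intro continuous_intros lipschitz_on_continuous_on[OF g])
  then have "dini_gap ?F 1 (p + (L + 1)) (q + (L + 1)) \<in> sets lborel"
    by (simp add: dini_gap_borel)
  with 0 have "emeasure lborel (dini_gap g 1 p q) \<le> emeasure lborel (dini_gap ?F 1 (p + (L + 1)) (q + (L + 1)))"
    using dini_gap_add_linear[of _ g p q "L + 1"] by (intro emeasure_mono) auto
  with 0 show ?thesis by simp
qed

text \<open>Tonelli over all \<open>x\<close> and over \<open>t\<close> in the unit interval takes
  the place of coordinates adapted to \<xi>: by translation invariance one order of integration
  gives the measure of \<open>Z\<close>, while the other gives 0.\<close>

lemma null_set_of_null_on_lines: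
  fixes Z :: "'a::euclidean_space set"
  assumes [measurable]: "Z \<in> sets borel"
    and lines: "\<And>x. emeasure lborel {t::real. x + t *\<^sub>R \<xi> \<in> Z} = 0"
  shows "emeasure lborel Z = 0"
proof -
  have "(\<integral>\<^sup>+t. (\<integral>\<^sup>+x. indicator Z (x + t *\<^sub>R \<xi>) * indicator {0..1} t \<partial>lborel) \<partial>lborel) =
    (\<integral>\<^sup>+x. (\<integral>\<^sup>+t. indicator Z (x + t *\<^sub>R \<xi>) * indicator {0..1::real} t \<partial>lborel) \<partial>lborel)"
    by (rule lborel_pair.Fubini') measurable
  also have "\<dots> \<le> (\<integral>\<^sup>+x. 0 \<partial>(lborel :: 'a measure))"
  proof (intro nn_integral_mono)
    fix x :: 'a
    have "(\<integral>\<^sup>+t. indicator Z (x + t *\<^sub>R \<xi>) * indicator {0..1::real} t \<partial>lborel) \<le> (\<integral>\<^sup>+t. indicator {t. x + t *\<^sub>R \<xi> \<in> Z} t \<partial>lborel)"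
      by (intro nn_integral_mono) (auto simp: indicator_def)
    also have "\<dots> = 0" using lines[of x] by (subst nn_integral_indicator) auto
    finally show "(\<integral>\<^sup>+t. indicator Z (x + t *\<^sub>R \<xi>) * indicator {0..1::real} t \<partial>lborel) \<le> 0" .
  qed
  finally have "(\<integral>\<^sup>+t. (\<integral>\<^sup>+x. indicator Z (x + t *\<^sub>R \<xi>) * indicator {0..1} t \<partial>lborel) \<partial>lborel) = 0"
    by simp
  moreover have "(\<integral>\<^sup>+x. indicator Z (x + t *\<^sub>R \<xi>) * indicator {0..1} t \<partial>lborel) = emeasure lborel Z * indicator {0..1} t" for t
  proof -
    have "(\<integral>\<^sup>+x. indicator Z (x + t *\<^sub>R \<xi>) \<partial>lborel) = (\<integral>\<^sup>+x. indicator Z x \<partial>distr lborel borel ((+) (t *\<^sub>R \<xi>)))"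
      by (subst nn_integral_distr) (auto simp: add.commute)
    also have "\<dots> = emeasure lborel Z"
      by (simp add: lborel_distr_plus)
    finally show ?thesis by (subst nn_integral_multc) auto
  qed
  ultimately show ?thesis
    by (simp add: nn_integral_cmult)
qed

text \<open>If the lower limit were below the upper limit, two rationals would fit strictly between
  them and \<open>x\<close> would lie in their gap set. Rational thresholds keep the number of
  exceptional sets countable; boundedness makes the limit finite.\<close>

lemma tendsto_of_no_dini_gap:
  fixes f :: "'a::real_normed_vector \<Rightarrow> real"
  assumes bdd: "\<And>h. \<bar>(f (x + h *\<^sub>R \<xi>) - f x) / h\<bar> \<le> B"
    and gap: "\<And>p q. p \<in> \<rat> \<Longrightarrow> q \<in> \<rat> \<Longrightarrow> p < q \<Longrightarrow> x \<notin> dini_gap f \<xi> p q"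
  shows "\<exists>l. ((\<lambda>h. (f (x + h *\<^sub>R \<xi>) - f x) / h) \<longlongrightarrow> l) (at 0)"
proof -
  let ?Q = "\<lambda>h. (f (x + h *\<^sub>R \<xi>) - f x) / h"
  let ?l = "Liminf (at 0) (\<lambda>h. ereal (?Q h))" and ?u = "Limsup (at 0) (\<lambda>h. ereal (?Q h))"
  have "- B \<le> ?Q h \<and> ?Q h \<le> B" for h
    using bdd[of h] by linarith
  then have lB: "ereal (- B) \<le> ?l" "?u \<le> ereal B"
    by (auto intro!: Liminf_bounded Limsup_bounded always_eventually)
  have lu: "?l \<le> ?u" by (rule Liminf_le_Limsup) simp
  have "\<not> ?l < ?u"
  proof
    assume "?l < ?u"
    then obtain p q where pq: "?l < ereal (of_rat p)" "of_rat p < (of_rat q :: real)" "ereal (of_rat q) < ?u"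
    proof -
      obtain a where a: "?l < ereal a" "ereal a < ?u"
        using \<open>?l < ?u\<close> ereal_dense2 by blast
      obtain p where p: "?l < ereal (real_of_rat p)" "ereal (of_rat p) < ereal a"
        using ereal_dense3[OF a(1)] by blast
      obtain q where q: "ereal a < ereal (real_of_rat q)" "ereal (of_rat q) < ?u"
        using ereal_dense3[OF a(2)] by blast
      show ?thesis using that[of p q] p q by simp
    qed
    have "x \<in> dini_gap f \<xi> (of_rat p) (of_rat q)"
      unfolding dini_gap_def
    proof (intro CollectI conjI allI impI; rule ccontr)
      fix d :: real assume d: "d > 0" and no: "\<not> (\<exists>h. 0 < \<bar>h\<bar> \<and> \<bar>h\<bar> < d \<and> ?Q h < of_rat p)"
      have "eventually (\<lambda>h. ereal (of_rat p) \<le> ereal (?Q h)) (at 0)"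
        using d no by (auto simp: eventually_at dist_real_def not_less intro!: exI[of _ d])
      then have "ereal (of_rat p) \<le> ?l" by (rule Liminf_bounded)
      with pq show False by simp
    next
      fix d :: real assume d: "d > 0" and no: "\<not> (\<exists>h. 0 < \<bar>h\<bar> \<and> \<bar>h\<bar> < d \<and> of_rat q < ?Q h)"
      have "eventually (\<lambda>h. ereal (?Q h) \<le> ereal (of_rat q)) (at 0)"
        using d no by (auto simp: eventually_at dist_real_def not_less intro!: exI[of _ d])
      then have "?u \<le> ereal (of_rat q)" by (rule Limsup_bounded)
      with pq show False by simp
    qed
    with gap[of "of_rat p" "of_rat q"] pq(2) show False by auto
  qed
  with lu have eq: "?l = ?u" by simp
  have "ereal (- B) \<le> ?u" using lB(1) eq by simp
  with lB(2) have "\<bar>?u\<bar> \<noteq> \<infinity>" by auto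
  then obtain r where "?u = ereal r" by (metis ereal_real')
  with eq have r: "?l = ereal r" by simp
  have "((\<lambda>h. ereal (?Q h)) \<longlongrightarrow> ereal r) (at 0)"
    using eq r by (intro Liminf_eq_Limsup) auto
  then show ?thesis by auto
qed

theorem AE_directional_derivative:
  fixes f :: "'a::euclidean_space \<Rightarrow> real"
  assumes f: "L-lipschitz_on UNIV f"
  shows "AE x in lborel. \<exists>l. ((\<lambda>h. (f (x + h *\<^sub>R \<xi>) - f x) / h) \<longlongrightarrow> l) (at 0)"
proof -
  have cont: "continuous_on UNIV f" using f by (rule lipschitz_on_continuous_on)
  have L: "L \<ge> 0" using f lipschitz_on_nonneg by blast
  \<comment> \<open>On each line parallel to \<xi> the gap set is that of a Lipschitz function of
    one real variable.\<close>
  have null: "emeasure lborel (dini_gap f \<xi> p q) = 0" if "p < q" for p q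
  proof (rule null_set_of_null_on_lines[OF dini_gap_borel[OF cont]])
    fix x
    have "{t::real. x + t *\<^sub>R \<xi> \<in> dini_gap f \<xi> p q} = dini_gap (\<lambda>t. f (x + t *\<^sub>R \<xi>)) 1 p q"
      by (simp add: dini_gap_def scaleR_add_left add.assoc)
    moreover have "(L * norm \<xi>)-lipschitz_on UNIV (\<lambda>t. f (x + t *\<^sub>R \<xi>))"
    proof (rule lipschitz_onI)
      fix s t :: real
      have "dist (f (x + s *\<^sub>R \<xi>)) (f (x + t *\<^sub>R \<xi>)) \<le> L * dist (x + s *\<^sub>R \<xi>) (x + t *\<^sub>R \<xi>)"
        using f by (rule lipschitz_onD) auto
      also have "dist (x + s *\<^sub>R \<xi>) (x + t *\<^sub>R \<xi>) = norm \<xi> * dist s t"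
        by (simp add: dist_norm mult.commute flip: scaleR_diff_left)
      finally show "dist (f (x + s *\<^sub>R \<xi>)) (f (x + t *\<^sub>R \<xi>)) \<le> L * norm \<xi> * dist s t" by simp
    qed (use L in auto)
    ultimately show "emeasure lborel {t::real. x + t *\<^sub>R \<xi> \<in> dini_gap f \<xi> p q} = 0"
      using dini_gap_null_lipschitz that by metis
  qed
  have "AE x in lborel. \<forall>p\<in>\<rat>. \<forall>q\<in>\<rat>. p < q \<longrightarrow> x \<notin> dini_gap f \<xi> p q"
  proof (intro AE_ball_countable[THEN iffD2] countable_rat ballI)
    fix p q :: real
    show "AE x in lborel. p < q \<longrightarrow> x \<notin> dini_gap f \<xi> p q"
    proof (cases "p < q")
      case True
      then have "dini_gap f \<xi> p q \<in> null_sets lborel"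
        using null dini_gap_borel[OF cont] by (auto simp: null_sets_def)
      then show ?thesis using AE_not_in by auto
    qed simp
  qed
  then show ?thesis
  proof (rule AE_mp, intro AE_I2 impI)
    fix x assume *: "\<forall>p\<in>\<rat>. \<forall>q\<in>\<rat>. p < q \<longrightarrow> x \<notin> dini_gap f \<xi> p q"
    show "\<exists>l. ((\<lambda>h. (f (x + h *\<^sub>R \<xi>) - f x) / h) \<longlongrightarrow> l) (at 0)"
    proof (rule tendsto_of_no_dini_gap)
      fix h
      have "\<bar>f (x + h *\<^sub>R \<xi>) - f x\<bar> \<le> L * norm (h *\<^sub>R \<xi>)"
        using lipschitz_onD[OF f, of "x + h *\<^sub>R \<xi>" x] by (simp add: dist_norm)
      then show "\<bar>(f (x + h *\<^sub>R \<xi>) - f x) / h\<bar> \<le> L * norm \<xi>"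
        using L by (cases "h = 0") (auto simp: abs_divide divide_simps mult_ac)
    qed (use * in auto)
  qed
qed

section \<open>Almost everywhere linearity of directional derivatives\<close>

definition dir_deriv :: "('a::real_normed_vector \<Rightarrow> real) \<Rightarrow> 'a \<Rightarrow> 'a \<Rightarrow> real" where
  "dir_deriv f \<xi> x = lim (\<lambda>n. (f (x + (1 / real (Suc n)) *\<^sub>R \<xi>) - f x) / (1 / real (Suc n)))"

lemma tendsto_difference_quotient_seq:
  assumes "((\<lambda>h. (f (x + h *\<^sub>R \<xi>) - f x) / h) \<longlongrightarrow> l) (at (0::real))"
  shows "(\<lambda>n. (f (x + (1 / real (Suc n)) *\<^sub>R \<xi>) - f x) / (1 / real (Suc n))) \<longlonglongrightarrow> l"
proof -
  have "filterlim (\<lambda>n. 1 / real (Suc n)) (at 0) sequentially"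
    unfolding filterlim_at using lim_1_over_n[THEN LIMSEQ_Suc] by (auto simp: eventually_sequentially)
  then show ?thesis using assms by (rule filterlim_compose[rotated])
qed

lemma dir_deriv_eqI:
  assumes "((\<lambda>h. (f (x + h *\<^sub>R \<xi>) - f x) / h) \<longlongrightarrow> l) (at (0::real))"
  shows "dir_deriv f \<xi> x = l"
  unfolding dir_deriv_def using tendsto_difference_quotient_seq[OF assms] by (rule limI)

lemma tendsto_difference_quotient_scaleR:
  fixes f :: "'a::real_normed_vector \<Rightarrow> real"
  assumes "((\<lambda>h. (f (x + h *\<^sub>R \<xi>) - f x) / h) \<longlongrightarrow> l) (at (0::real))"
  shows "((\<lambda>h. (f (x + h *\<^sub>R (c *\<^sub>R \<xi>)) - f x) / h) \<longlongrightarrow> c * l) (at (0::real))"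
proof (cases "c = 0")
  case False
  have "filterlim (\<lambda>h. h * c) (at 0) (at 0)"
    unfolding filterlim_at using False by (auto intro!: tendsto_eq_intros simp: eventually_at_filter)
  from filterlim_compose[OF assms this]
  have "((\<lambda>h. c * ((f (x + (h * c) *\<^sub>R \<xi>) - f x) / (h * c))) \<longlongrightarrow> c * l) (at 0)"
    by (intro tendsto_mult_left)
  then show ?thesis using False by (simp add: divide_simps)
qed simp

text \<open>This is why \<open>dir_deriv\<close> is a limit along the steps
  \<open>1 / (n + 1)\<close>: a sequential limit of measurable quotients is Borel on the whole
  space, including points where the full directional derivative fails to exist.\<close>

lemma dir_deriv_measurable:
  fixes f :: "'a::euclidean_space \<Rightarrow> real"
  assumes "continuous_on UNIV f"
  shows "dir_deriv f \<xi> \<in> borel_measurable borel"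
proof -
  have [measurable]: "f \<in> borel_measurable borel" using assms by (rule borel_measurable_continuous_onI)
  show ?thesis unfolding dir_deriv_def[abs_def] by measurable
qed

text \<open>Adding the bound \<open>M\<close> turns the claim into equality of the nonnegative
  densities \<open>d + M\<close> and \<open>M\<close>. Their measures agree on boxes, an
  intersection-stable generator, and densities are unique almost everywhere.\<close>

lemma AE_zero_of_box_integrals:
  fixes d :: "'a::euclidean_space \<Rightarrow> real"
  assumes [measurable]: "d \<in> borel_measurable borel" and bdd: "AE x in lborel. \<bar>d x\<bar> \<le> M" and M: "0 \<le> M"
    and zero: "\<And>a b. (\<integral>x. indicator (box a b) x * d x \<partial>lborel) = 0"
  shows "AE x in lborel. d x = 0"
proof -
  have eq: "emeasure (density lborel (\<lambda>x. ennreal (d x + M))) (box a b) = emeasure (density lborel (\<lambda>_. ennreal M)) (box a b)"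
    for a b
  proof -
    have int1: "integrable lborel (\<lambda>x. indicator (box a b) x * M)"
      using emeasure_lborel_box_finite[of a b] by (intro integrable_mult_left integrable_real_indicator) auto
    have int2: "integrable lborel (\<lambda>x. indicator (box a b) x * d x)"
    proof (rule Bochner_Integration.integrable_bound[OF int1])
      show "AE x in lborel. norm (indicator (box a b) x * d x) \<le> norm (indicator (box a b) x * M)"
        using bdd by eventually_elim (auto simp: indicator_def)
    qed simp
    have "emeasure (density lborel (\<lambda>x. ennreal (d x + M))) (box a b) =
        (\<integral>\<^sup>+x. ennreal (indicator (box a b) x * d x + indicator (box a b) x * M) \<partial>lborel)"
      by (subst emeasure_density) (auto intro!: nn_integral_cong simp: indicator_def)
    also have "\<dots> = ennreal (\<integral>x. indicator (box a b) x * d x + indicator (box a b) x * M \<partial>lborel)"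
    proof (rule nn_integral_eq_integral)
      show "AE x in lborel. 0 \<le> indicator (box a b) x * d x + indicator (box a b) x * M"
        using bdd by eventually_elim (auto simp: indicator_def)
    qed (use int1 int2 in auto)
    also have "(\<integral>x. indicator (box a b) x * d x + indicator (box a b) x * M \<partial>lborel) = (\<integral>x. indicator (box a b) x * M \<partial>lborel)"
      using int1 int2 zero[of a b] by (subst Bochner_Integration.integral_add) auto
    also have "ennreal (\<integral>x. indicator (box a b) x * M \<partial>lborel) = (\<integral>\<^sup>+x. ennreal (indicator (box a b) x * M) \<partial>lborel)"
      using M int1 by (intro nn_integral_eq_integral[symmetric]) auto
    also have "\<dots> = emeasure (density lborel (\<lambda>_. ennreal M)) (box a b)"
      by (subst emeasure_density) (auto intro!: nn_integral_cong simp: indicator_def)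
    finally show ?thesis .
  qed
  have "density lborel (\<lambda>x. ennreal (d x + M)) = density lborel (\<lambda>_. ennreal M)"
  proof (rule measure_eqI_generator_eq)
    let ?E = "range (\<lambda>(a, b). box a b::'a set)"
    show "Int_stable ?E"
      by (auto simp: Int_stable_def box_Int_box)
    show "?E \<subseteq> Pow UNIV" "sets (density lborel (\<lambda>x. ennreal (d x + M))) = sigma_sets UNIV ?E"
      "sets (density lborel (\<lambda>_. ennreal M)) = sigma_sets UNIV ?E"
      by (simp_all add: borel_eq_box)
    let ?A = "\<lambda>n::nat. box (- (real n *\<^sub>R One)) (real n *\<^sub>R One) :: 'a set"
    show "range ?A \<subseteq> ?E" "(\<Union>i. ?A i) = UNIV"
      unfolding UN_box_eq_UNIV by auto
    show "emeasure (density lborel (\<lambda>x. ennreal (d x + M))) (?A i) \<noteq> \<infinity>" for i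
      using emeasure_lborel_box_finite
      by (subst eq, subst emeasure_density) (auto simp: nn_integral_cmult ennreal_mult_eq_top_iff)
    show "emeasure (density lborel (\<lambda>x. ennreal (d x + M))) X = emeasure (density lborel (\<lambda>_. ennreal M)) X"
      if "X \<in> ?E" for X
      using that eq by auto
  qed
  then have "AE x in lborel. ennreal (d x + M) = ennreal M"
    by (rule sigma_finite_measure.density_unique[OF lborel.sigma_finite_measure_axioms, rotated 2]) auto
  with bdd show ?thesis
    by eventually_elim (use M in \<open>auto simp: ennreal_inj\<close>)
qed

context
  fixes f :: "'a::euclidean_space \<Rightarrow> real" and L :: real
  assumes lip: "L-lipschitz_on UNIV f"
begin

lemma lipschitz_measurable[measurable]: "f \<in> borel_measurable borel"
  using lip by (intro borel_measurable_continuous_onI lipschitz_on_continuous_on)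

lemma dir_deriv_measurable'[measurable]: "dir_deriv f \<xi> \<in> borel_measurable borel"
  using lip by (intro dir_deriv_measurable lipschitz_on_continuous_on)

lemma difference_quotient_bound:
  "\<bar>(f (x + h *\<^sub>R \<xi>) - f x) / h\<bar> \<le> L * norm \<xi>"
proof -
  have "\<bar>f (x + h *\<^sub>R \<xi>) - f x\<bar> \<le> L * norm (h *\<^sub>R \<xi>)"
    using lipschitz_onD[OF lip, of "x + h *\<^sub>R \<xi>" x] by (simp add: dist_norm)
  then show ?thesis
    using lipschitz_on_nonneg[OF lip] by (cases "h = 0") (auto simp: abs_divide divide_simps mult_ac)
qed

lemma AE_dir_deriv:
  "AE x in lborel. ((\<lambda>h. (f (x + h *\<^sub>R \<xi>) - f x) / h) \<longlongrightarrow> dir_deriv f \<xi> x) (at 0)"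
  using AE_directional_derivative[OF lip, of \<xi>] by eventually_elim (metis dir_deriv_eqI)

lemma AE_dir_deriv_bound: "AE x in lborel. \<bar>dir_deriv f \<xi> x\<bar> \<le> L * norm \<xi>"
  using AE_dir_deriv[of \<xi>]
proof eventually_elim
  case (elim x)
  then show ?case
    by (intro tendsto_upperbound[OF tendsto_rabs[OF elim]] always_eventually allI difference_quotient_bound) auto
qed

lemma AE_dir_deriv_scaleR: "AE x in lborel. dir_deriv f (c *\<^sub>R \<xi>) x = c * dir_deriv f \<xi> x"
  using AE_dir_deriv[of \<xi>]
  by eventually_elim (intro dir_deriv_eqI tendsto_difference_quotient_scaleR)

lemma tendsto_integral_difference_quotient:
  assumes [measurable]: "A \<in> sets borel" and fin: "emeasure lborel A < \<infinity>"
  shows "(\<lambda>n. \<integral>x. indicator A x * ((f (x + (1 / real (Suc n)) *\<^sub>R \<xi>) - f x) / (1 / real (Suc n))) \<partial>lborel)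
    \<longlonglongrightarrow> (\<integral>x. indicator A x * dir_deriv f \<xi> x \<partial>lborel)"
    and "integrable lborel (\<lambda>x. indicator A x * dir_deriv f \<xi> x)"
    and "integrable lborel (\<lambda>x. indicator A x * ((f (x + h *\<^sub>R \<xi>) - f x) / h))"
proof -
  have w: "integrable lborel (\<lambda>x. indicator A x * (L * norm \<xi>))"
    using fin by (intro integrable_mult_left integrable_real_indicator) auto
  have lim: "AE x in lborel. (\<lambda>n. indicator A x * ((f (x + (1 / real (Suc n)) *\<^sub>R \<xi>) - f x) / (1 / real (Suc n)))) \<longlonglongrightarrow> indicator A x * dir_deriv f \<xi> x"
    using AE_dir_deriv[of \<xi>] by eventually_elim (intro tendsto_mult_left tendsto_difference_quotient_seq)
  have bd: "norm (indicator A x * ((f (x + h *\<^sub>R \<xi>) - f x) / h)) \<le> indicator A x * (L * norm \<xi>)" for x h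
    using difference_quotient_bound[of x h \<xi>] by (auto simp: indicator_def)
  show "(\<lambda>n. \<integral>x. indicator A x * ((f (x + (1 / real (Suc n)) *\<^sub>R \<xi>) - f x) / (1 / real (Suc n))) \<partial>lborel)
    \<longlonglongrightarrow> (\<integral>x. indicator A x * dir_deriv f \<xi> x \<partial>lborel)"
    by (rule integral_dominated_convergence[OF _ _ w lim]) (measurable, rule AE_I2, rule bd)
  show "integrable lborel (\<lambda>x. indicator A x * dir_deriv f \<xi> x)"
    by (rule integrable_dominated_convergence[OF _ _ w lim]) (measurable, rule AE_I2, rule bd)
  show "integrable lborel (\<lambda>x. indicator A x * ((f (x + h *\<^sub>R \<xi>) - f x) / h))"
    by (rule Bochner_Integration.integrable_bound[OF w]) (measurable, rule AE_I2, rule order_trans[OF bd], simp)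
qed

end

context
  fixes f :: "'a::euclidean_space \<Rightarrow> real" and L :: real
  assumes lip: "L-lipschitz_on UNIV f"
begin

lemmas [measurable] = lipschitz_measurable[OF lip] dir_deriv_measurable'[OF lip]

text \<open>The difference of the two sides, integrated over a box \<open>A\<close>, is the limit of integrals of
  difference quotients in direction \<open>v\<close> over \<open>A\<close> shifted by \<open>u / n\<close> minus \<open>A\<close>.\<close>
lemma AE_dir_deriv_add:
  "AE x in lborel. dir_deriv f (u + v) x = dir_deriv f u x + dir_deriv f v x"
proof -
  let ?d = "\<lambda>x. dir_deriv f (u + v) x - dir_deriv f u x - dir_deriv f v x"
  let ?q = "\<lambda>n \<xi> x. (f (x + (1 / real (Suc n)) *\<^sub>R \<xi>) - f x) / (1 / real (Suc n))"
  have L: "L \<ge> 0" using lip lipschitz_on_nonneg by blast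
  have "AE x in lborel. ?d x = 0"
  proof (rule AE_zero_of_box_integrals)
    show "AE x in lborel. \<bar>?d x\<bar> \<le> L * norm (u + v) + L * norm u + L * norm v"
      using AE_dir_deriv_bound[OF lip, of "u + v"] AE_dir_deriv_bound[OF lip, of u] AE_dir_deriv_bound[OF lip, of v]
      by eventually_elim linarith
    show "0 \<le> L * norm (u + v) + L * norm u + L * norm v"
      using L by simp
    fix a b :: 'a
    let ?A = "box a b"
    let ?s = "\<lambda>n. (1 / real (Suc n)) *\<^sub>R u"
    have fin: "emeasure lborel ?A < \<infinity>" by (rule emeasure_lborel_box_finite)
    have A: "?A \<in> sets borel" by simp
    have "(\<lambda>n. (\<integral>x. indicator ?A x * ?q n (u + v) x \<partial>lborel) - (\<integral>x. indicator ?A x * ?q n u x \<partial>lborel) - (\<integral>x. indicator ?A x * ?q n v x \<partial>lborel))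
       \<longlonglongrightarrow> (\<integral>x. indicator ?A x * dir_deriv f (u + v) x \<partial>lborel) - (\<integral>x. indicator ?A x * dir_deriv f u x \<partial>lborel) - (\<integral>x. indicator ?A x * dir_deriv f v x \<partial>lborel)"
      by (intro tendsto_diff tendsto_integral_difference_quotient(1)[OF lip A fin])
    also have "(\<integral>x. indicator ?A x * dir_deriv f (u + v) x \<partial>lborel) - (\<integral>x. indicator ?A x * dir_deriv f u x \<partial>lborel) - (\<integral>x. indicator ?A x * dir_deriv f v x \<partial>lborel)
       = (\<integral>x. indicator ?A x * ?d x \<partial>lborel)"
      using tendsto_integral_difference_quotient(2)[OF lip A fin]
      by (simp add: right_diff_distrib Bochner_Integration.integral_diff)
    also have "(\<lambda>n. (\<integral>x. indicator ?A x * ?q n (u + v) x \<partial>lborel) - (\<integral>x. indicator ?A x * ?q n u x \<partial>lborel) - (\<integral>x. indicator ?A x * ?q n v x \<partial>lborel))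
       = (\<lambda>n. \<integral>x. (indicator ?A (x - ?s n) - indicator ?A x) * ?q n v x \<partial>lborel)"
    proof
      fix n
      let ?t = "1 / real (Suc n)"
      have int: "integrable lborel (\<lambda>x. indicator ?A x * ?q n \<xi> x)" for \<xi>
        by (rule tendsto_integral_difference_quotient(3)[OF lip A fin])
      \<comment> \<open>A step along \<open>u + v\<close> is a step along \<open>u\<close> followed
        by one along \<open>v\<close>, so the quotient along \<open>v\<close> at the shifted point
        is a difference of two quotients at \<open>x\<close>.\<close>
      have eq: "indicator ?A x * ?q n v (x + ?s n) = indicator ?A x * ?q n (u + v) x - indicator ?A x * ?q n u x" for x
        by (simp add: scaleR_add_right add.assoc) (simp add: left_diff_distrib right_diff_distrib)
      have int2: "integrable lborel (\<lambda>x. indicator ?A x * ?q n v (x + ?s n))"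
        unfolding eq using int by auto
      define g where "g x = indicator ?A (x - ?s n) * ?q n v x" for x
      have [measurable]: "g \<in> borel_measurable borel" unfolding g_def[abs_def] by measurable
      have D: "distr lborel borel (\<lambda>x. x + ?s n) = lborel"
      proof -
        have "(\<lambda>x. x + ?s n) = (+) (?s n)"
          by (rule ext) (rule add.commute)
        then show ?thesis by (simp only: lborel_distr_plus)
      qed
      have gs: "g (x + ?s n) = indicator ?A x * ?q n v (x + ?s n)" for x
        by (simp only: g_def add_diff_cancel_right')
      have int3: "integrable lborel (\<lambda>x. indicator ?A (x - ?s n) * ?q n v x)"
        using int2 integrable_distr_eq[of "\<lambda>x. x + ?s n" lborel borel g]
        unfolding D gs g_def[abs_def] by simp
      have "(\<integral>x. indicator ?A (x - ?s n) * ?q n v x \<partial>lborel) = (\<integral>x. indicator ?A x * ?q n v (x + ?s n) \<partial>lborel)"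
        using integral_distr[of "\<lambda>x. x + ?s n" lborel borel g]
        unfolding D gs unfolding g_def[abs_def] by simp
      also have "\<dots> = (\<integral>x. indicator ?A x * ?q n (u + v) x \<partial>lborel) - (\<integral>x. indicator ?A x * ?q n u x \<partial>lborel)"
        unfolding eq by (rule Bochner_Integration.integral_diff[OF int int])
      finally show "(\<integral>x. indicator ?A x * ?q n (u + v) x \<partial>lborel) - (\<integral>x. indicator ?A x * ?q n u x \<partial>lborel) - (\<integral>x. indicator ?A x * ?q n v x \<partial>lborel)
         = (\<integral>x. (indicator ?A (x - ?s n) - indicator ?A x) * ?q n v x \<partial>lborel)"
        unfolding left_diff_distrib by (subst Bochner_Integration.integral_diff[OF int3 int]) simp
    qed
    finally have lim1: "(\<lambda>n. \<integral>x. (indicator ?A (x - ?s n) - indicator ?A x) * ?q n v x \<partial>lborel) \<longlonglongrightarrow> (\<integral>x. indicator ?A x * ?d x \<partial>lborel)" .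
    obtain R where "\<forall>x\<in>?A. norm x \<le> R"
      using bounded_box[of a b, unfolded bounded_iff] by blast
    then have R: "?A \<subseteq> cball 0 R" by auto
    have s0: "?s \<longlonglongrightarrow> 0"
      using tendsto_scaleR[OF lim_1_over_n[THEN LIMSEQ_Suc] tendsto_const[of u]] by simp
    have "(\<lambda>n. \<integral>x. (indicator ?A (x - ?s n) - indicator ?A x) * ?q n v x \<partial>lborel) \<longlonglongrightarrow> (\<integral>x. 0 \<partial>(lborel :: 'a measure))"
    proof (rule integral_dominated_convergence)
      show "integrable lborel (\<lambda>x. indicator (cball 0 (R + norm u)) x * (L * norm v))"
        using emeasure_lborel_cball_finite by (intro integrable_mult_left integrable_real_indicator) auto
      \<comment> \<open>Off the frontier of the box, which is a null set, shifting the box by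
        \<open>?s n\<close> eventually no longer changes membership of \<open>x\<close>.\<close>
      show "AE x in lborel. (\<lambda>n. (indicator ?A (x - ?s n) - indicator ?A x) * ?q n v x) \<longlonglongrightarrow> 0"
      proof -
        have "frontier ?A \<in> null_sets lborel"
          using negligible_convex_frontier[OF convex_box(2)] frontier_closed
          by (auto simp: negligible_iff_null_sets null_sets_def emeasure_completion)
        then have "AE x in lborel. x \<notin> frontier ?A" by (rule AE_not_in)
        then show ?thesis
        proof eventually_elim
          case (elim x)
          have lim: "(\<lambda>n. x - ?s n) \<longlonglongrightarrow> x"
            using tendsto_diff[OF tendsto_const[of x] s0] by simp
          have "eventually (\<lambda>n. (x - ?s n \<in> ?A) = (x \<in> ?A)) sequentially"
          proof (cases "x \<in> ?A")
            case True
            then show ?thesis using topological_tendstoD[OF lim open_box True] by simp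
          next
            case False
            with elim have "x \<in> - closure ?A" using interior_subset[of ?A] by (auto simp: frontier_def)
            from topological_tendstoD[OF lim _ this]
            have "eventually (\<lambda>n. x - ?s n \<in> - closure ?A) sequentially" by auto
            then show ?thesis by eventually_elim (use False closure_subset in auto)
          qed
          then have "eventually (\<lambda>n. (indicator ?A (x - ?s n) - indicator ?A x) * ?q n v x = 0) sequentially"
            by eventually_elim (auto simp: indicator_def)
          then show ?case by (rule tendsto_eventually)
        qed
      qed
      show "AE x in lborel. norm ((indicator ?A (x - ?s n) - indicator ?A x) * ?q n v x) \<le> indicator (cball 0 (R + norm u)) x * (L * norm v)" for n
      proof (rule AE_I2)
        fix x
        have "x \<in> cball 0 (R + norm u)" if "x - ?s n \<in> ?A \<or> x \<in> ?A"
        proof -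
          have "norm (?s n) \<le> norm u"
            by (simp add: divide_le_eq distrib_left)
          moreover have "norm (x - ?s n) \<le> R \<or> norm x \<le> R" using that R by auto
          moreover have "norm x \<le> norm (x - ?s n) + norm (?s n)"
            using norm_triangle_ineq[of "x - ?s n" "?s n"] by simp
          ultimately show ?thesis using norm_ge_zero[of u] by (auto simp del: norm_ge_zero)
        qed
        then show "norm ((indicator ?A (x - ?s n) - indicator ?A x) * ?q n v x) \<le> indicator (cball 0 (R + norm u)) x * (L * norm v)"
          using difference_quotient_bound[OF lip, of x "1 / real (Suc n)" v] L
          by (auto simp: indicator_def)
      qed
    qed measurable
    then show "(\<integral>x. indicator ?A x * ?d x \<partial>lborel) = 0"
      using LIMSEQ_unique[OF lim1] by simp
  qed measurable
  then show ?thesis by eventually_elim simp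
qed

section \<open>From directional derivatives to differentiability\<close>

lemma AE_dir_deriv_linear:
  "AE x in lborel. dir_deriv f w x = (\<Sum>b\<in>Basis. (w \<bullet> b) * dir_deriv f b x)"
proof -
  have "AE x in lborel. dir_deriv f (\<Sum>b\<in>S. (w \<bullet> b) *\<^sub>R b) x = (\<Sum>b\<in>S. (w \<bullet> b) * dir_deriv f b x)"
    if "finite S" for S
    using that
  proof (induction S rule: finite_induct)
    case empty
    have "dir_deriv f 0 x = 0" for x
      by (rule dir_deriv_eqI) simp
    then show ?case by simp
  next
    case (insert b S)
    show ?case
      using insert.IH AE_dir_deriv_add[of "(w \<bullet> b) *\<^sub>R b" "\<Sum>b\<in>S. (w \<bullet> b) *\<^sub>R b"] AE_dir_deriv_scaleR[OF lip, of "w \<bullet> b" b]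
      by eventually_elim (use insert.hyps in simp)
  qed
  from this[OF finite_Basis] show ?thesis
    by (simp add: euclidean_representation)
qed

text \<open>By compactness finitely many directions of \<open>W\<close> are \<eta>-close to every
  unit vector, so the convergence along them is uniform. The Lipschitz bound for \<open>f\<close>
  and the boundedness of \<open>T\<close> transfer it to all directions.\<close>

lemma has_derivative_of_dense_directions:
  assumes dense: "closure W = UNIV" and T: "bounded_linear T"
    and W: "\<And>w. w \<in> W \<Longrightarrow> ((\<lambda>h. (f (x + h *\<^sub>R w) - f x) / h) \<longlongrightarrow> T w) (at (0::real))"
  shows "(f has_derivative T) (at x)"
  unfolding has_derivative_at_alt
proof (intro conjI T allI impI)
  interpret T: bounded_linear T by (rule T)
  fix e :: real assume e: "e > 0"
  obtain K where K: "K \<ge> 0" "\<And>v. norm (T v) \<le> norm v * K"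
    using T.nonneg_bounded by blast
  have L: "L \<ge> 0" using lip lipschitz_on_nonneg by blast
  \<comment> \<open>Per unit step, replacing a direction \<open>u\<close> by a nearby
    \<open>w\<close> costs \<open>L * \<eta>\<close> in \<open>f\<close> and
    \<open>K * \<eta>\<close> in \<open>T\<close>, and the difference quotient along
    \<open>w\<close> costs another \<eta>.\<close>
  define \<eta> where "\<eta> = e / (L + K + 1)"
  have \<eta>: "\<eta> > 0" "\<eta> * (L + K + 1) = e" using e L K by (auto simp: \<eta>_def)
  have "sphere (0::'a) 1 \<subseteq> (\<Union>w\<in>W. ball w \<eta>)"
  proof
    fix y :: 'a
    have "y \<in> closure W" using dense by simp
    then show "y \<in> (\<Union>w\<in>W. ball w \<eta>)"
      using \<eta> by (auto simp: closure_approachable)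
  qed
  with compactE_image[of "sphere (0::'a) 1" W "\<lambda>w. ball w \<eta>"]
  obtain C where C: "C \<subseteq> W" "finite C" "sphere (0::'a) 1 \<subseteq> (\<Union>w\<in>C. ball w \<eta>)"
    by (metis compact_sphere open_ball)
  have "\<exists>\<delta>>0. \<forall>h. 0 < \<bar>h\<bar> \<and> \<bar>h\<bar> < \<delta> \<longrightarrow> \<bar>(f (x + h *\<^sub>R w) - f x) / h - T w\<bar> < \<eta>" if "w \<in> C" for w
    using tendstoD[OF W \<eta>(1), of w] C(1) that by (auto simp: eventually_at dist_real_def)
  then obtain \<delta> where \<delta>: "\<And>w. w \<in> C \<Longrightarrow> \<delta> w > 0"
    "\<And>w h. w \<in> C \<Longrightarrow> 0 < \<bar>h\<bar> \<Longrightarrow> \<bar>h\<bar> < \<delta> w \<Longrightarrow> \<bar>(f (x + h *\<^sub>R w) - f x) / h - T w\<bar> < \<eta>"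
    by metis
  define d where "d = Min (insert 1 (\<delta> ` C))"
  have d: "d > 0" "\<And>w. w \<in> C \<Longrightarrow> d \<le> \<delta> w"
    using C(2) \<delta>(1) by (auto simp: d_def)
  show "\<exists>d>0. \<forall>y. norm (y - x) < d \<longrightarrow> norm (f y - f x - T (y - x)) \<le> e * norm (y - x)"
  proof (intro exI[of _ d] conjI allI impI d(1))
    fix y assume y: "norm (y - x) < d"
    show "norm (f y - f x - T (y - x)) \<le> e * norm (y - x)"
    proof (cases "y = x")
      case False
      define t where "t = norm (y - x)"
      have t: "t > 0" "t < d" using False y by (auto simp: t_def)
      define u where "u = (y - x) /\<^sub>R t"
      have "norm u = 1" using t by (simp add: u_def t_def)
      then obtain w where w: "w \<in> C" "dist w u < \<eta>" using C(3) by auto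
      have yx: "y = x + t *\<^sub>R u" "y - x = t *\<^sub>R u" using t by (auto simp: u_def)
      have 1: "\<bar>f (x + t *\<^sub>R u) - f (x + t *\<^sub>R w)\<bar> \<le> t * (L * \<eta>)"
      proof -
        have "\<bar>f (x + t *\<^sub>R u) - f (x + t *\<^sub>R w)\<bar> \<le> L * dist (x + t *\<^sub>R u) (x + t *\<^sub>R w)"
          using lipschitz_onD[OF lip, of "x + t *\<^sub>R u" "x + t *\<^sub>R w"] by (simp add: dist_real_def)
        also have "dist (x + t *\<^sub>R u) (x + t *\<^sub>R w) = t * dist w u"
          using t by (simp add: dist_norm norm_minus_commute flip: scaleR_diff_right)
        also have "L * (t * dist w u) \<le> L * (t * \<eta>)"
          using L t w by (intro mult_left_mono) auto
        finally show ?thesis by (simp add: mult_ac)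
      qed
      have 2: "\<bar>f (x + t *\<^sub>R w) - f x - t * T w\<bar> \<le> t * \<eta>"
      proof -
        have "\<bar>(f (x + t *\<^sub>R w) - f x) / t - T w\<bar> < \<eta>"
          using \<delta>(2)[OF w(1), of t] d(2)[OF w(1)] t by auto
        moreover have "f (x + t *\<^sub>R w) - f x - t * T w = t * ((f (x + t *\<^sub>R w) - f x) / t - T w)"
          using t by (simp add: field_simps)
        ultimately show ?thesis using t by (simp add: abs_mult)
      qed
      have 3: "\<bar>t * T w - T (t *\<^sub>R u)\<bar> \<le> t * (K * \<eta>)"
      proof -
        have "t * T w - T (t *\<^sub>R u) = t * T (w - u)"
          by (simp add: T.scaleR T.diff right_diff_distrib)
        moreover have "\<bar>T (w - u)\<bar> \<le> K * \<eta>"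
          using K(2)[of "w - u"] w(2) K(1) by (intro order_trans[OF K(2)[of "w - u", simplified]]) (auto simp: dist_norm mult.commute intro!: mult_left_mono)
        ultimately show ?thesis using t by (simp add: abs_mult)
      qed
      have "\<bar>f y - f x - T (y - x)\<bar> \<le> t * (L * \<eta>) + t * \<eta> + t * (K * \<eta>)"
        unfolding yx(2) unfolding yx(1) using 1 2 3 by linarith
      also have "\<dots> = t * (\<eta> * (L + K + 1))" by (simp add: algebra_simps)
      also have "\<dots> = e * norm (y - x)" unfolding \<eta>(2) t_def by simp
      finally show ?thesis by simp
    qed (simp add: T.zero)
  qed
qed

lemma has_derivative_difference_quotient:
  assumes "(f has_derivative T) (at x)"
  shows "((\<lambda>h. (f (x + h *\<^sub>R \<xi>) - f x) / h) \<longlongrightarrow> T \<xi>) (at (0::real))"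
proof -
  interpret T: bounded_linear T using assms by (rule has_derivative_bounded_linear)
  have f': "(f has_derivative T) (at (x + 0 *\<^sub>R \<xi>))"
    using assms by simp
  have "((\<lambda>h. f (x + h *\<^sub>R \<xi>)) has_derivative (\<lambda>h. T (h *\<^sub>R \<xi>))) (at (0::real))"
  proof -
    have "((\<lambda>h. x + h *\<^sub>R \<xi>) has_derivative (\<lambda>h. h *\<^sub>R \<xi>)) (at 0)"
      by (auto intro!: derivative_eq_intros)
    from has_derivative_compose[OF this f'] show ?thesis .
  qed
  then have "((\<lambda>h. f (x + h *\<^sub>R \<xi>)) has_real_derivative T \<xi>) (at 0)"
    by (simp add: has_field_derivative_def T.scaleR mult.commute[of _ "T \<xi>"])
  then show ?thesis by (simp add: DERIV_def)
qed

lemma dir_deriv_eq_frechet: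
  assumes "f differentiable (at x)"
  shows "frechet_derivative f (at x) \<xi> = dir_deriv f \<xi> x"
  using has_derivative_difference_quotient[OF assms[unfolded frechet_derivative_works], of \<xi>]
  by (rule dir_deriv_eqI[symmetric])

lemma not_in_dini_gap:
  assumes l: "((\<lambda>h. (f (x + h *\<^sub>R \<xi>) - f x) / h) \<longlongrightarrow> l) (at (0::real))" and pq: "p < q"
  shows "x \<notin> dini_gap f \<xi> p q"
proof
  assume x: "x \<in> dini_gap f \<xi> p q"
  let ?Q = "\<lambda>h. (f (x + h *\<^sub>R \<xi>) - f x) / h"
  consider "l > p" | "l < q" using pq by linarith
  then show False
  proof cases
    case 1
    from order_tendstoD(1)[OF l this] obtain d where "d > 0" "\<And>h. 0 < \<bar>h\<bar> \<Longrightarrow> \<bar>h\<bar> < d \<Longrightarrow> p < ?Q h"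
      by (auto simp: eventually_at dist_real_def)
    with x show False unfolding dini_gap_def by force
  next
    case 2
    from order_tendstoD(2)[OF l this] obtain d where "d > 0" "\<And>h. 0 < \<bar>h\<bar> \<Longrightarrow> \<bar>h\<bar> < d \<Longrightarrow> ?Q h < q"
      by (auto simp: eventually_at dist_real_def)
    with x show False unfolding dini_gap_def by force
  qed
qed

text \<open>Countably many Borel conditions decide differentiability. This serves twice:
  Rademacher's theorem then needs only countably many null sets, and the set of differentiability is
  Borel, as an upper bound on the essential supremum in \<open>dir_grad_sup\<close>
  requires.\<close>

lemma differentiable_iff_countable:
  obtains W where "countable W" "{x. f differentiable (at x)} =
    {x. \<forall>w\<in>W. (\<forall>p\<in>\<rat>. \<forall>q\<in>\<rat>. p < q \<longrightarrow> x \<notin> dini_gap f w p q) \<and>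
       dir_deriv f w x = (\<Sum>b\<in>Basis. (w \<bullet> b) * dir_deriv f b x)}"
proof -
  obtain W0 :: "'a set" where W0: "countable W0" "closure W0 = UNIV"
    using separable by (metis UNIV_I antisym subsetI)
  define W where "W = W0 \<union> Basis"
  have W: "countable W" "closure W = UNIV"
    using W0 closure_mono[of W0 W] by (auto simp: W_def countable_finite)
  have "f differentiable (at x) \<longleftrightarrow> (\<forall>w\<in>W. (\<forall>p\<in>\<rat>. \<forall>q\<in>\<rat>. p < q \<longrightarrow> x \<notin> dini_gap f w p q) \<and>
       dir_deriv f w x = (\<Sum>b\<in>Basis. (w \<bullet> b) * dir_deriv f b x))" (is "?l \<longleftrightarrow> ?r") for x
  proof
    assume ?l
    then obtain T where T: "(f has_derivative T) (at x)" by (auto simp: differentiable_def)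
    interpret T: bounded_linear T using T by (rule has_derivative_bounded_linear)
    have eq: "dir_deriv f w x = T w" for w
      by (rule dir_deriv_eqI has_derivative_difference_quotient T)+
    have sum: "T w = (\<Sum>b\<in>Basis. (w \<bullet> b) * T b)" for w
    proof -
      have "T w = T (\<Sum>b\<in>Basis. (w \<bullet> b) *\<^sub>R b)" by (simp add: euclidean_representation)
      then show ?thesis by (simp add: T.sum T.scaleR)
    qed
    show ?r
    proof (intro ballI conjI impI)
      show "x \<notin> dini_gap f w p q" if "p < q" for w p q
        using has_derivative_difference_quotient[OF T] that by (rule not_in_dini_gap)
      show "dir_deriv f w x = (\<Sum>b\<in>Basis. (w \<bullet> b) * dir_deriv f b x)" for w
        unfolding eq by (rule sum)
    qed
  next
    assume r: ?r
    have "(f has_derivative (\<lambda>w. \<Sum>b\<in>Basis. (w \<bullet> b) * dir_deriv f b x)) (at x)"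
    proof (rule has_derivative_of_dense_directions[OF W(2)])
      show "bounded_linear (\<lambda>w. \<Sum>b\<in>Basis. (w \<bullet> b) * dir_deriv f b x)"
        by (intro bounded_linear_sum bounded_linear_mult_const bounded_linear_inner_left)
      fix w assume w: "w \<in> W"
      obtain l where l: "((\<lambda>h. (f (x + h *\<^sub>R w) - f x) / h) \<longlongrightarrow> l) (at 0)"
        using tendsto_of_no_dini_gap[of f x w "L * norm w", OF difference_quotient_bound[OF lip]] r w by blast
      with dir_deriv_eqI[OF l] r w
      show "((\<lambda>h. (f (x + h *\<^sub>R w) - f x) / h) \<longlongrightarrow> (\<Sum>b\<in>Basis. (w \<bullet> b) * dir_deriv f b x)) (at 0)"
        by auto
    qed
    then show ?l by (auto simp: differentiable_def)
  qed
  then show ?thesis using that[OF W(1)] by auto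
qed

lemma differentiable_borel: "{x. f differentiable (at x)} \<in> sets borel"
proof -
  obtain W where W: "countable W" "{x. f differentiable (at x)} =
    {x. \<forall>w\<in>W. (\<forall>p\<in>\<rat>. \<forall>q\<in>\<rat>. p < q \<longrightarrow> x \<notin> dini_gap f w p q) \<and>
       dir_deriv f w x = (\<Sum>b\<in>Basis. (w \<bullet> b) * dir_deriv f b x)}"
    by (rule differentiable_iff_countable)
  have [measurable]: "dini_gap f w p q \<in> sets borel" for w p q
    using lip by (intro dini_gap_borel lipschitz_on_continuous_on)
  have "{x. \<forall>w\<in>W. (\<forall>p\<in>\<rat>. \<forall>q\<in>\<rat>. p < q \<longrightarrow> x \<notin> dini_gap f w p q) \<and>
       dir_deriv f w x = (\<Sum>b\<in>Basis. (w \<bullet> b) * dir_deriv f b x)} =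
     (\<Inter>w\<in>W. (\<Inter>p\<in>\<rat>. \<Inter>q\<in>\<rat>\<inter>{p<..}. - dini_gap f w p q) \<inter> {x. dir_deriv f w x = (\<Sum>b\<in>Basis. (w \<bullet> b) * dir_deriv f b x)})"
    by auto
  also have "\<dots> \<in> sets borel"
    using W(1) by (intro sets.countable_INT'' sets.Int borel_comp
       countable_Int1 countable_rat) measurable
  finally show ?thesis using W(2) by simp
qed

text \<open>Existence and linearity in one direction hold off a null set depending on that
  direction; for a countable set of directions the union of these sets is still null.\<close>

theorem rademacher: "AE x in lborel. f differentiable (at x)"
proof -
  obtain W where W: "countable W" "{x. f differentiable (at x)} =
    {x. \<forall>w\<in>W. (\<forall>p\<in>\<rat>. \<forall>q\<in>\<rat>. p < q \<longrightarrow> x \<notin> dini_gap f w p q) \<and>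
       dir_deriv f w x = (\<Sum>b\<in>Basis. (w \<bullet> b) * dir_deriv f b x)}"
    by (rule differentiable_iff_countable)
  have "AE x in lborel. \<forall>w\<in>W. (\<forall>p\<in>\<rat>. \<forall>q\<in>\<rat>. p < q \<longrightarrow> x \<notin> dini_gap f w p q) \<and>
       dir_deriv f w x = (\<Sum>b\<in>Basis. (w \<bullet> b) * dir_deriv f b x)"
  proof (intro AE_ball_countable[THEN iffD2] W(1) ballI)
    fix w
    show "AE x in lborel. (\<forall>p\<in>\<rat>. \<forall>q\<in>\<rat>. p < q \<longrightarrow> x \<notin> dini_gap f w p q) \<and>
       dir_deriv f w x = (\<Sum>b\<in>Basis. (w \<bullet> b) * dir_deriv f b x)"
      using AE_dir_deriv_linear[of w] AE_dir_deriv[OF lip, of w]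
      by eventually_elim (use not_in_dini_gap in blast)
  qed
  then show ?thesis using W(2) by auto
qed

end

section \<open>Directional Lipschitz constants\<close>

text \<open>The N of the overview as a real number. For Lipschitz \<open>f\<close> the conversion
  loses nothing, see \<open>dir_grad_sup_eq\<close>.\<close>

definition lip_norm :: "(real^'n \<Rightarrow> real) \<Rightarrow> real^'n \<Rightarrow> real" where
  "lip_norm f \<xi> = real_of_ereal (dir_grad_sup f \<xi>)"

lemma AE_lborel_translate:
  fixes P :: "'a::euclidean_space \<Rightarrow> bool"
  assumes "AE x in lborel. P x"
  shows "AE x in lborel. P (x + c)"
proof -
  have "(\<lambda>x. x + c) = (+) c" by (rule ext) (rule add.commute)
  then have "AE x in distr lborel borel (\<lambda>x. x + c). P x"
    using assms by (simp only: lborel_distr_plus)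
  then show ?thesis by (rule AE_distrD[rotated]) simp
qed

context
  fixes f :: "real^'n \<Rightarrow> real" and L :: real
  assumes lip: "L-lipschitz_on UNIV f"
begin

lemmas [measurable] = lipschitz_measurable[OF lip] dir_deriv_measurable'[OF lip] differentiable_borel[OF lip]

lemma dir_grad_measurable[measurable]:
  "(\<lambda>x. if f differentiable (at x) then frechet_derivative f (at x) \<xi> else 0) \<in> borel_measurable borel"
proof -
  have "(\<lambda>x. if f differentiable (at x) then frechet_derivative f (at x) \<xi> else 0) =
      (\<lambda>x. if x \<in> {x. f differentiable (at x)} then dir_deriv f \<xi> x else 0)"
    using dir_deriv_eq_frechet[OF lip] by (auto simp: fun_eq_iff)
  also have "\<dots> \<in> borel_measurable borel" by measurable
  finally show ?thesis .
qed

lemma dir_grad_sup_leI: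
  assumes "AE x in lborel. f differentiable (at x) \<longrightarrow> \<bar>frechet_derivative f (at x) \<xi>\<bar> \<le> c" "0 \<le> c"
  shows "dir_grad_sup f \<xi> \<le> ereal c"
  unfolding dir_grad_sup_def
proof (rule esssup_I)
  show "AE x in lborel. ereal \<bar>if f differentiable (at x) then frechet_derivative f (at x) \<xi> else 0\<bar> \<le> ereal c"
    using assms(1) by eventually_elim (use assms(2) in auto)
qed measurable

lemma dir_grad_sup_le_of_line_lipschitz:
  assumes "\<And>x h. \<bar>f (x + h *\<^sub>R \<xi>) - f x\<bar> \<le> c * \<bar>h\<bar>" "0 \<le> c"
  shows "dir_grad_sup f \<xi> \<le> ereal c"
proof (rule dir_grad_sup_leI[OF AE_I2 assms(2)], rule impI)
  fix x assume d: "f differentiable (at x)"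
  have "\<bar>(f (x + h *\<^sub>R \<xi>) - f x) / h\<bar> \<le> c" for h
    using assms(1)[of x h] assms(2) by (cases "h = 0") (auto simp: divide_le_eq)
  then show "\<bar>frechet_derivative f (at x) \<xi>\<bar> \<le> c"
    by (intro tendsto_upperbound[OF tendsto_rabs[OF has_derivative_difference_quotient[OF lip d[unfolded frechet_derivative_works]]]]
      always_eventually allI) auto
qed

lemma dir_grad_sup_eq: "dir_grad_sup f \<xi> = ereal (lip_norm f \<xi>)"
  and lip_norm_nonneg: "0 \<le> lip_norm f \<xi>"
  and lip_norm_le: "lip_norm f \<xi> \<le> L * norm \<xi>"
proof -
  have L: "L \<ge> 0" using lip lipschitz_on_nonneg by blast
  have 1: "dir_grad_sup f \<xi> \<le> ereal (L * norm \<xi>)"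
  proof (rule dir_grad_sup_le_of_line_lipschitz)
    show "\<bar>f (x + h *\<^sub>R \<xi>) - f x\<bar> \<le> L * norm \<xi> * \<bar>h\<bar>" for x h
      using lipschitz_onD[OF lip, of "x + h *\<^sub>R \<xi>" x] by (simp add: dist_norm mult_ac)
  qed (use L in auto)
  have "(0::ereal) = esssup (lborel :: (real^'n) measure) (\<lambda>x. 0)"
    by (rule esssup_const[symmetric]) simp
  also have "\<dots> \<le> dir_grad_sup f \<xi>"
    unfolding dir_grad_sup_def by (rule esssup_mono) auto
  finally have 0: "0 \<le> dir_grad_sup f \<xi>" .
  show "dir_grad_sup f \<xi> = ereal (lip_norm f \<xi>)"
    using 0 1 unfolding lip_norm_def by (cases "dir_grad_sup f \<xi>") auto
  with 0 1 show "0 \<le> lip_norm f \<xi>" "lip_norm f \<xi> \<le> L * norm \<xi>" by auto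
qed

lemma AE_frechet_le_lip_norm:
  "AE x in lborel. f differentiable (at x) \<longrightarrow> \<bar>frechet_derivative f (at x) \<xi>\<bar> \<le> lip_norm f \<xi>"
proof -
  have "AE x in lborel. ereal \<bar>if f differentiable (at x) then frechet_derivative f (at x) \<xi> else 0\<bar> \<le> dir_grad_sup f \<xi>"
    unfolding dir_grad_sup_def by (rule esssup_AE)
  then show ?thesis
    by eventually_elim (auto simp: dir_grad_sup_eq)
qed

lemma lip_norm_leI:
  assumes "AE x in lborel. f differentiable (at x) \<longrightarrow> \<bar>frechet_derivative f (at x) \<xi>\<bar> \<le> c" "0 \<le> c"
  shows "lip_norm f \<xi> \<le> c"
  using dir_grad_sup_leI[OF assms] by (simp add: dir_grad_sup_eq)

lemma lip_norm_add: "lip_norm f (\<xi> + \<eta>) \<le> lip_norm f \<xi> + lip_norm f \<eta>"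
proof (rule lip_norm_leI)
  show "AE x in lborel. f differentiable (at x) \<longrightarrow> \<bar>frechet_derivative f (at x) (\<xi> + \<eta>)\<bar> \<le> lip_norm f \<xi> + lip_norm f \<eta>"
    using AE_frechet_le_lip_norm[of \<xi>] AE_frechet_le_lip_norm[of \<eta>]
  proof eventually_elim
    case (elim x)
    show ?case
    proof
      assume d: "f differentiable (at x)"
      then have "frechet_derivative f (at x) (\<xi> + \<eta>) = frechet_derivative f (at x) \<xi> + frechet_derivative f (at x) \<eta>"
        using linear_add linear_frechet_derivative by blast
      with elim d show "\<bar>frechet_derivative f (at x) (\<xi> + \<eta>)\<bar> \<le> lip_norm f \<xi> + lip_norm f \<eta>" by auto
    qed
  qed
qed (simp add: lip_norm_nonneg)

lemma lip_norm_scaleR_le: "0 < t \<Longrightarrow> lip_norm f (t *\<^sub>R \<xi>) \<le> t * lip_norm f \<xi>"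
proof (rule lip_norm_leI)
  assume t: "0 < t"
  show "AE x in lborel. f differentiable (at x) \<longrightarrow> \<bar>frechet_derivative f (at x) (t *\<^sub>R \<xi>)\<bar> \<le> t * lip_norm f \<xi>"
    using AE_frechet_le_lip_norm[of \<xi>]
  proof eventually_elim
    case (elim x)
    show ?case
    proof
      assume d: "f differentiable (at x)"
      then have "frechet_derivative f (at x) (t *\<^sub>R \<xi>) = t * frechet_derivative f (at x) \<xi>"
        using linear_scale linear_frechet_derivative by fastforce
      with elim d t show "\<bar>frechet_derivative f (at x) (t *\<^sub>R \<xi>)\<bar> \<le> t * lip_norm f \<xi>"
        by (auto simp: abs_mult)
    qed
  qed
qed (simp add: lip_norm_nonneg)

text \<open>The reverse inequality is the same bound with the factor \<open>1 / t\<close>.\<close>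

lemma lip_norm_scaleR: "0 < t \<Longrightarrow> lip_norm f (t *\<^sub>R \<xi>) = t * lip_norm f \<xi>"
  using lip_norm_scaleR_le[of t \<xi>] lip_norm_scaleR_le[of "1 / t" "t *\<^sub>R \<xi>"]
  by (simp add: field_simps)

text \<open>Subadditivity and the bound by \<open>L * norm \<xi>\<close> make
  \<open>lip_norm f\<close> itself \<open>L\<close>-Lipschitz, so measurability in \<xi> follows
  from continuity.\<close>

lemma lip_norm_measurable[measurable]: "lip_norm f \<in> borel_measurable borel"
proof -
  have *: "lip_norm f x - lip_norm f y \<le> L * dist x y" for x y
    using lip_norm_add[of y "x - y"] lip_norm_le[of "x - y"] by (simp add: dist_norm)
  have "L-lipschitz_on UNIV (lip_norm f)"
  proof (rule lipschitz_onI)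
    show "dist (lip_norm f x) (lip_norm f y) \<le> L * dist x y" for x y
      using *[of x y] *[of y x] by (simp add: dist_real_def dist_commute abs_le_iff)
  qed (use lip lipschitz_on_nonneg in blast)
  then show ?thesis
    by (intro borel_measurable_continuous_onI lipschitz_on_continuous_on)
qed

text \<open>Averaging over \<open>A\<close> makes \<open>t \<mapsto> \<integral>\<^sub>A f (x + t \<xi>) dx\<close> differentiable everywhere, so that the mean value theorem
  applies although \<open>f\<close> is differentiable only almost everywhere.\<close>
lemma integral_translate_diff_le:
  fixes A :: "(real^'n) set"
  assumes [measurable]: "A \<in> sets borel" and bdd: "bounded A"
  shows "(\<integral>x. indicator A x * (f x - f (x + \<xi>)) \<partial>lborel) \<le> lip_norm f \<xi> * measure lborel A"
proof -
  have fin: "emeasure lborel A < \<infinity>" using bdd by (rule emeasure_bounded_finite)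
  define F where "F t = (\<integral>x. indicator A x * f (x + t *\<^sub>R \<xi>) \<partial>lborel)" for t
  define D where "D t = (\<integral>x. indicator A x * dir_deriv f \<xi> (x + t *\<^sub>R \<xi>) \<partial>lborel)" for t
  let ?q = "\<lambda>h x. (f (x + h *\<^sub>R \<xi>) - f x) / h"
  have int: "integrable lborel (\<lambda>x. indicator A x * f (x + c))" for c
  proof -
    obtain R where R: "\<forall>x\<in>A. norm x \<le> R" using bdd bounded_iff by blast
    have L: "L \<ge> 0" using lip lipschitz_on_nonneg by blast
    have "integrable lborel (\<lambda>x. indicator A x * (\<bar>f c\<bar> + L * R))"
      using fin by (intro integrable_mult_left integrable_real_indicator) auto
    then show ?thesis
    proof (rule Bochner_Integration.integrable_bound)
      show "AE x in lborel. norm (indicator A x * f (x + c)) \<le> norm (indicator A x * (\<bar>f c\<bar> + L * R))"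
      proof (rule AE_I2)
        fix x
        have "\<bar>f (x + c)\<bar> \<le> \<bar>f c\<bar> + L * R" if "x \<in> A"
        proof -
          have "\<bar>f (x + c) - f c\<bar> \<le> L * norm x"
            using lipschitz_onD[OF lip, of "x + c" c] by (simp add: dist_norm)
          also have "\<dots> \<le> L * R" using R that L by (intro mult_left_mono) auto
          finally show ?thesis by linarith
        qed
        then show "norm (indicator A x * f (x + c)) \<le> norm (indicator A x * (\<bar>f c\<bar> + L * R))"
          by (auto simp: indicator_def)
      qed
    qed measurable
  qed
  have w: "integrable lborel (\<lambda>x. indicator A x * (L * norm \<xi>))"
    using fin by (intro integrable_mult_left integrable_real_indicator) auto
  have deriv: "(F has_real_derivative D t) (at t)" for t
    unfolding DERIV_def
  \<comment> \<open>Differentiability is tested along sequences of steps because dominated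
    convergence is a statement about sequences.\<close>
  proof (rule LIMSEQ_SEQ_conv[THEN iffD1], intro allI impI)
    fix s :: "nat \<Rightarrow> real" assume s: "(\<forall>n. s n \<noteq> 0) \<and> s \<longlonglongrightarrow> 0"
    have "(\<lambda>n. \<integral>x. indicator A x * ?q (s n) (x + t *\<^sub>R \<xi>) \<partial>lborel) \<longlonglongrightarrow> D t"
      unfolding D_def
    proof (rule integral_dominated_convergence[OF _ _ w])
      have fl: "filterlim s (at 0) sequentially" using s by (auto simp: filterlim_at)
      show "AE x in lborel. (\<lambda>n. indicator A x * ?q (s n) (x + t *\<^sub>R \<xi>)) \<longlonglongrightarrow> indicator A x * dir_deriv f \<xi> (x + t *\<^sub>R \<xi>)"
        using AE_lborel_translate[OF AE_dir_deriv[OF lip, of \<xi>], of "t *\<^sub>R \<xi>"]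
        by eventually_elim (intro tendsto_mult_left, rule filterlim_compose[OF _ fl])
      show "AE x in lborel. norm (indicator A x * ?q (s n) (x + t *\<^sub>R \<xi>)) \<le> indicator A x * (L * norm \<xi>)" for n
        using difference_quotient_bound[OF lip, of _ "s n" \<xi>] by (intro AE_I2) (auto simp: indicator_def)
    qed measurable
    moreover have Feq: "(F (t + s n) - F t) / s n = (\<integral>x. indicator A x * ?q (s n) (x + t *\<^sub>R \<xi>) \<partial>lborel)" for n
    proof -
      have "(F (t + s n) - F t) / s n = (\<integral>x. (indicator A x * f (x + (t + s n) *\<^sub>R \<xi>) - indicator A x * f (x + t *\<^sub>R \<xi>)) / s n \<partial>lborel)"
        unfolding F_def by (subst Bochner_Integration.integral_diff[OF int int, symmetric]) simp
      also have "\<dots> = (\<integral>x. indicator A x * ?q (s n) (x + t *\<^sub>R \<xi>) \<partial>lborel)"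
        by (intro Bochner_Integration.integral_cong) (auto simp: algebra_simps diff_divide_distrib)
      finally show ?thesis .
    qed
    ultimately show "(\<lambda>n. (F (t + s n) - F t) / s n) \<longlonglongrightarrow> D t"
      by (simp only: Feq)
  qed
  have Dle: "- D t \<le> lip_norm f \<xi> * measure lborel A" for t
  proof -
    have AEb: "AE x in lborel. \<bar>dir_deriv f \<xi> x\<bar> \<le> lip_norm f \<xi>"
      using AE_frechet_le_lip_norm[of \<xi>] rademacher[OF lip]
      by eventually_elim (simp add: dir_deriv_eq_frechet[OF lip])
    have iw: "integrable lborel (\<lambda>x. indicator A x * lip_norm f \<xi>)"
      using fin by (intro integrable_mult_left integrable_real_indicator) auto
    have bd: "AE x in lborel. norm (indicator A x * dir_deriv f \<xi> (x + t *\<^sub>R \<xi>)) \<le> indicator A x * lip_norm f \<xi>"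
      using AE_lborel_translate[OF AEb, of "t *\<^sub>R \<xi>"] by eventually_elim (auto simp: indicator_def)
    have iD: "integrable lborel (\<lambda>x. indicator A x * dir_deriv f \<xi> (x + t *\<^sub>R \<xi>))"
    proof (rule Bochner_Integration.integrable_bound[OF iw])
      show "AE x in lborel. norm (indicator A x * dir_deriv f \<xi> (x + t *\<^sub>R \<xi>)) \<le> norm (indicator A x * lip_norm f \<xi>)"
        using bd by eventually_elim (auto intro: order_trans)
    qed measurable
    have "norm (D t) \<le> (\<integral>x. norm (indicator A x * dir_deriv f \<xi> (x + t *\<^sub>R \<xi>)) \<partial>lborel)"
      unfolding D_def by (rule integral_norm_bound)
    also have "\<dots> \<le> (\<integral>x. indicator A x * lip_norm f \<xi> \<partial>lborel)"
      using iD iw bd by (intro integral_mono_AE integrable_norm)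
    finally have "norm (D t) \<le> (\<integral>x. indicator A x * lip_norm f \<xi> \<partial>lborel)" .
    then show ?thesis by (simp add: mult.commute)
  qed
  obtain z where "F 1 - F 0 = (1 - 0) * D z"
    using MVT2[of 0 1 F D] deriv by auto
  then have "F 0 - F 1 \<le> lip_norm f \<xi> * measure lborel A"
    using Dle[of z] by simp
  moreover have "F 0 - F 1 = (\<integral>x. indicator A x * (f x - f (x + \<xi>)) \<partial>lborel)"
    unfolding F_def using int[of 0] int[of \<xi>]
    by (simp add: right_diff_distrib Bochner_Integration.integral_diff)
  ultimately show ?thesis by simp
qed

text \<open>A violation at one point would persist, by continuity and with a fixed margin, on a
  small ball, contradicting the bound for averages over that ball.\<close>

lemma translate_diff_le_lip_norm: "f x - f (x + \<xi>) \<le> lip_norm f \<xi>"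
proof (rule ccontr)
  assume neg: "\<not> ?thesis"
  define \<epsilon> where "\<epsilon> = (f x - f (x + \<xi>) - lip_norm f \<xi>) / 2"
  have \<epsilon>: "\<epsilon> > 0" using neg by (simp add: \<epsilon>_def)
  have cf: "continuous_on UNIV f" using lip by (rule lipschitz_on_continuous_on)
  have "continuous_on UNIV (\<lambda>y. f y - f (y + \<xi>))"
    by (intro continuous_intros continuous_on_compose2[OF cf] cf) auto
  then have "open {y. lip_norm f \<xi> + \<epsilon> < f y - f (y + \<xi>)}"
    by (intro open_Collect_less continuous_on_const)
  moreover have "x \<in> {y. lip_norm f \<xi> + \<epsilon> < f y - f (y + \<xi>)}"
    using \<epsilon> by (simp add: \<epsilon>_def field_simps)
  ultimately obtain r where r: "r > 0" "ball x r \<subseteq> {y. lip_norm f \<xi> + \<epsilon> < f y - f (y + \<xi>)}"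
    by (meson openE)
  let ?A = "ball x r"
  have [measurable]: "?A \<in> sets borel" "(\<lambda>y. f y - f (y + \<xi>)) \<in> borel_measurable borel"
    by simp_all
  have fin: "emeasure lborel ?A < \<infinity>" by (rule emeasure_lborel_ball_finite)
  have L: "L \<ge> 0" using lip lipschitz_on_nonneg by blast
  have "(lip_norm f \<xi> + \<epsilon>) * measure lborel ?A = (\<integral>y. indicator ?A y * (lip_norm f \<xi> + \<epsilon>) \<partial>lborel)"
    using fin by simp
  also have "\<dots> \<le> (\<integral>y. indicator ?A y * (f y - f (y + \<xi>)) \<partial>lborel)"
  proof (rule integral_mono)
    show "integrable lborel (\<lambda>y. indicator ?A y * (lip_norm f \<xi> + \<epsilon>))"
      using fin by (intro integrable_mult_left integrable_real_indicator) auto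
    have "integrable lborel (\<lambda>y. indicator ?A y * (L * norm \<xi>))"
      using fin by (intro integrable_mult_left integrable_real_indicator) auto
    then show "integrable lborel (\<lambda>y. indicator ?A y * (f y - f (y + \<xi>)))"
    proof (rule Bochner_Integration.integrable_bound)
      show "AE y in lborel. norm (indicator ?A y * (f y - f (y + \<xi>))) \<le> norm (indicator ?A y * (L * norm \<xi>))"
      proof (rule AE_I2)
        fix y
        have "\<bar>f y - f (y + \<xi>)\<bar> \<le> L * norm \<xi>"
          using lipschitz_onD[OF lip, of y "y + \<xi>"] by (simp add: dist_norm)
        then show "norm (indicator ?A y * (f y - f (y + \<xi>))) \<le> norm (indicator ?A y * (L * norm \<xi>))"
          by (auto simp: indicator_def)
      qed
    qed measurable
  qed (use r in \<open>auto simp: indicator_def\<close>)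
  also have "\<dots> \<le> lip_norm f \<xi> * measure lborel ?A"
    by (rule integral_translate_diff_le) auto
  finally have "\<epsilon> * measure lborel ?A \<le> 0" by (simp add: distrib_right)
  moreover have "measure lborel ?A > 0" using r(1) by (rule content_ball_pos)
  ultimately show False using \<epsilon> by (simp add: mult_le_0_iff)
qed

end

section \<open>The entropy inequality\<close>

text \<open>Prekopa-Leindler with \<open>h = e\<^sup>f\<close>, weights \<open>k/(k+1)\<close> and \<open>1/(k+1)\<close>; the entropy
  appears as the derivative at \<open>0\<close> of \<open>s \<mapsto> \<integral> e\<^bsup>(1+s) f\<^esup>\<close> when \<open>k = 1/s\<close> tends to infinity.\<close>
context
  fixes f N :: "'a::euclidean_space \<Rightarrow> real"
  assumes [measurable]: "f \<in> borel_measurable borel" "N \<in> borel_measurable borel"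
    and N0: "\<And>x. 0 \<le> N x" and hom: "\<And>t x. t > 0 \<Longrightarrow> N (t *\<^sub>R x) = t * N x"
    and le: "\<And>x y. f x - f (x + y) \<le> N y"
    and one: "(\<integral>\<^sup>+x. ennreal (exp (f x)) \<partial>lborel) = 1"
begin

lemma entropy_prekopa_leindler:
  assumes k: "0 < k"
  shows "ennreal (((1 + 1 / real k) ^ k) ^ DIM('a)) * ((\<integral>\<^sup>+x. ennreal (exp (f x + f x / real k)) \<partial>lborel) ^ k
     * (\<integral>\<^sup>+x. ennreal (exp (- N x)) \<partial>lborel)) \<le> 1"
proof -
  let ?n = "DIM('a)" and ?F = "\<integral>\<^sup>+x. ennreal (exp (f x + f x / real k)) \<partial>lborel"
  \<comment> \<open>Prekopa-Leindler produces \<open>exp (- (k+1) * N)\<close>; by homogeneity a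
    dilation by \<open>k + 1\<close> restores \<open>exp (- N)\<close> at the cost of the factor
    \<open>(k+1) ^ n\<close>.\<close>
  have G: "(\<integral>\<^sup>+x. ennreal (exp (- N x)) \<partial>lborel) = ennreal (real (k+1) ^ ?n) * (\<integral>\<^sup>+x. ennreal (exp (- (real (k+1) * N x))) \<partial>lborel)"
    using nn_integral_scaleR_lborel[of "\<lambda>x. ennreal (exp (- N x))" "real (k+1)"] by (simp add: hom del: of_nat_Suc of_nat_add)
  have "ennreal (pl_const k) ^ ?n * (?F ^ k * (\<integral>\<^sup>+x. ennreal (exp (- (real (k+1) * N x))) \<partial>lborel))
     \<le> (\<integral>\<^sup>+x. ennreal (exp (f x)) \<partial>lborel) ^ (k+1)"
  proof (rule prekopa_leindler[OF k])
    fix x y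
    have "exp (f x + f x / real k) ^ k = exp (real (k+1) * f x)"
      using k by (simp add: exp_of_nat_mult[symmetric] field_simps)
    moreover have "exp (f (x + y)) ^ (k+1) = exp (real (k+1) * f (x + y))"
      by (rule exp_of_nat_mult[symmetric])
    moreover have "exp (real (k+1) * f x) * exp (- (real (k+1) * N y)) \<le> exp (real (k+1) * f (x + y))"
    proof -
      have "real (k+1) * (f x - N y) \<le> real (k+1) * f (x + y)"
        using le[of x y] by (intro mult_left_mono) auto
      then show ?thesis by (simp add: right_diff_distrib flip: exp_add)
    qed
    ultimately show "ennreal (exp (f x + f x / real k)) ^ k * ennreal (exp (- (real (k+1) * N y))) \<le> ennreal (exp (f (x + y))) ^ (k+1)"
      by (simp add: ennreal_power ennreal_leI del: power_Suc of_nat_Suc of_nat_add flip: ennreal_mult'')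
  qed measurable
  also have "\<dots> = 1" using one by simp
  finally have *: "ennreal (pl_const k) ^ ?n * (?F ^ k * (\<integral>\<^sup>+x. ennreal (exp (- (real (k+1) * N x))) \<partial>lborel)) \<le> 1" .
  \<comment> \<open>The second factor, raised to the dimension, is absorbed by the dilation; the
    first stays bounded and tends to e.\<close>
  have "pl_const k = (1 + 1 / real k) ^ k * real (k+1)"
  proof -
    have "1 + 1 / real k = real (k+1) / real k" using k by (simp add: field_simps)
    then show ?thesis by (simp add: pl_const_def power_divide)
  qed
  then have c: "ennreal (pl_const k) ^ ?n = ennreal (((1 + 1 / real k) ^ k) ^ ?n) * ennreal (real (k+1) ^ ?n)"
    by (simp add: ennreal_power power_mult_distrib del: of_nat_Suc of_nat_add flip: ennreal_mult'')
  show ?thesis using * unfolding c G by (simp only: mult_ac)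
qed

text \<open>The case \<open>k = 1\<close> bounds the product of this integral and two positive
  factors by 1, which excludes \<open>top\<close>.\<close>

lemma entropy_partition_finite:
  obtains z where "(\<integral>\<^sup>+x. ennreal (exp (- N x)) \<partial>lborel) = ennreal z" "0 < z"
proof -
  let ?Z = "\<integral>\<^sup>+x. ennreal (exp (- N x)) \<partial>lborel"
  have pos: "(\<integral>\<^sup>+x. ennreal (exp (g x)) \<partial>lborel) \<noteq> 0" if [measurable]: "g \<in> borel_measurable borel" for g :: "'a \<Rightarrow> real"
  proof
    assume "(\<integral>\<^sup>+x. ennreal (exp (g x)) \<partial>lborel) = 0"
    then have "AE x in (lborel :: 'a measure). False"
      by (subst (asm) nn_integral_0_iff_AE) (auto simp: ennreal_eq_0_iff not_le[symmetric])
    then show False by (simp add: eventually_False ae_filter_eq_bot_iff)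
  qed
  have "?Z \<noteq> top"
  proof
    assume "?Z = top"
    with entropy_prekopa_leindler[of 1] pos[of "\<lambda>x. f x + f x"] show False
      by (simp add: ennreal_mult_top ennreal_mult_eq_top_iff top_unique)
  qed
  then show ?thesis
    using that pos[of "\<lambda>x. - N x"] by (cases ?Z) (auto simp: ennreal_eq_0_iff less_le)
qed

theorem entropy_bound:
  assumes z: "(\<integral>\<^sup>+x. ennreal (exp (- N x)) \<partial>lborel) = ennreal z" "0 < z"
  shows "enn2ereal (\<integral>\<^sup>+x. ennreal (max 0 (exp (f x) * f x)) \<partial>lborel) - enn2ereal (\<integral>\<^sup>+x. ennreal (max 0 (- (exp (f x) * f x))) \<partial>lborel)
    \<le> ereal (- real DIM('a) - ln z)"
proof -
  let ?n = "DIM('a)"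
  let ?P = "\<integral>\<^sup>+x. ennreal (max 0 (exp (f x) * f x)) \<partial>lborel" and ?Q = "\<integral>\<^sup>+x. ennreal (max 0 (- (exp (f x) * f x))) \<partial>lborel"
  let ?F = "\<lambda>k. \<integral>\<^sup>+x. ennreal (exp (f x + f x / real k)) \<partial>lborel"
  \<comment> \<open>Since \<open>z > 0\<close>, an infinite \<open>?F k\<close> would make the left
    side of \<open>entropy_prekopa_leindler\<close> infinite.\<close>
  have Ffin: "?F k < top" if k: "0 < k" for k
  proof (rule ccontr)
    assume "\<not> ?F k < top"
    then have "?F k = top" using less_top by blast
    moreover have "((1 + 1 / real k) ^ k) ^ ?n > 0" by (intro zero_less_power) (simp add: add_pos_nonneg)
    ultimately show False
      using entropy_prekopa_leindler[OF k] k z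
      by (simp add: ennreal_mult_top ennreal_top_mult ennreal_eq_0_iff top_unique not_le)
  qed
  \<comment> \<open>By \<open>f \<le> exp f\<close> the positive part of the entropy integrand is
    dominated by \<open>exp (2 * f)\<close>, which is integrable by the case
    \<open>k = 1\<close>.\<close>
  have "?P \<le> ?F 1"
  proof (intro nn_integral_mono ennreal_leI)
    fix x
    have "f x \<le> exp (f x)" using exp_ge_add_one_self[of "f x"] by linarith
    then have "exp (f x) * f x \<le> exp (f x) * exp (f x)" by (intro mult_left_mono) auto
    moreover have "exp (f x) * exp (f x) = exp (f x + f x / real 1)"
      by (subst exp_add) simp
    ultimately show "max 0 (exp (f x) * f x) \<le> exp (f x + f x / real 1)" by simp
  qed
  from le_less_trans[OF this Ffin[OF zero_less_one]] have P: "?P < top" .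
  show ?thesis
  proof (cases "?Q = top")
    \<comment> \<open>With a finite positive part, an infinite negative part makes the entropy minus
      infinity.\<close>
    case True
    obtain p where "?P = ennreal p" "0 \<le> p" using P by (metis ennreal_cases less_irrefl)
    then show ?thesis unfolding True by (simp add: top_ennreal.rep_eq top_ereal_def)
  next
    case False
    define g where "g x = exp (f x) * f x" for x
    have [measurable]: "g \<in> borel_measurable borel" unfolding g_def[abs_def] by measurable
    have max0: "ennreal (max 0 y) = ennreal y" for y by (simp add: max_def ennreal_neg)
    have P': "?P = (\<integral>\<^sup>+x. ennreal (g x) \<partial>lborel)" and Q': "?Q = (\<integral>\<^sup>+x. ennreal (- g x) \<partial>lborel)"
      by (simp_all only: max0 g_def)
    have int: "integrable lborel g"
      unfolding real_integrable_def using P False P' Q' by (auto simp: less_top)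
    define E where "E = (\<integral>x. g x \<partial>lborel)"
    obtain p where p: "?P = ennreal p" "0 \<le> p"
      using P by (rule less_top_ennreal[THEN iffD1, THEN exE]) auto
    have "?Q < top" using False less_top by blast
    then obtain q where q: "?Q = ennreal q" "0 \<le> q"
      by (rule less_top_ennreal[THEN iffD1, THEN exE]) auto
    note pq = p q
    have "E = p - q"
      unfolding E_def real_lebesgue_integral_def[OF int] P'[symmetric] Q'[symmetric] pq using pq by simp
    then have Ent: "enn2ereal ?P - enn2ereal ?Q = ereal E"
      using pq by simp
    have inte: "integrable lborel (\<lambda>x. exp (f x))"
      using one by (intro integrableI_nonneg) auto
    have int1: "(\<integral>x. exp (f x) \<partial>lborel) = 1"
      using one by (subst integral_eq_nn_integral) auto
    \<comment> \<open>From \<open>exp (f / k) \<ge> 1 + f / k\<close> and the normalization,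
      \<open>?F k \<ge> 1 + E / k\<close>, which is the only way the entropy enters.\<close>
    have bound: "((1 + 1 / real k) ^ k) ^ ?n * ((1 + E / real k) ^ k * z) \<le> 1" if k: "0 < k" "0 \<le> 1 + E / real k" for k
    proof -
      have intk: "integrable lborel (\<lambda>x. exp (f x + f x / real k))"
        using Ffin[OF k(1)] by (intro integrableI_nonneg) auto
      have "ennreal (1 + E / real k) = ennreal (\<integral>x. exp (f x) + g x / real k \<partial>lborel)"
        using inte int int1 by (simp add: E_def)
      also have "\<dots> \<le> ennreal (\<integral>x. exp (f x + f x / real k) \<partial>lborel)"
      proof (intro ennreal_leI integral_mono)
        show "integrable lborel (\<lambda>x. exp (f x) + g x / real k)"
          using inte int by auto
        show "integrable lborel (\<lambda>x. exp (f x + f x / real k))" by (fact intk)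
        fix x
        have "exp (f x) * (1 + f x / real k) \<le> exp (f x) * exp (f x / real k)"
          using exp_ge_add_one_self by (intro mult_left_mono) auto
        then show "exp (f x) + g x / real k \<le> exp (f x + f x / real k)"
          by (simp add: g_def exp_add distrib_left)
      qed
      also have "\<dots> = ?F k"
        using intk by (intro nn_integral_eq_integral[symmetric]) auto
      finally have "ennreal (1 + E / real k) ^ k \<le> ?F k ^ k" by (rule power_mono_ennreal)
      then have "ennreal (((1 + 1 / real k) ^ k) ^ ?n) * (ennreal (1 + E / real k) ^ k * ennreal z) \<le> 1"
        using entropy_prekopa_leindler[OF k(1)] unfolding z(1)
        by (meson mult_left_mono mult_right_mono order_trans zero_le)
      then show ?thesis
        using k(2) z by (simp add: ennreal_power flip: ennreal_mult'')
    qed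
    \<comment> \<open>Both powers are exponential limits; in the limit the bound reads e^n e^E z <=
      1, and its logarithm is the claim.\<close>
    have "(\<lambda>k. ((1 + 1 / real k) ^ k) ^ ?n * ((1 + E / real k) ^ k * z)) \<longlonglongrightarrow> exp 1 ^ ?n * (exp E * z)"
      by (intro tendsto_intros tendsto_exp_limit_sequentially)
    moreover have "eventually (\<lambda>k. ((1 + 1 / real k) ^ k) ^ ?n * ((1 + E / real k) ^ k * z) \<le> 1) sequentially"
    proof -
      \<comment> \<open>For \<open>k \<ge> \<bar>E\<bar>\<close> the base \<open>1 + E / k\<close>
        is nonnegative, so \<open>ennreal\<close> does not truncate it before the power is
        taken.\<close>
      obtain m :: nat where m: "\<bar>E\<bar> \<le> real m" using real_arch_simple by blast
      have "((1 + 1 / real k) ^ k) ^ ?n * ((1 + E / real k) ^ k * z) \<le> 1" if "k \<ge> Suc m" for k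
      proof (rule bound)
        show "0 < k" using that by simp
        have "\<bar>E\<bar> \<le> real k" using m that by simp
        then show "0 \<le> 1 + E / real k" using \<open>0 < k\<close> by (simp add: field_simps abs_le_iff)
      qed
      then show ?thesis by (rule eventually_sequentiallyI)
    qed
    ultimately have "exp 1 ^ ?n * (exp E * z) \<le> 1"
      by (rule tendsto_upperbound) simp
    then have "exp (real ?n + E + ln z) \<le> exp 0"
      using z exp_of_nat_mult[of ?n "1::real"] by (simp add: exp_add mult.assoc)
    then have "E \<le> - real ?n - ln z" by simp
    then show ?thesis unfolding Ent by simp
  qed
qed

end

section \<open>The right-hand side in terms of the partition integral\<close>

lemma omega_pos: "omega n > 0"
  unfolding omega_def by (intro divide_pos_pos Gamma_real_pos) (auto simp: add_nonneg_pos)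

text \<open>With S the spherical integral, the n-th powers of \<open>kconst n\<close> and
  \<open>E_inf f\<close> are 1 / (n! omega_n) and n omega_n / S. The volume omega_n cancels from
  their product, leaving 1 / ((n-1)! S) = 1 / z.\<close>

lemma entropy_rhs_eq:
  fixes f :: "real^'n \<Rightarrow> real"
  assumes lip: "L-lipschitz_on UNIV f" and \<beta>: "\<beta> > 0"
    and z: "(\<integral>\<^sup>+\<xi>. ennreal (exp (- lip_norm f \<xi>)) \<partial>lborel) = ennreal z" "z > 0"
  shows "real CARD('n) * ln (\<beta> * kconst CARD('n) / exp 1 * E_inf f) = real CARD('n) * ln \<beta> - real CARD('n) - ln z"
proof -
  let ?n = "CARD('n)"
  let ?S = "sphere_nn_integral (\<lambda>\<xi>. inverse (e2ennreal (dir_grad_sup f \<xi>)) ^ ?n)"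
  have n: "?n > 0" by simp
  have [measurable]: "lip_norm f \<in> borel_measurable borel" by (rule lip_norm_measurable[OF lip])
  have dim: "DIM(real^'n) = ?n" by simp
  have "?S = of_nat ?n * (\<integral>\<^sup>+x\<in>ball 0 1. inverse (ennreal (lip_norm f (x /\<^sub>R norm x))) ^ ?n \<partial>lborel)"
    by (simp only: sphere_nn_integral_def dir_grad_sup_eq[OF lip] e2ennreal_ereal)
  then have Sz: "ennreal (fact (?n - 1)) * ?S = ennreal z"
    using polar_exp_homogeneous[OF lip_norm_measurable[OF lip] lip_norm_nonneg[OF lip] lip_norm_scaleR[OF lip]] z(1)
    unfolding dim by (simp only:)
  \<comment> \<open>As \<open>z\<close> is a positive real, so is the spherical integral; hence
    \<open>enn2real\<close> in \<open>E_inf\<close> does not turn an infinite value into 0.\<close>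
  have "\<exists>s>0. X = ennreal s \<and> r * s = z" if "ennreal r * X = ennreal z" "0 < r" for X r
  proof (cases X)
    case (real s)
    with that z(2) have "r * s = z" by (simp flip: ennreal_mult'')
    with real that z(2) show ?thesis by (metis mult_zero_right order_le_less)
  next
    case top
    with that show ?thesis by (simp add: ennreal_mult_top)
  qed
  from this[OF Sz] obtain s where s: "?S = ennreal s" "s > 0" "fact (?n - 1) * s = z"
    by auto
  then have s0: "s > 0" by (simp only:)
  have E: "E_inf f = (real ?n * omega ?n) powr (1 / real ?n) * s powr (- 1 / real ?n)"
    unfolding E_inf_def s using s0 by simp
  have k: "kconst ?n > 0" and E0: "E_inf f > 0"
    unfolding kconst_def E using s0 omega_pos[of ?n] by auto
  have "real ?n * ln (kconst ?n) = - ln (fact ?n * omega ?n)"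
    using omega_pos[of ?n] by (simp add: kconst_def ln_powr ln_div)
  moreover have "real ?n * ln (E_inf f) = ln (real ?n * omega ?n) - ln s"
    unfolding E using s0 omega_pos[of ?n] by (simp add: ln_mult ln_powr field_simps)
  moreover have "ln (fact ?n * omega ?n) = ln (fact ?n) + ln (omega ?n)" "ln (real ?n * omega ?n) = ln (real ?n) + ln (omega ?n)"
    using omega_pos[of ?n] by (simp_all add: ln_mult)
  moreover have "ln (fact ?n) = ln (real ?n) + ln (fact (?n - 1))"
    using fact_reduce[OF n, where ?'a = real] by (simp add: ln_mult)
  moreover have "ln z = ln (fact (?n - 1)) + ln s"
    unfolding s(3)[symmetric] using s0 by (simp add: ln_mult)
  moreover have lnE: "ln (\<beta> * kconst ?n / exp 1 * E_inf f) = ln \<beta> + ln (kconst ?n) - 1 + ln (E_inf f)"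
    using \<beta> k E0 by (simp add: ln_mult ln_div)
  ultimately show ?thesis unfolding lnE by (simp add: algebra_simps)
qed

lemma partition_scale:
  fixes f :: "real^'n \<Rightarrow> real"
  assumes lip: "L-lipschitz_on UNIV f" and \<beta>: "\<beta> > 0"
  shows "(\<integral>\<^sup>+\<xi>. ennreal (exp (- lip_norm f \<xi>)) \<partial>lborel)
    = ennreal (\<beta> ^ CARD('n)) * (\<integral>\<^sup>+\<xi>. ennreal (exp (- (\<beta> * lip_norm f \<xi>))) \<partial>lborel)"
  using nn_integral_scaleR_lborel[of "\<lambda>\<xi>. ennreal (exp (- lip_norm f \<xi>))" \<beta>] \<beta> lip_norm_measurable[OF lip]
  by (simp add: lip_norm_scaleR[OF lip])

lemma entropy_upper_bound:
  fixes f :: "real^'n \<Rightarrow> real"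
  assumes \<beta>: "\<beta> > 0" and lip: "L-lipschitz_on UNIV f"
    and one: "(\<integral>\<^sup>+x. ennreal (exp (\<beta> * f x)) \<partial>lborel) = 1"
  shows "Ent \<beta> f \<le> ereal (real CARD('n) * ln (\<beta> * kconst CARD('n) / exp 1 * E_inf f))"
proof -
  have [measurable]: "lip_norm f \<in> borel_measurable borel" "f \<in> borel_measurable borel"
    by (rule lip_norm_measurable[OF lip] lipschitz_measurable[OF lip])+
  have le: "\<beta> * f x - \<beta> * f (x + y) \<le> \<beta> * lip_norm f y" for x y
    using mult_left_mono[OF translate_diff_le_lip_norm[OF lip, of x y], of \<beta>] \<beta> by (simp add: right_diff_distrib)
  have N: "0 \<le> \<beta> * lip_norm f x" "t > 0 \<Longrightarrow> \<beta> * lip_norm f (t *\<^sub>R x) = t * (\<beta> * lip_norm f x)" for x t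
    using \<beta> lip_norm_nonneg[OF lip] lip_norm_scaleR[OF lip] by auto
  have m: "(\<lambda>x. \<beta> * f x) \<in> borel_measurable borel" "(\<lambda>x. \<beta> * lip_norm f x) \<in> borel_measurable borel"
    by measurable
  obtain z where z: "(\<integral>\<^sup>+x. ennreal (exp (- (\<beta> * lip_norm f x))) \<partial>lborel) = ennreal z" "0 < z"
    by (rule entropy_partition_finite[OF m N le one])
  have "Ent \<beta> f \<le> ereal (- real CARD('n) - ln z)"
    using entropy_bound[OF m N le one z] by (simp add: Ent_def)
  \<comment> \<open>Here \<open>z\<close> belongs to \<open>\<beta> * lip_norm f\<close>; the
    partition integral of \<open>lip_norm f\<close> itself is \<open>\<beta> ^ n * z\<close>, which
    accounts for the term \<open>n * ln \<beta>\<close>.\<close>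
  also have "- real CARD('n) - ln z = real CARD('n) * ln \<beta> - real CARD('n) - ln (\<beta> ^ CARD('n) * z)"
    using \<beta> z by (simp add: ln_mult ln_realpow)
  also have "\<dots> = real CARD('n) * ln (\<beta> * kconst CARD('n) / exp 1 * E_inf f)"
    using \<beta> z by (intro entropy_rhs_eq[OF lip \<beta>, symmetric])
      (auto simp: partition_scale[OF lip \<beta>] simp flip: ennreal_mult'')
  finally show ?thesis .
qed

section \<open>Equality for cones\<close>

lemma lip_norm_cone:
  fixes A :: "real^'n^'n" and a :: "real^'n" and b c :: real
  assumes b: "b > 0" and A: "invertible A"
  defines "f \<equiv> \<lambda>x. c - b * norm (A *v x - a)"
  shows "\<exists>L. L-lipschitz_on UNIV f" "lip_norm f \<xi> = b * norm (A *v \<xi>)"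
proof -
  have diff: "\<bar>f x - f y\<bar> \<le> b * norm (A *v (x - y))" for x y
  proof -
    have "\<bar>norm (A *v y - a) - norm (A *v x - a)\<bar> \<le> norm (A *v (y - x))"
      using norm_triangle_ineq3[of "A *v y - a" "A *v x - a"] by (simp add: matrix_vector_mult_diff_distrib)
    also have "\<dots> = norm (A *v (x - y))"
      by (metis minus_diff_eq norm_minus_cancel matrix_vector_mult_diff_distrib)
    finally have "b * \<bar>norm (A *v y - a) - norm (A *v x - a)\<bar> \<le> b * norm (A *v (x - y))"
      using b by (intro mult_left_mono) auto
    then show ?thesis using b by (simp add: f_def abs_mult flip: right_diff_distrib)
  qed
  obtain K where K: "K \<ge> 0" "\<And>x. norm (A *v x) \<le> norm x * K"
    using bounded_linear.nonneg_bounded[OF matrix_vector_mul_bounded_linear[of A]] by blast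
  have lip: "(b * K)-lipschitz_on UNIV f"
  proof (rule lipschitz_onI)
    fix x y
    have "b * norm (A *v (x - y)) \<le> b * (norm (x - y) * K)"
      using b K by (intro mult_left_mono) auto
    then show "dist (f x) (f y) \<le> b * K * dist x y"
      using diff[of x y] by (simp add: dist_norm mult_ac)
  qed (use b K in auto)
  then show "\<exists>L. L-lipschitz_on UNIV f" by blast
  have "dir_grad_sup f \<xi> \<le> ereal (b * norm (A *v \<xi>))"
  proof (rule dir_grad_sup_le_of_line_lipschitz[OF lip])
    show "\<bar>f (x + h *\<^sub>R \<xi>) - f x\<bar> \<le> b * norm (A *v \<xi>) * \<bar>h\<bar>" for x h
      using diff[of "x + h *\<^sub>R \<xi>" x] by (simp add: matrix_vector_mult_scaleR mult_ac)
  qed (use b in auto)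
  then have "lip_norm f \<xi> \<le> b * norm (A *v \<xi>)"
    by (simp add: dir_grad_sup_eq[OF lip])
  \<comment> \<open>From the apex \<open>x0\<close> the decrease of \<open>f\<close> along \<xi> is
    exactly \<open>b * norm (A *v \<xi>)\<close>, so the general increment bound yields the lower
    estimate without differentiating the norm.\<close>
  moreover obtain x0 where "A *v x0 = a"
    using A by (metis matrix_vector_mul_assoc matrix_vector_mul_lid invertible_def)
  then have "b * norm (A *v \<xi>) \<le> lip_norm f \<xi>"
    using translate_diff_le_lip_norm[OF lip, of x0 \<xi>] by (simp add: f_def matrix_vector_right_distrib)
  ultimately show "lip_norm f \<xi> = b * norm (A *v \<xi>)" by simp
qed

lemma nn_integral_translate:
  fixes g :: "'a::euclidean_space \<Rightarrow> ennreal"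
  assumes [measurable]: "g \<in> borel_measurable borel"
  shows "(\<integral>\<^sup>+x. g (c + x) \<partial>lborel) = (\<integral>\<^sup>+x. g x \<partial>lborel)"
proof -
  have "(\<integral>\<^sup>+x. g x \<partial>distr lborel borel ((+) c)) = (\<integral>\<^sup>+x. g (c + x) \<partial>lborel)"
    by (rule nn_integral_distr) measurable
  then show ?thesis by (simp add: lborel_distr_plus)
qed

text \<open>Seen from the apex, \<open>\<beta> * f\<close> is \<open>\<beta> * c - q\<close> with
  \<open>q\<close> homogeneous. Normalization makes the integral of \<open>exp (- q)\<close> equal
  to \<open>exp (- (\<beta> * c))\<close>, and \<open>q\<close> has mean n under the normalized
  density, so the entropy is \<open>\<beta> * c - n\<close>. The same integral, inserted into
  \<open>entropy_rhs_eq\<close>, gives this value for the right-hand side.\<close>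

lemma entropy_cone:
  fixes A :: "real^'n^'n" and a :: "real^'n" and b c :: real
  assumes \<beta>: "\<beta> > 0" and b: "b > 0" and A: "invertible A"
  defines "f \<equiv> \<lambda>x. c - b * norm (A *v x - a)"
  assumes one: "(\<integral>\<^sup>+x. ennreal (exp (\<beta> * f x)) \<partial>lborel) = 1"
  shows "Ent \<beta> f = ereal (real CARD('n) * ln (\<beta> * kconst CARD('n) / exp 1 * E_inf f))"
proof -
  let ?n = "CARD('n)"
  obtain L where lip: "L-lipschitz_on UNIV f"
    using lip_norm_cone(1)[OF b A] unfolding f_def by blast
  have N: "lip_norm f \<xi> = b * norm (A *v \<xi>)" for \<xi>
    unfolding f_def by (rule lip_norm_cone(2)[OF b A])
  define q where "q x = \<beta> * (b * norm (A *v x))" for x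
  have [measurable]: "q \<in> borel_measurable borel"
    unfolding q_def by (intro borel_measurable_continuous_onI continuous_intros matrix_vector_mult_linear_continuous_on)
  have q: "0 \<le> q x" "t > 0 \<Longrightarrow> q (t *\<^sub>R x) = t * q x" for x t
    using \<beta> b by (auto simp: q_def matrix_vector_mult_scaleR)
  have qpos: "0 < q x" if "x \<noteq> 0" for x
  proof -
    have "A *v x \<noteq> 0" using A that by (metis inj_matrix_vector_mult injD matrix_vector_mult_0_right)
    then show ?thesis using \<beta> b by (simp add: q_def)
  qed
  obtain x0 where x0: "A *v x0 = a"
    using A by (metis matrix_vector_mul_assoc matrix_vector_mul_lid invertible_def)
  have fq: "\<beta> * f (x0 + x) = \<beta> * c - q x" for x
    by (simp add: f_def q_def matrix_vector_right_distrib x0 algebra_simps)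
  have [measurable]: "f \<in> borel_measurable borel" by (rule lipschitz_measurable[OF lip])
  let ?Z = "\<integral>\<^sup>+x. ennreal (exp (- q x)) \<partial>lborel"
  have "1 = (\<integral>\<^sup>+x. ennreal (exp (\<beta> * f (x0 + x))) \<partial>lborel)"
    using one nn_integral_translate[of "\<lambda>x. ennreal (exp (\<beta> * f x))" x0] by simp
  also have "\<dots> = (\<integral>\<^sup>+x. ennreal (exp (\<beta> * c)) * ennreal (exp (- q x)) \<partial>lborel)"
    by (simp add: fq exp_diff exp_minus divide_inverse flip: ennreal_mult'')
  also have "\<dots> = ennreal (exp (\<beta> * c)) * ?Z"
    by (rule nn_integral_cmult) measurable
  finally have Z1: "ennreal (exp (\<beta> * c)) * ?Z = 1" by simp
  have "?Z = (ennreal (exp (- (\<beta> * c))) * ennreal (exp (\<beta> * c))) * ?Z"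
    by (simp flip: ennreal_mult'' exp_add)
  also have "\<dots> = ennreal (exp (- (\<beta> * c)))" unfolding mult.assoc Z1 by simp
  finally have Z: "?Z = ennreal (exp (- (\<beta> * c)))" .
  have mean: "(\<integral>\<^sup>+x. ennreal (q x * exp (- q x)) \<partial>lborel) = ennreal (real ?n * exp (- (\<beta> * c)))"
    using polar_mean_homogeneous[of q] q qpos Z by (simp flip: ennreal_mult'')
  define g where "g x = exp (\<beta> * f x) * (\<beta> * f x)" for x
  have [measurable]: "g \<in> borel_measurable borel" unfolding g_def[abs_def] by measurable
  have gx: "g (x0 + x) = exp (\<beta> * c) * (\<beta> * c * exp (- q x) - q x * exp (- q x))" for x
    by (simp add: g_def fq exp_diff exp_minus divide_inverse algebra_simps)
  have i1: "integrable lborel (\<lambda>x. exp (- q x))" "(\<integral>x. exp (- q x) \<partial>lborel) = exp (- (\<beta> * c))"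
    using Z by (auto intro!: integrableI_nonneg simp: integral_eq_nn_integral)
  have i2: "integrable lborel (\<lambda>x. q x * exp (- q x))" "(\<integral>x. q x * exp (- q x) \<partial>lborel) = real ?n * exp (- (\<beta> * c))"
    using mean q(1) by (auto intro!: integrableI_nonneg simp: integral_eq_nn_integral)
  have ig': "integrable lborel (\<lambda>x. g (x0 + x))" unfolding gx using i1 i2 by auto
  have D: "distr lborel borel ((+) x0) = lborel" by (rule lborel_distr_plus)
  have ig: "integrable lborel g"
    using ig' integrable_distr_eq[of "(+) x0" lborel borel g] unfolding D by simp
  have "(\<integral>x. g x \<partial>lborel) = (\<integral>x. g (x0 + x) \<partial>lborel)"
    using integral_distr[of "(+) x0" lborel borel g] unfolding D by simp
  also have "\<dots> = exp (\<beta> * c) * (\<beta> * c * exp (- (\<beta> * c)) - real ?n * exp (- (\<beta> * c)))"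
    unfolding gx using i1 i2 by simp
  also have "\<dots> = \<beta> * c - real ?n"
    by (simp add: exp_minus field_simps)
  finally have Eg: "(\<integral>x. g x \<partial>lborel) = \<beta> * c - real ?n" .
  let ?P = "\<integral>\<^sup>+x. ennreal (g x) \<partial>lborel" and ?Q = "\<integral>\<^sup>+x. ennreal (- g x) \<partial>lborel"
  have max0: "ennreal (max 0 y) = ennreal y" for y by (simp add: max_def ennreal_neg)
  have PQ: "?P < top" "?Q < top"
    using ig unfolding real_integrable_def by (auto simp: less_top)
  obtain p where p: "?P = ennreal p" "0 \<le> p"
    using PQ(1) by (rule less_top_ennreal[THEN iffD1, THEN exE]) auto
  obtain r where r: "?Q = ennreal r" "0 \<le> r"
    using PQ(2) by (rule less_top_ennreal[THEN iffD1, THEN exE]) auto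
  have "(\<integral>x. g x \<partial>lborel) = p - r"
    unfolding real_lebesgue_integral_def[OF ig] p r using p r by simp
  moreover have "Ent \<beta> f = enn2ereal ?P - enn2ereal ?Q"
    by (simp only: Ent_def max0 g_def ln_exp)
  ultimately have Ent: "Ent \<beta> f = ereal (\<beta> * c - real ?n)"
    using p r Eg by simp
  have "(\<integral>\<^sup>+\<xi>. ennreal (exp (- lip_norm f \<xi>)) \<partial>lborel) = ennreal (\<beta> ^ ?n * exp (- (\<beta> * c)))"
    unfolding partition_scale[OF lip \<beta>] using Z \<beta> by (simp add: N q_def[abs_def] flip: ennreal_mult'')
  then have "real ?n * ln (\<beta> * kconst ?n / exp 1 * E_inf f) = real ?n * ln \<beta> - real ?n - ln (\<beta> ^ ?n * exp (- (\<beta> * c)))"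
    using \<beta> by (intro entropy_rhs_eq[OF lip \<beta>]) auto
  also have "\<dots> = \<beta> * c - real ?n"
    using \<beta> by (simp add: ln_mult ln_realpow)
  finally show ?thesis unfolding Ent by simp
qed

theorem theorem1p2:
  fixes \<beta> :: real
  assumes "\<beta> > 0"
  shows "(\<forall>f :: real^'n \<Rightarrow> real.
            (\<exists>L. L-lipschitz_on UNIV f) \<and>
            (\<integral>\<^sup>+ x. ennreal (exp (\<beta> * f x)) \<partial>lborel) = 1 \<longrightarrow>
            Ent \<beta> f \<le> ereal (real CARD('n) *
               ln (\<beta> * kconst CARD('n) / exp 1 * E_inf f)))
       \<and> (\<forall>(a :: real^'n) (b :: real) (c :: real) (A :: real^'n^'n).
            b > 0 \<and> det A = 1 \<and>
            (\<integral>\<^sup>+ x. ennreal (exp (\<beta> * (c - b * norm (A *v x - a)))) \<partial>lborel) = 1 \<longrightarrow>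
            Ent \<beta> (\<lambda>x. c - b * norm (A *v x - a)) =
              ereal (real CARD('n) *
               ln (\<beta> * kconst CARD('n) / exp 1 * E_inf (\<lambda>x. c - b * norm (A *v x - a)))))"
proof (intro conjI allI impI; elim conjE exE)
  fix f :: "real^'n \<Rightarrow> real" and L
  assume "L-lipschitz_on UNIV f" "(\<integral>\<^sup>+ x. ennreal (exp (\<beta> * f x)) \<partial>lborel) = 1"
  then show "Ent \<beta> f \<le> ereal (real CARD('n) * ln (\<beta> * kconst CARD('n) / exp 1 * E_inf f))"
    by (rule entropy_upper_bound[OF assms])
next
  fix a :: "real^'n" and b c :: real and A :: "real^'n^'n"
  assume b: "b > 0" and A: "det A = 1"
    and one: "(\<integral>\<^sup>+ x. ennreal (exp (\<beta> * (c - b * norm (A *v x - a)))) \<partial>lborel) = 1"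
  have "invertible A" using A by (simp add: invertible_det_nz)
  then show "Ent \<beta> (\<lambda>x. c - b * norm (A *v x - a)) =
      ereal (real CARD('n) * ln (\<beta> * kconst CARD('n) / exp 1 * E_inf (\<lambda>x. c - b * norm (A *v x - a))))"
    by (rule entropy_cone[OF assms b _ one])
qed

end
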